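(* There exists $\alpha_0 > 0$ so that for every $0 < \alpha \leq \alpha_0$ there is an integer $n_0$ for which every graph on $n \geq n_0$ vertices with minimum degree $\delta \geq (1/2+\alpha)n$ and maximum degree $\Delta \leq \delta + \alpha^2 n/5$ contains at least $(\delta - \alpha n)/2$ edge-disjoint Hamilton cycles.
   Context: Graphs are finite and simple. A set of Hamilton cycles is edge-disjoint if no edge of the graph lies in two of them. *)

theory Defs
  imports Complex_Main "HOL-Library.Disjoint_Sets"
begin

definition simple_graph :: "'a set \<Rightarrow> 'a set set \<Rightarrow> bool" where
  "simple_graph V E \<longleftrightarrow> finite V \<and> (\<forall>e\<in>E. e \<subseteq> V \<and> card e = 2)"

definition degree :: "'a set set \<Rightarrow> 'a \<Rightarrow> nat" where
  "degree E v = card {e \<in> E. v \<in> e}"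

text \<open>\<^const>\<open>Min\<close> and \<^const>\<open>Max\<close> of the empty set are unspecified, so the next two definitions are
  meaningful only for a nonempty finite vertex set.\<close>

definition min_degree :: "'a set \<Rightarrow> 'a set set \<Rightarrow> nat" where
  "min_degree V E = Min (degree E ` V)"

definition max_degree :: "'a set \<Rightarrow> 'a set set \<Rightarrow> nat" where
  "max_degree V E = Max (degree E ` V)"

definition cycle_edges :: "'a list \<Rightarrow> 'a set set" where
  "cycle_edges vs = {{vs ! i, vs ! (Suc i mod length vs)} | i. i < length vs}"

text \<open>A Hamilton cycle is identified with its edge set, so two vertex sequences that differ only by
  rotation or reversal give the same cycle and are counted once.\<close>

definition hamilton_cycle :: "'a set \<Rightarrow> 'a set set \<Rightarrow> 'a set set \<Rightarrow> bool" where
  "hamilton_cycle V E C \<longleftrightarrow>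
     (\<exists>vs. distinct vs \<and> set vs = V \<and> 3 \<le> length vs \<and> C = cycle_edges vs \<and> C \<subseteq> E)"

definition edge_disjoint_hamilton_cycles :: "'a set \<Rightarrow> 'a set set \<Rightarrow> 'a set set set \<Rightarrow> bool" where
  "edge_disjoint_hamilton_cycles V E H \<longleftrightarrow> (\<forall>C\<in>H. hamilton_cycle V E C) \<and> disjoint H"

end

theory Submission
  imports "HOL-Probability.Probability" "HOL-Real_Asymp.Real_Asymp" "HOL-Number_Theory.Cong" Defs
begin

text \<open>
  Write \<open>d\<close> for the minimum degree. Shifting weight along triangles gives an exactly regular
  fractional spanning subgraph of degree \<open>(1 - \<alpha>/5) * d\<close>; randomised rounding turns it into an almost
  regular graph \<open>E'\<close> whose degrees still exceed \<open>n/2\<close> by a linear amount.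

  Split the vertices randomly into \<open>p - 1\<close> parts, \<open>p\<close> a large prime. For \<open>1 \<le> m \<le> (p - 1)/2\<close> ordering
  the parts by \<open>a * m mod p\<close> gives a Hamilton path on the parts, and these paths decompose the complete
  graph on the parts. Colouring the bipartite graphs along the \<open>m\<close>-th path by Koenig's theorem and
  uniting the matchings of one colour gives, for each pair \<open>(m, c)\<close>, a linear forest. Together
  these forests use almost all edges of \<open>E'\<close>, and almost all of them have \<open>O(n/p)\<close> components. From the
  forest with index \<open>i\<close> the set \<open>S i\<close> of vertices in the first \<open>s0\<close> parts of its path is deleted.

  A random choice of few colours is put into two reservoirs. Components of the forest \<open>i\<close> are linked
  to a cycle by paths \<open>x, s, z\<close> with \<open>s \<in> S i\<close> and edges from the first reservoir, and each remaining
  \<open>s \<in> S i\<close> is inserted into a forest edge both of whose ends are joined to \<open>s\<close> in the second reservoir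
  (such edges exist since degrees exceed \<open>n/2\<close>, as in the proof of Dirac's theorem). The order along the
  forest never changes, so the number of admissible choices depends only on the colouring, and
  polynomially many events have to be controlled when the reservoirs are drawn. The cycles are
  built one after the other, avoiding vertices whose reservoir edges have been used too often.
\<close>

section \<open>Concentration\<close>

text \<open>Each cycle depends on the earlier ones, so no random choice could be analysed while they
  are built. All randomness is spent beforehand, on statements about every forest and every pair of
  vertices at once; after that only counting is left. The constants balance two demands. A vertex
  lies in \<open>S i\<close> for at most \<open>s0\<close> of the paths, so s0/p governs both the
  size of \<open>S i\<close> and the strain on the second reservoir. It has to be small in terms of
  \<alpha>, since an absorbed vertex finds only about \<alpha> * n forest edges. A link, however,
  finds only about (s0/p) * \<alpha> * n vertices, against O(n/p) components and a strain of order
  sqrt(1/p). Hence \<open>s0\<close> is a small constant fraction of \<open>p\<close>, and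
  \<open>p\<close> is far larger than that fraction alone would require. The bound
  \<open>\<alpha>\<^sup>2 * n / 5\<close> on the spread of the degrees is what the weight shift
  tolerates: the excess of a vertex is spread over at least \<open>\<alpha> * n\<^sup>2 / 2\<close>
  triangles, so that every edge changes by O(\<alpha>). Of the permitted loss of \<alpha> * n / 2
  cycles, regularising takes at most \<alpha> * n / 10 and the packing at most \<alpha> * n /
  4.\<close>

text \<open>Hoeffding's inequality for each sum and a union bound over \<open>K\<close> leave an
  outcome that is good for all sums. It is returned as a plain function, so that the arguments built
  on it are deterministic.\<close>

lemma hoeffding_exists:
  fixes p :: "'i \<Rightarrow> 'b pmf" and X :: "'k \<Rightarrow> 'i \<Rightarrow> 'b \<Rightarrow> real" and t B N :: real
  assumes I: "finite I" and K: "finite K"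
    and A: "\<And>k. k \<in> K \<Longrightarrow> A k \<subseteq> I" "\<And>k. k \<in> K \<Longrightarrow> real (card (A k)) \<le> N"
    and X: "\<And>k i y. k \<in> K \<Longrightarrow> i \<in> I \<Longrightarrow> 0 \<le> X k i y \<and> X k i y \<le> B"
    and pos: "t > 0" "B > 0" "N > 0"
    and small: "real (card K) * (2 * exp (- 2 * t\<^sup>2 / (N * B\<^sup>2))) < 1"
  obtains f where "\<And>i. i \<in> I \<Longrightarrow> f i \<in> set_pmf (p i)"
    "\<And>k. k \<in> K \<Longrightarrow>
       \<bar>(\<Sum>i\<in>A k. X k i (f i)) - (\<Sum>i\<in>A k. measure_pmf.expectation (p i) (X k i))\<bar> < t"
proof -
  define M where "M = Pi_pmf I undefined p"
  define mu where "mu k = (\<Sum>i\<in>A k. measure_pmf.expectation (p i) (X k i))" for k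
  define bad where "bad k = {f. \<bar>(\<Sum>i\<in>A k. X k i (f i)) - mu k\<bar> \<ge> t}" for k
  have bad_le: "measure_pmf.prob M (bad k) \<le> 2 * exp (- 2 * t\<^sup>2 / (N * B\<^sup>2))" if k: "k \<in> K" for k
  proof (cases "A k = {}")
    case True
    then have "bad k = {}" using pos by (simp add: bad_def mu_def)
    then show ?thesis by simp
  next
    case False
    have fin: "finite (A k)" using A(1)[OF k] I finite_subset by blast
    have ex: "measure_pmf.expectation M (\<lambda>f. X k i (f i)) = measure_pmf.expectation (p i) (X k i)"
      if "i \<in> A k" for i
    proof -
      have "map_pmf (\<lambda>f. f i) M = p i"
        unfolding M_def using that A(1)[OF k] I by (subst Pi_pmf_component) auto
      then show ?thesis using integral_map_pmf[of "\<lambda>f. f i" M "X k i"] by simp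
    qed
    interpret H: indep_interval_bounded_random_variables "measure_pmf M" "A k"
        "\<lambda>i f. X k i (f i)" "\<lambda>_. 0" "\<lambda>_. B"
    proof unfold_locales
      show "finite (A k)" by (rule fin)
      have "prob_space.indep_vars (measure_pmf M) (\<lambda>_. count_space UNIV) (\<lambda>i f. f i) (A k)"
        unfolding M_def by (rule prob_space.indep_vars_subset[OF measure_pmf.prob_space_axioms indep_vars_Pi_pmf[OF I] A(1)[OF k]])
      then show "prob_space.indep_vars (measure_pmf M) (\<lambda>_. borel) (\<lambda>i f. X k i (f i)) (A k)"
        by (rule prob_space.indep_vars_compose2[OF measure_pmf.prob_space_axioms]) auto
      show "AE f in measure_pmf M. X k i (f i) \<in> {0..B}" if "i \<in> A k" for i
        using X[OF k] that A(1)[OF k] by (intro always_eventually) auto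
    qed
    interpret H: Hoeffding_ineq "measure_pmf M" "A k" "\<lambda>i f. X k i (f i)" "\<lambda>_. 0" "\<lambda>_. B" "mu k"
      by unfold_locales (simp add: mu_def ex cong: sum.cong)
    have cpos: "real (card (A k)) > 0" using False fin by (simp add: card_gt_0_iff)
    have "measure_pmf.prob M (bad k) \<le> 2 * exp (-2 * t\<^sup>2 / (\<Sum>i\<in>A k. (B - 0)\<^sup>2))"
      unfolding bad_def using H.Hoeffding_ineq_abs_ge[of t] pos cpos by simp
    also have "\<dots> = 2 * exp (-2 * t\<^sup>2 / (card (A k) * B\<^sup>2))" by simp
    also have "\<dots> \<le> 2 * exp (-2 * t\<^sup>2 / (N * B\<^sup>2))"
    proof -
      have "2 * t\<^sup>2 / (N * B\<^sup>2) \<le> 2 * t\<^sup>2 / (card (A k) * B\<^sup>2)"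
        using A(2)[OF k] cpos pos by (intro divide_left_mono mult_right_mono) auto
      then show ?thesis by simp
    qed
    finally show ?thesis .
  qed
  have "measure_pmf.prob M (\<Union>k\<in>K. bad k) \<le> (\<Sum>k\<in>K. measure_pmf.prob M (bad k))"
    by (intro measure_pmf.finite_measure_subadditive_finite) (auto simp: K)
  also have "\<dots> \<le> (\<Sum>k\<in>K. 2 * exp (- 2 * t\<^sup>2 / (N * B\<^sup>2)))"
    by (intro sum_mono bad_le)
  also have "\<dots> < 1" using small by simp
  finally have lt: "measure_pmf.prob M (\<Union>k\<in>K. bad k) < 1" .
  \<comment> \<open>An event of probability below one cannot contain the whole support; a point of
    the support outside it has all its values in the supports of the \<open>p i\<close>.\<close>
  have "\<not> set_pmf M \<subseteq> (\<Union>k\<in>K. bad k)"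
  proof
    assume "set_pmf M \<subseteq> (\<Union>k\<in>K. bad k)"
    then have "measure_pmf.prob M (\<Union>k\<in>K. bad k) = 1"
      by (subst measure_pmf.prob_eq_1) (auto simp: AE_measure_pmf_iff)
    with lt show False by simp
  qed
  then obtain f where f: "f \<in> set_pmf M" "f \<notin> (\<Union>k\<in>K. bad k)" by blast
  show thesis
  proof (rule that)
    show "f i \<in> set_pmf (p i)" if "i \<in> I" for i
      using f(1) that set_Pi_pmf[OF I, of undefined p] unfolding M_def
      by (auto simp: PiE_dflt_def)
    show "\<bar>(\<Sum>i\<in>A k. X k i (f i)) - (\<Sum>i\<in>A k. measure_pmf.expectation (p i) (X k i))\<bar> < t"
      if "k \<in> K" for k
      using f(2) that by (auto simp: bad_def mu_def not_le)
  qed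
qed

text \<open>Exponential decay beats a polynomial number of events. The expression has the shape of
  the smallness hypotheses of the random choices below.\<close>

lemma eventually_union_bound_small:
  fixes c C :: real
  assumes "c > 0"
  shows "\<forall>\<^sub>F n::nat in sequentially. C * real n ^ d * (2 * exp (- c * real n)) < 1"
proof -
  have "((\<lambda>n::nat. C * real n ^ d * (2 * exp (- c * real n))) \<longlongrightarrow> 0) sequentially"
    using assms by real_asymp
  then show ?thesis by (rule order_tendstoD) simp
qed

section \<open>Almost regular subgraphs\<close>

definition nbr :: "'a set set \<Rightarrow> 'a \<Rightarrow> 'a set" where
  "nbr E v = {u. {v, u} \<in> E}"

lemma mem_nbr: "u \<in> nbr E v \<longleftrightarrow> {v, u} \<in> E"
  by (simp add: nbr_def)

lemma simple_graph_edgeD: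
  assumes "simple_graph V E" "{u, v} \<in> E"
  shows "u \<in> V" "v \<in> V" "u \<noteq> v"
  using assms by (fastforce simp: simple_graph_def)+

lemma simple_graph_subset: "simple_graph V E \<Longrightarrow> F \<subseteq> E \<Longrightarrow> simple_graph V F"
  by (auto simp: simple_graph_def)

lemma simple_graph_finite_edges: "simple_graph V E \<Longrightarrow> finite E"
  by (rule finite_subset[of _ "Pow V"]) (auto simp: simple_graph_def)

lemma nbr_subset: "simple_graph V E \<Longrightarrow> nbr E v \<subseteq> V"
  by (auto simp: nbr_def dest: simple_graph_edgeD)

lemma finite_nbr: "simple_graph V E \<Longrightarrow> finite (nbr E v)"
  using nbr_subset finite_subset by (metis simple_graph_def)

lemma incident_edges_eq:
  assumes "simple_graph V E"
  shows "{e \<in> E. v \<in> e} = (\<lambda>u. {v, u}) ` nbr E v"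
proof (intro equalityI subsetI)
  fix e assume e: "e \<in> {e \<in> E. v \<in> e}"
  then have "card e = 2" using assms by (auto simp: simple_graph_def)
  then obtain x y where "e = {x, y}" by (auto simp: card_2_iff)
  with e show "e \<in> (\<lambda>u. {v, u}) ` nbr E v" by (auto simp: nbr_def insert_commute)
qed (auto simp: nbr_def)

lemma inj_on_insert_pair: "inj_on (\<lambda>u. {v, u}) A"
  by (auto simp: inj_on_def doubleton_eq_iff)

lemma degree_eq_card_nbr: "simple_graph V E \<Longrightarrow> Defs.degree E v = card (nbr E v)"
  unfolding Defs.degree_def by (simp add: incident_edges_eq card_image inj_on_insert_pair)

lemma card_nbr_le: "simple_graph V E \<Longrightarrow> card (nbr E v) \<le> card V"
  by (simp add: card_mono nbr_subset simple_graph_def)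

text \<open>For a triangle x u v, taking \<open>q x\<close> off the edges x u and x v and adding it
  to u v keeps the degrees of u and v and lowers that of x by twice \<open>q x\<close>. Doing this
  at every apex x removes the excess over \<open>d\<close> that remains once every edge has given up
  \<alpha>/5. This uniform loss makes room for the added weight, so that no edge exceeds 1.\<close>

lemma fractional_regular:
  fixes V :: "'a set" and \<alpha> d :: real
  assumes G: "simple_graph V E" and n: "card V = n" "n > 0"
    and \<alpha>: "0 < \<alpha>" "\<alpha> \<le> 1"
    and deg: "\<And>v. v \<in> V \<Longrightarrow> d \<le> card (nbr E v)"
      "\<And>v. v \<in> V \<Longrightarrow> card (nbr E v) \<le> d + \<alpha>\<^sup>2 * n / 5"
    and d: "d \<ge> (1/2 + \<alpha>) * n"
  obtains W :: "'a set \<Rightarrow> real" where "\<And>e. e \<in> E \<Longrightarrow> 0 \<le> W e \<and> W e \<le> 1"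
    "\<And>u. u \<in> V \<Longrightarrow> (\<Sum>e | e \<in> E \<and> u \<in> e. W e) = (1 - \<alpha>/5) * d"
proof -
  have finV: "finite V" using G by (simp add: simple_graph_def)
  define a where "a u v = (of_bool ({u,v} \<in> E) :: real)" for u v
  have a_comm: "a u v = a v u" for u v by (simp add: a_def insert_commute)
  have a01: "0 \<le> a u v" "a u v \<le> 1" for u v by (auto simp: a_def)
  define cod where "cod u v = (\<Sum>x\<in>V. a u x * a v x)" for u v
  define T where "T u = (\<Sum>v\<in>V. a u v * cod u v)" for u
  define D where "D u = (\<Sum>v\<in>V. a u v)" for u
  have D_eq: "D u = card (nbr E u)" for u
  proof -
    have "D u = (\<Sum>v\<in>V. if v \<in> nbr E u then 1 else 0)"
      unfolding D_def by (intro sum.cong) (auto simp: a_def nbr_def)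
    also have "\<dots> = card (V \<inter> nbr E u)"
      using finV by (subst sum.inter_restrict[symmetric]) auto
    also have "V \<inter> nbr E u = nbr E u" using nbr_subset[OF G] by auto
    finally show ?thesis .
  qed
  have cod_lower: "cod u v \<ge> 2 * \<alpha> * n" if "u \<in> V" "v \<in> V" for u v
  proof -
    have "2 * \<alpha> * n \<le> D u + D v - n"
      using deg(1)[OF that(1)] deg(1)[OF that(2)] d by (simp add: D_eq algebra_simps)
    also have "\<dots> = (\<Sum>x\<in>V. a u x + a v x - 1)"
      by (simp add: D_def sum.distrib sum_subtractf n)
    also have "\<dots> \<le> cod u v" unfolding cod_def
      by (intro sum_mono) (auto simp: a_def)
    finally show ?thesis .
  qed
  have cod_nonneg: "0 \<le> cod u v" for u v
    unfolding cod_def by (intro sum_nonneg mult_nonneg_nonneg a01)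
  have cod_upper: "cod u v \<le> n" for u v
  proof -
    have "cod u v \<le> (\<Sum>x\<in>V. 1)" unfolding cod_def
      by (intro sum_mono) (auto simp: a_def)
    then show ?thesis by (simp add: n)
  qed
  have T_lower: "T u \<ge> \<alpha> * n\<^sup>2" if u: "u \<in> V" for u
  proof -
    have "\<alpha> * n\<^sup>2 \<le> (2 * \<alpha> * n) * D u"
    proof -
      have "D u \<ge> n / 2" using deg(1)[OF u] d \<alpha> unfolding D_eq
        by (smt (verit) mult_nonneg_nonneg distrib_right of_nat_0_le_iff mult.commute times_divide_eq_left
            divide_inverse inverse_eq_divide mult_1)
      then have "(2 * \<alpha> * n) * (n / 2) \<le> (2 * \<alpha> * n) * D u"
        using \<alpha> by (intro mult_left_mono) auto
      then show ?thesis by (simp add: power2_eq_square)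
    qed
    also have "\<dots> = (\<Sum>v\<in>V. a u v * (2 * \<alpha> * n))"
      unfolding D_def by (subst mult.commute) (simp add: sum_distrib_right)
    also have "\<dots> \<le> T u" unfolding T_def
      using cod_lower u a01 by (intro sum_mono mult_left_mono) auto
    finally show ?thesis .
  qed
  \<comment> \<open>\<open>T u\<close> is twice the number of triangles at \<open>u\<close>, so the
    shifts with apex \<open>u\<close> lower its degree by \<open>q u * T u\<close>.\<close>
  define q where "q u = (1 - \<alpha>/5) * (D u - d) / T u" for u
  have an2: "\<alpha> * n\<^sup>2 > 0" using \<alpha> n by simp
  have q0: "0 \<le> q u" if "u \<in> V" for u
    unfolding q_def using T_lower[OF that] an2 deg(1)[OF that] \<alpha> D_eq[of u]
    by (intro divide_nonneg_nonneg mult_nonneg_nonneg) auto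
  \<comment> \<open>The bound on the maximum degree enters here: an excess of at most
    \<open>\<alpha>\<^sup>2 * n / 5\<close> is divided by at least
    \<open>\<alpha> * n\<^sup>2\<close>. A sum of \<open>n\<close> such weights then stays within
    the uniform loss \<alpha>/5.\<close>
  have q1: "q u \<le> \<alpha> / (5 * n)" if "u \<in> V" for u
  proof -
    have "q u \<le> (\<alpha>\<^sup>2 * n / 5) / (\<alpha> * n\<^sup>2)"
      unfolding q_def
    proof (intro frac_le)
      have "(1 - \<alpha>/5) * (D u - d) \<le> 1 * (D u - d)"
        using deg(1)[OF that] \<alpha> by (intro mult_right_mono) (auto simp: D_eq)
      then show "(1 - \<alpha>/5) * (D u - d) \<le> \<alpha>\<^sup>2 * n / 5"
        using deg(2)[OF that] by (simp add: D_eq)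
    qed (use an2 T_lower[OF that] in auto)
    also have "\<dots> = \<alpha> / (5 * n)" using \<alpha> n by (simp add: power2_eq_square)
    finally show ?thesis .
  qed
  \<comment> \<open>The weight taken from an edge: the uniform loss, the shifts with apex
    \<open>u\<close> or \<open>v\<close>, and with negative sign the gain from shifts whose apex is
    a common neighbour.\<close>
  define h where "h u v = \<alpha>/5 + q u * cod u v + q v * cod u v - (\<Sum>x\<in>V. a x u * a x v * q x)" for u v
  have h_bounds: "0 \<le> h u v \<and> h u v \<le> 1" if "u \<in> V" "v \<in> V" for u v
  proof -
    have s1: "(\<Sum>x\<in>V. a x u * a x v * q x) \<le> (\<Sum>x\<in>V. \<alpha> / (5 * n))"
    proof (intro sum_mono)
      fix x assume x: "x \<in> V"
      have "a x u * a x v * q x \<le> 1 * q x"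
        using q0[OF x] by (intro mult_right_mono) (auto simp: a_def)
      then show "a x u * a x v * q x \<le> \<alpha> / (5 * n)" using q1[OF x] by simp
    qed
    also have "\<dots> = \<alpha> / 5" using n by simp
    finally have s1: "(\<Sum>x\<in>V. a x u * a x v * q x) \<le> \<alpha> / 5" .
    have s2: "0 \<le> (\<Sum>x\<in>V. a x u * a x v * q x)"
      using q0 a01 by (intro sum_nonneg mult_nonneg_nonneg) auto
    have qc: "0 \<le> q y * cod u v \<and> q y * cod u v \<le> \<alpha> / 5" if y: "y \<in> V" for y
    proof -
      have "q y * cod u v \<le> (\<alpha> / (5 * n)) * n"
        using q0[OF y] q1[OF y] cod_nonneg cod_upper by (intro mult_mono) auto
      then show ?thesis using n q0[OF y] cod_nonneg by simp
    qed
    show ?thesis using s1 s2 qc[OF that(1)] qc[OF that(2)] \<alpha> unfolding h_def by linarith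
  qed
  have h_sum: "(\<Sum>v\<in>V. a u v * h u v) = D u - (1 - \<alpha>/5) * d" if u: "u \<in> V" for u
  proof -
    have "(\<Sum>v\<in>V. a u v * h u v) =
      (\<Sum>v\<in>V. a u v * (\<alpha>/5) + q u * (a u v * cod u v) + a u v * q v * cod u v
         - (\<Sum>x\<in>V. a u v * (a x u * a x v * q x)))"
      unfolding h_def by (intro sum.cong) (auto simp: algebra_simps sum_distrib_left)
    also have "\<dots> = D u * (\<alpha>/5) + q u * T u + (\<Sum>v\<in>V. a u v * q v * cod u v)
        - (\<Sum>v\<in>V. \<Sum>x\<in>V. a u v * (a x u * a x v * q x))"
      unfolding D_def T_def
      by (simp add: sum.distrib sum_subtractf sum_distrib_left sum_distrib_right)
    \<comment> \<open>After the exchange this double sum equals the single sum before it and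
      cancels: shifts with an apex other than \<open>u\<close> do not change the degree of
      \<open>u\<close>.\<close>
    also have "(\<Sum>v\<in>V. \<Sum>x\<in>V. a u v * (a x u * a x v * q x))
        = (\<Sum>x\<in>V. \<Sum>v\<in>V. a u v * (a x u * a x v * q x))" by (rule sum.swap)
    also have "\<dots> = (\<Sum>x\<in>V. a u x * q x * cod u x)"
      unfolding cod_def sum_distrib_left
      by (intro sum.cong refl) (simp add: a_comm[of _ u] mult_ac)
    finally have *: "(\<Sum>v\<in>V. a u v * h u v) = D u * (\<alpha>/5) + q u * T u" by simp
    have "T u > 0" using T_lower[OF u] an2 by linarith
    then have "q u * T u = (1 - \<alpha>/5) * (D u - d)" by (simp add: q_def)
    with * show ?thesis by (simp add: algebra_simps diff_divide_distrib)
  qed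
  \<comment> \<open>\<open>h\<close> takes ordered pairs, while weights live on edges as sets; sums
    and products over the two elements of \<open>e\<close> translate the symmetric
    expression.\<close>
  define W where "W e = 1 - (\<alpha>/5 + (\<Sum>y\<in>e. q y) * (\<Sum>x\<in>V. \<Prod>y\<in>e. a y x)
      - (\<Sum>x\<in>V. (\<Prod>y\<in>e. a x y) * q x))" for e
  have W: "W {u, v} = 1 - h u v" if "{u, v} \<in> E" for u v
    using simple_graph_edgeD[OF G that]
    by (simp add: W_def h_def cod_def algebra_simps)
  show thesis
  proof (rule that[of W])
    fix e assume e: "e \<in> E"
    then have "card e = 2" using G by (auto simp: simple_graph_def)
    then obtain u v where uv: "e = {u, v}" by (auto simp: card_2_iff)
    show "0 \<le> W e \<and> W e \<le> 1"
      using W[of u v] h_bounds[of u v] simple_graph_edgeD[OF G, of u v] e uv by auto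
  next
    fix u assume u: "u \<in> V"
    have "(\<Sum>e | e \<in> E \<and> u \<in> e. W e) = (\<Sum>v\<in>nbr E u. W {u, v})"
      unfolding incident_edges_eq[OF G] by (subst sum.reindex) (auto simp: inj_on_insert_pair)
    also have "\<dots> = (\<Sum>v\<in>nbr E u. 1 - h u v)"
      by (intro sum.cong refl W) (simp add: nbr_def)
    also have "\<dots> = (\<Sum>v\<in>V. if v \<in> nbr E u then 1 - h u v else 0)"
    proof -
      have "nbr E u = V \<inter> nbr E u" using nbr_subset[OF G] by auto
      then show ?thesis using finV by (metis sum.inter_restrict)
    qed
    also have "\<dots> = (\<Sum>v\<in>V. a u v - a u v * h u v)"
      by (intro sum.cong) (auto simp: a_def nbr_def)
    also have "\<dots> = (1 - \<alpha>/5) * d"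
      using h_sum[OF u] by (simp add: sum_subtractf D_def)
    finally show "(\<Sum>e | e \<in> E \<and> u \<in> e. W e) = (1 - \<alpha>/5) * d" .
  qed
qed

text \<open>Keeping each edge independently with probability \<open>W e\<close> gives every degree
  the mean \<open>r\<close>, and a degree is a sum of at most \<open>card V\<close> independent
  indicators.\<close>

lemma random_subgraph:
  fixes \<epsilon> r :: real and V :: "'a set" and W :: "'a set \<Rightarrow> real"
  assumes \<epsilon>: "\<epsilon> > 0" and G: "simple_graph V E" and n: "card V \<ge> 1"
    and W: "\<And>e. e \<in> E \<Longrightarrow> 0 \<le> W e \<and> W e \<le> 1"
    and sum: "\<And>u. u \<in> V \<Longrightarrow> (\<Sum>e | e \<in> E \<and> u \<in> e. W e) = r"
    and small: "real (card V) * (2 * exp (- (2 * \<epsilon>\<^sup>2) * real (card V))) < 1"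
  shows "\<exists>E'\<subseteq>E. \<forall>v\<in>V. \<bar>real (card (nbr E' v)) - r\<bar> < \<epsilon> * card V"
proof -
  have finV: "finite V" using G by (simp add: simple_graph_def)
  define N where "N = real (card V)"
  have N: "N > 0" using n by (simp add: N_def)
  obtain f where f: "\<And>v. v \<in> V \<Longrightarrow>
     \<bar>(\<Sum>e | e \<in> E \<and> v \<in> e. of_bool (f e)) -
      (\<Sum>e | e \<in> E \<and> v \<in> e. measure_pmf.expectation (bernoulli_pmf (W e)) of_bool)\<bar> < \<epsilon> * N"
  proof (rule hoeffding_exists[where I = E and K = V and A = "\<lambda>v. {e \<in> E. v \<in> e}"
       and X = "\<lambda>_ _. of_bool :: bool \<Rightarrow> real"
       and p = "\<lambda>e. bernoulli_pmf (W e)" and t = "\<epsilon> * N" and B = 1 and N = N])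
    show "real (card {e \<in> E. v \<in> e}) \<le> N" for v
      using card_nbr_le[OF G, of v] degree_eq_card_nbr[OF G, of v] by (simp add: Defs.degree_def N_def)
    have "2 * (\<epsilon> * N)\<^sup>2 / (N * 1\<^sup>2) = 2 * \<epsilon>\<^sup>2 * N"
      using N by (simp add: power2_eq_square)
    then show "real (card V) * (2 * exp (- 2 * (\<epsilon> * N)\<^sup>2 / (N * 1\<^sup>2))) < 1"
      using small by (simp add: N_def)
  qed (use simple_graph_finite_edges[OF G] finV \<epsilon> N in auto)
  show "\<exists>E'\<subseteq>E. \<forall>v\<in>V. \<bar>real (card (nbr E' v)) - r\<bar> < \<epsilon> * card V"
  proof (intro exI[of _ "{e \<in> E. f e}"] conjI ballI)
    fix v assume v: "v \<in> V"
    have fin: "finite {e \<in> E. v \<in> e}" using simple_graph_finite_edges[OF G] by simp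
    have "(\<Sum>e | e \<in> E \<and> v \<in> e. of_bool (f e)) = real (card ({e \<in> E. v \<in> e} \<inter> {e. f e}))"
      using fin by (simp add: of_bool_def sum.If_cases)
    also have "{e \<in> E. v \<in> e} \<inter> {e. f e} = {e \<in> {e \<in> E. f e}. v \<in> e}" by auto
    also have "card \<dots> = card (nbr {e \<in> E. f e} v)"
      using degree_eq_card_nbr[OF simple_graph_subset[OF G], of "{e \<in> E. f e}" v]
      unfolding Defs.degree_def by simp
    finally have 1: "(\<Sum>e | e \<in> E \<and> v \<in> e. of_bool (f e)) = real (card (nbr {e \<in> E. f e} v))" .
    have 2: "(\<Sum>e | e \<in> E \<and> v \<in> e. measure_pmf.expectation (bernoulli_pmf (W e)) of_bool) = r"
      using W sum v by (subst sum.cong[OF refl, of _ _ W]) auto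
    show "\<bar>real (card (nbr {e \<in> E. f e} v)) - r\<bar> < \<epsilon> * card V"
      using f[OF v] unfolding 1 2 N_def .
  qed auto
qed

section \<open>Random partitions and random sets of colours\<close>

text \<open>Every vertex chooses one of \<open>k\<close> parts uniformly. As \<open>\<A>\<close> is
  fixed in advance and polynomially large, one partition splits all its members evenly; it will
  consist of the vertex set and all common neighbourhoods.\<close>

lemma random_partition:
  fixes \<epsilon> :: real and V :: "'a set"
  assumes \<epsilon>: "\<epsilon> > 0" and k: "k \<ge> (1::nat)"
    and finV: "finite V" and n: "card V \<ge> 1" and \<A>: "\<A> \<subseteq> Pow V" "card \<A> \<le> card V ^ 3"
    and small: "real k * real (card V) ^ 3 * (2 * exp (- (2 * \<epsilon>\<^sup>2) * real (card V))) < 1"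
  shows "\<exists>f. (\<forall>v\<in>V. f v \<in> {1..k}) \<and>
       (\<forall>A\<in>\<A>. \<forall>a\<in>{1..k}. \<bar>real (card {u \<in> A. f u = a}) - card A / k\<bar> < \<epsilon> * card V)"
proof -
  define N where "N = real (card V)"
  have N: "N > 0" using n by (simp add: N_def)
  obtain f where f: "\<And>u. u \<in> V \<Longrightarrow> f u \<in> set_pmf (pmf_of_set {1..k})"
   "\<And>\<kappa>. \<kappa> \<in> \<A> \<times> {1..k} \<Longrightarrow> \<bar>(\<Sum>u\<in>fst \<kappa>. of_bool (f u = snd \<kappa>)) -
     (\<Sum>u\<in>fst \<kappa>. measure_pmf.expectation (pmf_of_set {1..k}) (\<lambda>y. of_bool (y = snd \<kappa>)))\<bar> < \<epsilon> * N"
  proof (rule hoeffding_exists[where I = V and K = "\<A> \<times> {1..k}" and A = fst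
       and X = "\<lambda>\<kappa> u y. of_bool (y = snd \<kappa>)"
       and p = "\<lambda>_. pmf_of_set {1..k}" and t = "\<epsilon> * N" and B = 1 and N = N])
    show "finite (\<A> \<times> {1..k})" using \<A>(1) finV by (meson finite_Pow_iff finite_SigmaI finite_atLeastAtMost finite_subset)
    show "real (card (fst \<kappa>)) \<le> N" if "\<kappa> \<in> \<A> \<times> {1..k}" for \<kappa>
      using that \<A>(1) finV by (fastforce simp: N_def intro!: card_mono)
    have e: "2 * (\<epsilon> * N)\<^sup>2 / (N * 1\<^sup>2) = 2 * \<epsilon>\<^sup>2 * N"
      using N by (simp add: power2_eq_square)
    have "real (card (\<A> \<times> {1..k})) \<le> real k * N ^ 3"
    proof -
      have "card (\<A> \<times> {1..k}) \<le> card V ^ 3 * k" using \<A>(2) by (simp add: card_cartesian_product)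
      then have "real (card (\<A> \<times> {1..k})) \<le> real (card V ^ 3 * k)" by (simp only: of_nat_le_iff)
      then show ?thesis by (simp add: N_def mult.commute)
    qed
    then have "real (card (\<A> \<times> {1..k})) * (2 * exp (- (2 * \<epsilon>\<^sup>2 * N)))
        \<le> real k * N ^ 3 * (2 * exp (- (2 * \<epsilon>\<^sup>2 * N)))"
      by (intro mult_right_mono) auto
    also have "\<dots> < 1" using small by (simp add: N_def)
    finally show "real (card (\<A> \<times> {1..k})) * (2 * exp (- 2 * (\<epsilon> * N)\<^sup>2 / (N * 1\<^sup>2))) < 1"
      using e by simp
    show "fst \<kappa> \<subseteq> V" if "\<kappa> \<in> \<A> \<times> {1..k}" for \<kappa>
    proof -
      have "fst \<kappa> \<in> \<A>" using that by auto
      then have "fst \<kappa> \<in> Pow V" by (rule subsetD[OF \<A>(1)])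
      then show ?thesis by simp
    qed
  qed (use finV \<epsilon> N in auto)
  show "\<exists>f. (\<forall>v\<in>V. f v \<in> {1..k}) \<and>
     (\<forall>A\<in>\<A>. \<forall>a\<in>{1..k}. \<bar>real (card {u \<in> A. f u = a}) - card A / k\<bar> < \<epsilon> * card V)"
  proof (intro exI[of _ f] conjI ballI)
    show "f v \<in> {1..k}" if "v \<in> V" for v using f(1)[OF that] k by simp
  next
    fix A a assume A: "A \<in> \<A>" and a: "a \<in> {1..k}"
    have finA: "finite A" using A \<A>(1) finV finite_subset[of A V] by (meson PowD subsetD)
    have 1: "(\<Sum>u\<in>A. of_bool (f u = a)) = real (card {u \<in> A. f u = a})"
      using finA by (simp add: of_bool_def sum.If_cases Int_def)
    have "measure_pmf.expectation (pmf_of_set {1..k}) (\<lambda>y. of_bool (y = a)) = 1 / k"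
      using a k by (subst integral_pmf_of_set) (auto simp: of_bool_def)
    then have 2: "(\<Sum>u\<in>A. measure_pmf.expectation (pmf_of_set {1..k}) (\<lambda>y. of_bool (y = a))) = card A / k"
      by simp
    show "\<bar>real (card {u \<in> A. f u = a}) - card A / k\<bar> < \<epsilon> * card V"
      using f(2)[of "(A, a)"] A a unfolding fst_conv snd_conv 1 2 N_def by simp
  qed
qed

section \<open>Random sets of colours that preserve many local configurations\<close>

text \<open>Every colour is chosen independently with probability \<rho>. An event \<kappa> has a
  list \<open>L \<kappa>\<close> of candidates, each usable if its colour is chosen. Since a colour
  serves at most two candidates, the number of usable ones is a sum, over the colours, of
  independent terms in [0, 2].\<close>

lemma thin_colours:
  fixes \<rho> b :: real and C :: "'c set" and K :: "'k set" and L :: "'k \<Rightarrow> 'l set"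
  assumes \<rho>: "0 < \<rho>" "\<rho> \<le> 1" and b: "0 < b" "b \<le> 1" and n: "1 \<le> n"
    and C: "finite C" "card C \<le> n" and K: "finite K" "card K \<le> n ^ 3"
    and L: "\<And>\<kappa>. \<kappa> \<in> K \<Longrightarrow> finite (L \<kappa>)" "\<And>\<kappa>. \<kappa> \<in> K \<Longrightarrow> p \<kappa> ` L \<kappa> \<subseteq> C"
      "\<And>\<kappa> c. \<kappa> \<in> K \<Longrightarrow> card {l \<in> L \<kappa>. p \<kappa> l = c} \<le> 2"
      "\<And>\<kappa>. \<kappa> \<in> K \<Longrightarrow> b * n \<le> card (L \<kappa>)"
    and small: "2 * real n ^ 3 * (2 * exp (- (\<rho>\<^sup>2 * b\<^sup>2 / 8) * real n)) < 1"
  shows "\<exists>J\<subseteq>C. card J \<le> 2 * \<rho> * n \<and> (\<forall>\<kappa>\<in>K. \<rho> * b / 2 * n \<le> card {l \<in> L \<kappa>. p \<kappa> l \<in> J})"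
proof -
  define r where "r = \<rho>\<^sup>2 * b\<^sup>2 / 8"
  define fib where "fib \<kappa> c = card {l \<in> L \<kappa>. p \<kappa> l = c}" for \<kappa> c
  \<comment> \<open>The index \<open>None\<close> monitors the size of the chosen set,
    \<open>Some \<kappa>\<close> the usable candidates of \<kappa>.\<close>
  define X where "X k c (y::bool) = (case k of None \<Rightarrow> of_bool y
     | Some \<kappa> \<Rightarrow> if y then real (fib \<kappa> c) else 0)" for k c y
  define K' where "K' = insert None (Some ` K)"
  \<comment> \<open>One deviation serves both purposes: it is at most \<open>\<rho> * n\<close>,
    which keeps the size below \<open>2 * \<rho> * n\<close>, and it is half of the guaranteed mean
    \<open>\<rho> * b * n\<close>.\<close>
  define t where "t = \<rho> * b / 2 * n"
  have n1: "real n \<ge> 1" using n by simp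
  obtain f where f:
   "\<And>k. k \<in> K' \<Longrightarrow> \<bar>(\<Sum>c\<in>C. X k c (f c)) -
     (\<Sum>c\<in>C. measure_pmf.expectation (bernoulli_pmf \<rho>) (X k c))\<bar> < t"
  proof (rule hoeffding_exists[where I = C and K = K' and A = "\<lambda>_. C" and X = X
       and p = "\<lambda>_. bernoulli_pmf \<rho>" and t = t and B = 2 and N = n])
    show "0 \<le> X k c y \<and> X k c y \<le> 2" if "k \<in> K'" "c \<in> C" for k c y
      using that L(3) by (auto simp: X_def K'_def fib_def)
    have e: "2 * t\<^sup>2 / (real n * 2\<^sup>2) = r * real n"
      using n1 by (simp add: t_def r_def power2_eq_square)
    have "card K' \<le> card K + 1"
      using K(1) by (simp add: K'_def card_insert_if card_image)
    also have "\<dots> \<le> n ^ 3 + n ^ 3" using K(2) n by (intro add_mono) auto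
    finally have "real (card K') \<le> real (n ^ 3 + n ^ 3)" by (simp only: of_nat_le_iff)
    then have "real (card K') \<le> 2 * real n ^ 3" by simp
    then have "real (card K') * (2 * exp (- (r * n))) \<le> 2 * real n ^ 3 * (2 * exp (- (r * n)))"
      by (intro mult_right_mono) auto
    also have "\<dots> < 1" using small by (simp add: r_def)
    finally show "real (card K') * (2 * exp (- 2 * t\<^sup>2 / (real n * 2\<^sup>2))) < 1"
      using e by simp
    show "0 < t" using \<rho> b n1 by (simp add: t_def)
  qed (use C K n1 in \<open>auto simp: K'_def\<close>)
  define J where "J = {c \<in> C. f c}"
  show "\<exists>J\<subseteq>C. card J \<le> 2 * \<rho> * n \<and> (\<forall>\<kappa>\<in>K. \<rho> * b / 2 * n \<le> card {l \<in> L \<kappa>. p \<kappa> l \<in> J})"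
  proof (intro exI[of _ J] conjI ballI)
    have 1: "(\<Sum>c\<in>C. X None c (f c)) = real (card J)"
      using C(1) by (simp add: X_def of_bool_def sum.If_cases Int_def J_def)
    have 2: "(\<Sum>c\<in>C. measure_pmf.expectation (bernoulli_pmf \<rho>) (X None c)) = \<rho> * card C"
      using \<rho> by (simp add: X_def)
    have "real (card J) < \<rho> * card C + t" using f[of None] unfolding 1 2 by (simp add: K'_def)
    also have "\<rho> * card C \<le> \<rho> * n" using \<rho> C(2) by (intro mult_left_mono) auto
    also have "t \<le> \<rho> * n"
    proof -
      have "\<rho> * (b / 2) * n \<le> \<rho> * 1 * n" using \<rho> b by (intro mult_right_mono mult_left_mono) auto
      then show ?thesis by (simp add: t_def)
    qed
    finally show "card J \<le> 2 * \<rho> * n" by simp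
  next
    fix \<kappa> assume \<kappa>: "\<kappa> \<in> K"
    have fin: "finite (L \<kappa>)" and sub: "p \<kappa> ` L \<kappa> \<subseteq> C" and big: "b * n \<le> card (L \<kappa>)"
      using L[OF \<kappa>] by auto
    have "(\<Sum>c\<in>C. X (Some \<kappa>) c (f c)) = (\<Sum>c\<in>J. real (fib \<kappa> c))"
      using C(1) by (simp add: X_def sum.If_cases Int_def J_def)
    also have "\<dots> = real (\<Sum>c\<in>J. card {l \<in> {l \<in> L \<kappa>. p \<kappa> l \<in> J}. p \<kappa> l = c})"
      unfolding fib_def of_nat_sum by (intro sum.cong refl arg_cong[where f = "\<lambda>A. real (card A)"]) auto
    also have "(\<Sum>c\<in>J. card {l \<in> {l \<in> L \<kappa>. p \<kappa> l \<in> J}. p \<kappa> l = c}) = card {l \<in> L \<kappa>. p \<kappa> l \<in> J}"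
      using sum.group[of "{l \<in> L \<kappa>. p \<kappa> l \<in> J}" J "p \<kappa>" "\<lambda>_. 1::nat"] fin C(1) by (auto simp: J_def)
    finally have 1: "(\<Sum>c\<in>C. X (Some \<kappa>) c (f c)) = card {l \<in> L \<kappa>. p \<kappa> l \<in> J}" .
    have "(\<Sum>c\<in>C. measure_pmf.expectation (bernoulli_pmf \<rho>) (X (Some \<kappa>) c)) = \<rho> * real (\<Sum>c\<in>C. fib \<kappa> c)"
      using \<rho> by (simp add: X_def sum_distrib_left mult.commute)
    also have "(\<Sum>c\<in>C. fib \<kappa> c) = card (L \<kappa>)"
      using sum.group[of "L \<kappa>" C "p \<kappa>" "\<lambda>_. 1::nat"] fin C(1) sub by (simp add: fib_def)
    finally have 2: "(\<Sum>c\<in>C. measure_pmf.expectation (bernoulli_pmf \<rho>) (X (Some \<kappa>) c)) = \<rho> * card (L \<kappa>)" .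
    have "\<rho> * card (L \<kappa>) - t < card {l \<in> L \<kappa>. p \<kappa> l \<in> J}"
      using f[of "Some \<kappa>"] \<kappa> unfolding 1 2 by (simp add: K'_def)
    moreover have "\<rho> * (b * n) \<le> \<rho> * card (L \<kappa>)" using \<rho> big by (intro mult_left_mono) auto
    ultimately show "\<rho> * b / 2 * n \<le> card {l \<in> L \<kappa>. p \<kappa> l \<in> J}" by (simp add: t_def)
  qed (auto simp: J_def)
qed

text \<open>A candidate now needs two chosen colours, so the count is no longer a sum of independent
  terms. Two rounds avoid this: \<open>J1\<close> is drawn for the first colours, then
  \<open>J2\<close> for the second colours of the survivors, and the union is taken. Each round
  costs a factor \<rho>/2, whence \<open>\<rho>\<^sup>2 * b / 4\<close>.\<close>

lemma thin_colour_pairs: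
  fixes \<rho> b :: real and C :: "'c set" and K :: "'k set" and L :: "'k \<Rightarrow> 'l set"
  assumes \<rho>: "0 < \<rho>" "\<rho> \<le> 1" and b: "0 < b" "b \<le> 1" and n: "1 \<le> n"
    and C: "finite C" "card C \<le> n" and K: "finite K" "card K \<le> n ^ 3"
    and L: "\<And>\<kappa>. \<kappa> \<in> K \<Longrightarrow> finite (L \<kappa>)"
      "\<And>\<kappa>. \<kappa> \<in> K \<Longrightarrow> p \<kappa> ` L \<kappa> \<subseteq> C" "\<And>\<kappa>. \<kappa> \<in> K \<Longrightarrow> q \<kappa> ` L \<kappa> \<subseteq> C"
      "\<And>\<kappa> c. \<kappa> \<in> K \<Longrightarrow> card {l \<in> L \<kappa>. p \<kappa> l = c} \<le> 2"
      "\<And>\<kappa> c. \<kappa> \<in> K \<Longrightarrow> card {l \<in> L \<kappa>. q \<kappa> l = c} \<le> 2"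
      "\<And>\<kappa>. \<kappa> \<in> K \<Longrightarrow> b * n \<le> card (L \<kappa>)"
    and small: "2 * real n ^ 3 * (2 * exp (- (\<rho> ^ 4 * b\<^sup>2 / 32) * real n)) < 1"
  shows "\<exists>J\<subseteq>C. card J \<le> 4 * \<rho> * n \<and>
       (\<forall>\<kappa>\<in>K. \<rho>\<^sup>2 * b / 4 * n \<le> card {l \<in> L \<kappa>. p \<kappa> l \<in> J \<and> q \<kappa> l \<in> J})"
proof -
  have b': "0 < \<rho> * b / 2" "\<rho> * b / 2 \<le> 1"
    using \<rho> b mult_mono[of \<rho> 1 b 1] by auto
  have "\<rho> ^ 2 \<le> 1" using \<rho> by (simp add: power_le_one)
  then have "\<rho> ^ 2 * (\<rho> ^ 2 * b\<^sup>2) \<le> 4 * (\<rho> ^ 2 * b\<^sup>2)" by (intro mult_right_mono) auto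
  then have "\<rho> ^ 4 * b\<^sup>2 / 32 \<le> \<rho>\<^sup>2 * b\<^sup>2 / 8" by (simp add: power4_eq_xxxx power2_eq_square mult_ac)
  then have "- (\<rho>\<^sup>2 * b\<^sup>2 / 8) * real n \<le> - (\<rho> ^ 4 * b\<^sup>2 / 32) * real n"
    by (intro mult_right_mono) auto
  then have "2 * real n ^ 3 * (2 * exp (- (\<rho>\<^sup>2 * b\<^sup>2 / 8) * real n)) \<le>
      2 * real n ^ 3 * (2 * exp (- (\<rho> ^ 4 * b\<^sup>2 / 32) * real n))"
    by (intro mult_left_mono) simp_all
  then have small1: "2 * real n ^ 3 * (2 * exp (- (\<rho>\<^sup>2 * b\<^sup>2 / 8) * real n)) < 1"
    using small by linarith
  have small2: "2 * real n ^ 3 * (2 * exp (- (\<rho>\<^sup>2 * (\<rho> * b / 2)\<^sup>2 / 8) * real n)) < 1"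
  proof -
    have "\<rho>\<^sup>2 * (\<rho> * b / 2)\<^sup>2 / 8 = \<rho> ^ 4 * b\<^sup>2 / 32"
      by (simp add: power4_eq_xxxx power2_eq_square)
    then show ?thesis using small by (simp only:)
  qed
  have "\<exists>J\<subseteq>C. card J \<le> 2 * \<rho> * n \<and> (\<forall>\<kappa>\<in>K. \<rho> * b / 2 * n \<le> card {l \<in> L \<kappa>. p \<kappa> l \<in> J})"
    by (rule thin_colours[OF \<rho> b n C K L(1,2,4,6) small1])
  then obtain J1 where J1: "J1 \<subseteq> C" "card J1 \<le> 2 * \<rho> * n"
      "\<forall>\<kappa>\<in>K. \<rho> * b / 2 * n \<le> card {l \<in> L \<kappa>. p \<kappa> l \<in> J1}" by (elim exE conjE)
  define L' where "L' \<kappa> = {l \<in> L \<kappa>. p \<kappa> l \<in> J1}" for \<kappa>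
  have L': "card {l \<in> L' \<kappa>. q \<kappa> l = c} \<le> 2" if "\<kappa> \<in> K" for \<kappa> c
  proof -
    have "card {l \<in> L' \<kappa>. q \<kappa> l = c} \<le> card {l \<in> L \<kappa>. q \<kappa> l = c}"
      using L(1)[OF that] by (intro card_mono) (auto simp: L'_def)
    then show ?thesis using L(5)[OF that] by (meson order_trans)
  qed
  have "\<exists>J\<subseteq>C. card J \<le> 2 * \<rho> * n \<and> (\<forall>\<kappa>\<in>K. \<rho> * (\<rho> * b / 2) / 2 * n \<le> card {l \<in> L' \<kappa>. q \<kappa> l \<in> J})"
  proof (rule thin_colours[OF \<rho> b' n C K _ _ _ _ small2])
    fix \<kappa> assume \<kappa>: "\<kappa> \<in> K"
    show "finite (L' \<kappa>)" "q \<kappa> ` L' \<kappa> \<subseteq> C" using L(1,3)[OF \<kappa>] by (auto simp: L'_def)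
    show "card {l \<in> L' \<kappa>. q \<kappa> l = c} \<le> 2" for c by (rule L'[OF \<kappa>])
    show "\<rho> * b / 2 * n \<le> card (L' \<kappa>)" using J1(3) \<kappa> by (simp add: L'_def)
  qed
  then obtain J2 where J2: "J2 \<subseteq> C" "card J2 \<le> 2 * \<rho> * n"
      "\<forall>\<kappa>\<in>K. \<rho> * (\<rho> * b / 2) / 2 * n \<le> card {l \<in> L' \<kappa>. q \<kappa> l \<in> J2}" by (elim exE conjE)
  show ?thesis
  proof (intro exI[of _ "J1 \<union> J2"] conjI ballI)
    show "J1 \<union> J2 \<subseteq> C" using J1 J2 by blast
    show "card (J1 \<union> J2) \<le> 4 * \<rho> * n"
      using card_Un_le[of J1 J2] J1(2) J2(2) by linarith
    fix \<kappa> assume \<kappa>: "\<kappa> \<in> K"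
    have "card {l \<in> L' \<kappa>. q \<kappa> l \<in> J2} \<le> card {l \<in> L \<kappa>. p \<kappa> l \<in> J1 \<union> J2 \<and> q \<kappa> l \<in> J1 \<union> J2}"
      using L(1)[OF \<kappa>] by (intro card_mono) (auto simp: L'_def)
    moreover have "\<rho>\<^sup>2 * b / 4 * n = \<rho> * (\<rho> * b / 2) / 2 * n" by (simp add: power2_eq_square)
    moreover have "\<rho> * (\<rho> * b / 2) / 2 * n \<le> card {l \<in> L' \<kappa>. q \<kappa> l \<in> J2}" using J2(3) \<kappa> by blast
    ultimately show "\<rho>\<^sup>2 * b / 4 * n \<le> card {l \<in> L \<kappa>. p \<kappa> l \<in> J1 \<union> J2 \<and> q \<kappa> l \<in> J1 \<union> J2}"
      by linarith
  qed
qed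

section \<open>Bipartite edge colouring and linear orders of forests\<close>

text \<open>Koenig's theorem by adding one edge x y at a time. A colour \<open>a\<close> is free at
  x and \<open>b\<close> at y; exchanging them on the alternating path from y frees \<open>a\<close>
  at y. The path enters left vertices by \<open>a\<close>-edges only, so it never meets x, where
  \<open>a\<close> is still free.\<close>

lemma bipartite_edge_coloring:
  fixes E :: "('a \<times> 'b) set"
  assumes "finite E" "\<And>x. card {y. (x, y) \<in> E} \<le> D" "\<And>y. card {x. (x, y) \<in> E} \<le> D"
  shows "\<exists>c. (\<forall>e\<in>E. c e < D) \<and>
    (\<forall>x y y'. (x, y) \<in> E \<longrightarrow> (x, y') \<in> E \<longrightarrow> c (x, y) = c (x, y') \<longrightarrow> y = y') \<and>
    (\<forall>x x' y. (x, y) \<in> E \<longrightarrow> (x', y) \<in> E \<longrightarrow> c (x, y) = c (x', y) \<longrightarrow> x = x')"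
  using assms
proof (induction E rule: finite_induct)
  case empty
  then show ?case by simp
next
  case (insert e E)
  obtain x y where e: "e = (x, y)" by (cases e)
  have finX: "finite {y. (z, y) \<in> E}" for z
    by (rule finite_subset[OF _ finite_imageI[OF insert.hyps(1), of snd]]) force
  have finY: "finite {x. (x, z) \<in> E}" for z
    by (rule finite_subset[OF _ finite_imageI[OF insert.hyps(1), of fst]]) force
  have eqX: "{w. (x, w) \<in> insert e E} = insert y {w. (x, w) \<in> E}" using e by auto
  have eqY: "{w. (w, y) \<in> insert e E} = insert x {w. (w, y) \<in> E}" using e by auto
  have dX: "card {w. (x, w) \<in> E} < D"
    using insert.prems(1)[of x] insert.hyps(2) e finX[of x] unfolding eqX by simp
  have dY: "card {w. (w, y) \<in> E} < D"
    using insert.prems(2)[of y] insert.hyps(2) e finY[of y] unfolding eqY by simp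
  have finX': "finite {y. (z, y) \<in> insert e E}" for z
    by (rule finite_subset[OF _ finite_insert[THEN iffD2, OF finX, of y z]]) (use e in auto)
  have finY': "finite {x. (x, z) \<in> insert e E}" for z
    by (rule finite_subset[OF _ finite_insert[THEN iffD2, OF finY, of x z]]) (use e in auto)
  have m1: "\<And>x. card {y. (x, y) \<in> E} \<le> D"
    by (rule order_trans[OF card_mono[OF finX'] insert.prems(1)]) auto
  have m2: "\<And>y. card {x. (x, y) \<in> E} \<le> D"
    by (rule order_trans[OF card_mono[OF finY'] insert.prems(2)]) auto
  obtain c where c0: "(\<forall>e\<in>E. c e < D) \<and>
    (\<forall>x y y'. (x, y) \<in> E \<longrightarrow> (x, y') \<in> E \<longrightarrow> c (x, y) = c (x, y') \<longrightarrow> y = y') \<and>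
    (\<forall>x x' y. (x, y) \<in> E \<longrightarrow> (x', y) \<in> E \<longrightarrow> c (x, y) = c (x', y) \<longrightarrow> x = x')"
    using insert.IH[OF m1 m2] by (elim exE)
  have c: "c e < D" if "e \<in> E" for e
    using c0 that by blast
  have cX: "y = y'" if "(x, y) \<in> E" "(x, y') \<in> E" "c (x, y) = c (x, y')" for x y y'
    using c0 that by blast
  have cY: "x = x'" if "(x, y) \<in> E" "(x', y) \<in> E" "c (x, y) = c (x', y)" for x x' y
    using c0 that by blast
  have "card ((\<lambda>w. c (x, w)) ` {w. (x, w) \<in> E}) < card {..<D}"
    using dX card_image_le[OF finX, of "\<lambda>w. c (x, w)" x] by simp
  then have "\<not> {..<D} \<subseteq> (\<lambda>w. c (x, w)) ` {w. (x, w) \<in> E}"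
    using card_mono[OF finite_imageI[OF finX]] by (metis not_le)
  then obtain a where a: "a < D" "\<And>w. (x, w) \<in> E \<Longrightarrow> c (x, w) \<noteq> a" by fastforce
  have "card ((\<lambda>w. c (w, y)) ` {w. (w, y) \<in> E}) < card {..<D}"
    using dY card_image_le[OF finY, of "\<lambda>w. c (w, y)" y] by simp
  then have "\<not> {..<D} \<subseteq> (\<lambda>w. c (w, y)) ` {w. (w, y) \<in> E}"
    using card_mono[OF finite_imageI[OF finY]] by (metis not_le)
  then obtain b where b: "b < D" "\<And>w. (w, y) \<in> E \<Longrightarrow> c (w, y) \<noteq> b" by fastforce
  \<comment> \<open>\<open>Z\<close> is the set of right vertices on the alternating \<open>a\<close>-\<open>b\<close> path that starts in \<open>y\<close>.\<close>
  define R where "R = {(y1, y2). \<exists>z. (z, y1) \<in> E \<and> c (z, y1) = a \<and> (z, y2) \<in> E \<and> c (z, y2) = b}"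
  define Z where "Z = R\<^sup>* `` {y}"
  have yZ: "y \<in> Z" by (simp add: Z_def)
  have forward: "y2 \<in> Z"
    if "y1 \<in> Z" "(z, y1) \<in> E" "c (z, y1) = a" "(z, y2) \<in> E" "c (z, y2) = b" for z y1 y2
    using that unfolding Z_def by (auto simp: R_def intro: rtrancl_into_rtrancl)
  have pred: "\<exists>y1\<in>Z. (z, y1) \<in> E \<and> c (z, y1) = a"
    if "y2 \<in> Z" "(z, y2) \<in> E" "c (z, y2) = b" for z y2
  proof -
    have "y2 \<noteq> y" using b(2) that by auto
    moreover have "(y, y2) \<in> R\<^sup>*" using that(1) by (simp add: Z_def)
    ultimately obtain y0 where "(y, y0) \<in> R\<^sup>*" "(y0, y2) \<in> R"
      by (metis rtranclE)
    then obtain z' where z': "(z', y0) \<in> E" "c (z', y0) = a" "(z', y2) \<in> E" "c (z', y2) = b"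
      by (auto simp: R_def)
    then have "z' = z" using cY that by metis
    with z' \<open>(y, y0) \<in> R\<^sup>*\<close> show ?thesis by (auto simp: Z_def)
  qed
  have backward: "y1 \<in> Z"
    if as: "y2 \<in> Z" "(z, y2) \<in> E" "c (z, y2) = b" "(z, y1) \<in> E" "c (z, y1) = a" for z y1 y2
  proof -
    obtain y0 where "y0 \<in> Z" "(z, y0) \<in> E" "c (z, y0) = a" using pred[OF as(1-3)] by blast
    then show ?thesis using cX[OF \<open>(z, y0) \<in> E\<close> as(4)] as(5) by simp
  qed
  define c' where "c' p = (if p = e then a else if snd p \<in> Z then
      (if c p = a then b else if c p = b then a else c p) else c p)" for p
  \<comment> \<open>Colour \<open>a\<close> could only arise at x from a \<open>b\<close>-edge whose
    right end is in \<open>Z\<close>, but then \<open>pred\<close> provides an \<open>a\<close>-edge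
    at x.\<close>
  have newX: "c' (x, w) \<noteq> a" if "(x, w) \<in> E" for w
    using that a(2)[OF that] pred[of w x] a(2) insert.hyps(2) unfolding c'_def e by auto
  have newY: "c' (w, y) \<noteq> a" if "(w, y) \<in> E" for w
    using that b(2)[OF that] yZ insert.hyps(2) unfolding c'_def e by auto
  have swap_inj: "p = q" if "(if p = a then b else if p = b then a else p) =
      (if q = a then b else if q = b then a else q)" for p q
    using that by (auto split: if_splits)
  \<comment> \<open>By \<open>forward\<close> and \<open>backward\<close> the \<open>a\<close>-edge
    and the \<open>b\<close>-edge of a left vertex are both exchanged or both kept, so the exchange
    creates no conflict on the left.\<close>
  have mix: "c' (u, w) \<noteq> c' (u, w')"
    if "(u, w) \<in> E" "(u, w') \<in> E" "w \<in> Z" "w' \<notin> Z" for u w w'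
  proof -
    have ne: "(u, w) \<noteq> e" "(u, w') \<noteq> e" using that insert.hyps(2) by auto
    have c1: "c' (u, w) = (if c (u, w) = a then b else if c (u, w) = b then a else c (u, w))"
      "c' (u, w') = c (u, w')"
      using ne that by (auto simp: c'_def)
    consider "c (u, w) = a" | "c (u, w) = b" "a \<noteq> b" | "c (u, w) \<noteq> a" "c (u, w) \<noteq> b" by blast
    then show ?thesis
    proof cases
      case 1
      then show ?thesis using forward[OF that(3,1) 1 that(2)] that(4) c1 by auto
    next
      case 2
      then show ?thesis using backward[OF that(3,1) 2(1) that(2)] that(4) c1 by auto
    next
      case 3
      then have "c' (u, w) = c (u, w)" using c1 by simp
      then show ?thesis using c1 cX[OF that(1,2)] that(3,4) by auto
    qed
  qed
  have c'e: "c' (x, y) = a" by (simp add: c'_def e)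
  show ?case
  proof (intro exI[of _ c'] conjI ballI allI impI)
    show "c' p < D" if "p \<in> insert e E" for p
      using that a(1) b(1) c[of p] by (auto simp: c'_def)
  next
    fix u w w' assume *: "(u, w) \<in> insert e E" "(u, w') \<in> insert e E" "c' (u, w) = c' (u, w')"
    show "w = w'"
    proof (cases "(u, w) = e \<or> (u, w') = e")
      case True
      then show ?thesis using *(3) newX[of w] newX[of w'] c'e *(1,2) unfolding e by auto
    next
      case False
      then have E: "(u, w) \<in> E" "(u, w') \<in> E" using * by auto
      show ?thesis
        using *(3) mix[OF E] mix[OF E(2,1)] cX[OF E] swap_inj[of "c (u, w)" "c (u, w')"] False
        unfolding c'_def by (cases "w \<in> Z"; cases "w' \<in> Z") auto
    qed
  next
    fix u u' w assume *: "(u, w) \<in> insert e E" "(u', w) \<in> insert e E" "c' (u, w) = c' (u', w)"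
    show "u = u'"
    proof (cases "(u, w) = e \<or> (u', w) = e")
      case True
      then show ?thesis using *(3) newY[of u] newY[of u'] c'e *(1,2) unfolding e by auto
    next
      case False
      then have E: "(u, w) \<in> E" "(u', w) \<in> E" using * by auto
      show ?thesis
        using *(3) False cY[OF E] swap_inj[of "c (u, w)" "c (u', w)"]
        unfolding c'_def by (cases "w \<in> Z") auto
    qed
  qed
qed

section \<open>Greedy representatives and orders along linear forests\<close>

text \<open>Every set is at least as large as the index set, so a greedy choice always finds a new
  element.\<close>

lemma distinct_representatives:
  assumes "finite I" "\<And>i. i \<in> I \<Longrightarrow> finite (C i) \<and> card I \<le> card (C i)"
  shows "\<exists>g. inj_on g I \<and> (\<forall>i\<in>I. g i \<in> C i)"
  using assms
proof (induction I rule: finite_induct)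
  case empty
  then show ?case by simp
next
  case (insert i I)
  have "\<And>j. j \<in> I \<Longrightarrow> finite (C j) \<and> card I \<le> card (C j)"
    using insert.prems insert.hyps by fastforce
  then obtain g where g: "inj_on g I" "\<forall>j\<in>I. g j \<in> C j" using insert.IH by blast
  have "card (g ` I) < card (C i)"
    using insert.prems[of i] insert.hyps card_image_le[OF insert.hyps(1), of g] by simp
  then obtain y where y: "y \<in> C i" "y \<notin> g ` I"
    using card_mono[of "g ` I" "C i"] insert.hyps(1) by (meson finite_imageI not_le subsetI)
  show ?case
    by (rule exI[of _ "g(i := y)"]) (use y g insert.hyps(2) in \<open>auto simp: inj_on_def\<close>)
qed

text \<open>The height \<open>h\<close> excludes directed cycles, so \<open>F\<close> is a disjoint
  union of paths. A vertex of greatest height has no successor; it is placed directly after its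
  predecessor, or at the end of the list if it has none.\<close>

lemma forest_linear_order:
  fixes h :: "'a \<Rightarrow> nat"
  assumes "finite W" "F \<subseteq> W \<times> W" "single_valued F" "single_valued (F\<inverse>)"
    "\<And>u w. (u, w) \<in> F \<Longrightarrow> h u < h w"
  shows "\<exists>L. distinct L \<and> set L = W \<and> (\<forall>(u, w)\<in>F. \<exists>xs ys. L = xs @ u # w # ys)"
  using assms
proof (induction "card W" arbitrary: W F)
  case 0
  then show ?case by (intro exI[of _ "[]"]) auto
next
  case (Suc n)
  then have ne: "W \<noteq> {}" by auto
  have "Max (h ` W) \<in> h ` W" using Suc.prems(1) ne by simp
  then obtain w where w0: "w \<in> W" "Max (h ` W) = h w" by (elim imageE)
  have w: "w \<in> W" "\<And>v. v \<in> W \<Longrightarrow> h v \<le> h w"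
    using w0 Max_ge[of "h ` W"] Suc.prems(1) by auto
  have noout: "(w, v) \<notin> F" for v
    using Suc.prems(2,5) w(2) by (metis SigmaE2 in_mono not_less)
  define F' where "F' = {e \<in> F. snd e \<noteq> w}"
  have "\<exists>L. distinct L \<and> set L = W - {w} \<and> (\<forall>(u, v)\<in>F'. \<exists>xs ys. L = xs @ u # v # ys)"
  proof (rule Suc.hyps(1))
    show "n = card (W - {w})" using Suc.hyps(2) w(1) Suc.prems(1) by simp
    show "F' \<subseteq> (W - {w}) \<times> (W - {w})"
      using Suc.prems(2) noout by (fastforce simp: F'_def)
    show "single_valued F'" "single_valued (F'\<inverse>)"
      using Suc.prems(3,4) by (auto simp: F'_def single_valued_def)
    show "h u < h v" if "(u, v) \<in> F'" for u v using that Suc.prems(5) by (auto simp: F'_def)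
  qed (use Suc.prems in auto)
  then obtain L where L0: "distinct L \<and> set L = W - {w} \<and>
    (\<forall>(u, v)\<in>F'. \<exists>xs ys. L = xs @ u # v # ys)" by (elim exE)
  have L: "distinct L" "set L = W - {w}" using L0 by auto
  have L3: "\<exists>xs ys. L = xs @ u # v # ys" if "(u, v) \<in> F'" for u v
    using L0 that by fast
  show ?case
  proof (cases "\<exists>u. (u, w) \<in> F")
    case False
    have "\<exists>xs ys. L @ [w] = xs @ u # v # ys" if "(u, v) \<in> F" for u v
    proof -
      have "(u, v) \<in> F'" using that False by (auto simp: F'_def)
      then obtain xs ys where "L = xs @ u # v # ys" using L3 by blast
      then have "L @ [w] = xs @ u # v # (ys @ [w])" by simp
      then show ?thesis by blast
    qed
    then show ?thesis
      using L(1,2) w(1) by (intro exI[of _ "L @ [w]"]) auto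
  next
    case True
    then obtain u where u: "(u, w) \<in> F" by blast
    then have "u \<in> set L" using Suc.prems(2) L(2) noout by auto
    then obtain xs ys where xy: "L = xs @ u # ys" by (meson split_list)
    have "\<exists>as bs. xs @ u # w # ys = as @ p # v # bs" if pv: "(p, v) \<in> F" for p v
    proof (cases "v = w")
      case True
      then have "p = u" using u pv Suc.prems(4) by (auto simp: single_valued_def)
      then show ?thesis using True by auto
    next
      case False
      then have "(p, v) \<in> F'" using pv by (simp add: F'_def)
      then obtain as bs where ab: "L = as @ p # v # bs" using L3 by blast
      \<comment> \<open>Inserting \<open>w\<close> after \<open>u\<close> separates only
        \<open>u\<close> from its old neighbour in the list, and the only pair of \<open>F\<close>
        that starts in \<open>u\<close> is (u, w).\<close>
      have "p \<noteq> u" using False u pv Suc.prems(3) by (auto simp: single_valued_def)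
      have p: "p \<notin> set as" "p \<notin> set (v # bs)" using L(1) ab by auto
      have "p \<in> set xs \<or> p \<in> set ys" using xy ab \<open>p \<noteq> u\<close>
        by (metis in_set_conv_decomp set_ConsD Un_iff set_append)
      then show ?thesis
      proof
        assume "p \<in> set xs"
        then obtain xs1 xs2 where x: "xs = xs1 @ p # xs2" by (meson split_list)
        then have "as @ p # (v # bs) = xs1 @ p # (xs2 @ u # ys)" using xy ab by simp
        then have "as = xs1" "v # bs = xs2 @ u # ys" using append_Cons_eq_iff[OF p] by metis+
        then have "\<exists>cs. xs2 @ u # w # ys = v # cs" by (cases xs2) auto
        then show ?thesis using x by auto
      next
        assume "p \<in> set ys"
        then obtain ys1 ys2 where y: "ys = ys1 @ p # ys2" by (meson split_list)
        then have "as @ p # (v # bs) = (xs @ u # ys1) @ p # ys2" using xy ab by simp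
        then have "ys2 = v # bs" using append_Cons_eq_iff[OF p] by metis
        then have "xs @ u # w # ys = (xs @ u # w # ys1) @ p # v # bs" using y by simp
        then show ?thesis by blast
      qed
    qed
    then show ?thesis
      using L(1,2) w(1) xy by (intro exI[of _ "xs @ u # w # ys"]) auto
  qed
qed

section \<open>A Hamilton cycle from a linear forest\<close>

text \<open>This assembles the cycle from the order of the forest: \<open>g u\<close> holds the
  vertices inserted after \<open>u\<close>, and \<open>z\<close> will be the head of the list, so
  that the walk closes.\<close>

lemma successively_concat_chunks:
  assumes "L \<noteq> []" "successively (\<lambda>u w. successively P (u # g u @ [w])) (L @ [z])"
  shows "successively P (concat (map (\<lambda>u. u # g u) L) @ [z])"
  using assms
proof (induction L rule: list_nonempty_induct)
  case (single u)
  then show ?case by simp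
next
  case (cons u L)
  then obtain u' L' where L: "L = u' # L'" by (cases L) auto
  have 1: "successively P (u # g u @ [u'])"
    and 2: "successively P (concat (map (\<lambda>u. u # g u) L) @ [z])"
    using cons by (auto simp: L)
  obtain ys where ys: "concat (map (\<lambda>u. u # g u) L) @ [z] = u' # ys" by (simp add: L)
  have "successively P ((u # g u) @ (u' # ys))"
    using 1 2[unfolded ys] by (auto simp: successively_append_iff successively_Cons hd_append)
  then show ?case using ys by simp
qed

lemma cycle_edges_successively:
  assumes "successively P (vs @ [hd vs])" "e \<in> cycle_edges vs"
  shows "\<exists>u w. P u w \<and> e = {u, w}"
proof -
  obtain i where i: "i < length vs" "e = {vs ! i, vs ! (Suc i mod length vs)}"
    using assms(2) by (auto simp: cycle_edges_def)
  have "P ((vs @ [hd vs]) ! i) ((vs @ [hd vs]) ! Suc i)"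
    using successively_nth[OF assms(1), of i] i by simp
  moreover have "(vs @ [hd vs]) ! Suc i = vs ! (Suc i mod length vs)"
    using i by (cases "vs = []"; cases "Suc i = length vs") (auto simp: nth_append hd_conv_nth)
  moreover have "(vs @ [hd vs]) ! i = vs ! i" using i by (simp add: nth_append)
  ultimately show ?thesis using i by auto
qed

text \<open>The linear order of the forest is read cyclically. Every path end x and the path start
  after it receive a common \<open>A\<close>-neighbour in \<open>S\<close>, and each vertex of
  \<open>S\<close> left over is put into an own edge of \<open>F\<close>. In both cases the supply
  is at least the demand, so greedy representatives suffice. The threefold description of the cycle
  edges tells afterwards which reservoir edges were used, and for which vertex.\<close>

lemma hamilton_cycle_from_forest:
  fixes h :: "'a \<Rightarrow> nat"
  assumes finV: "finite V" and S: "S \<subseteq> V" and W: "W = V - S" "2 \<le> card W"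
    and F: "F \<subseteq> W \<times> W" "single_valued F" "single_valued (F\<inverse>)"
      "\<And>u w. (u, w) \<in> F \<Longrightarrow> h u < h w"
    and link: "\<And>x z. x \<in> W - Domain F \<Longrightarrow> z \<in> W - Range F \<Longrightarrow> x \<noteq> z \<Longrightarrow>
      card (W - Domain F) \<le> card {s \<in> S. (x, s) \<in> A \<and> (z, s) \<in> A}"
    and absorb: "\<And>s. s \<in> S \<Longrightarrow> card S \<le> card {e \<in> F. (s, fst e) \<in> B \<and> (s, snd e) \<in> B}"
  shows "\<exists>vs. distinct vs \<and> set vs = V \<and> (\<forall>e\<in>cycle_edges vs.
     (\<exists>u w. (u, w) \<in> F \<and> e = {u, w}) \<or>
     (\<exists>x s. x \<in> (W - Domain F) \<union> (W - Range F) \<and> s \<in> S \<and> (x, s) \<in> A \<and> e = {x, s}) \<or>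
     (\<exists>s u. s \<in> S \<and> u \<in> W \<and> (s, u) \<in> B \<and> e = {s, u}))"
proof -
  have finW: "finite W" and finS: "finite S" using finV W S finite_subset by auto
  have finF: "finite F" using F(1) finW by (meson finite_SigmaI finite_subset)
  have "\<exists>L. distinct L \<and> set L = W \<and> (\<forall>(u, w)\<in>F. \<exists>xs ys. L = xs @ u # w # ys)"
    by (rule forest_linear_order[OF finW F(1-3), of h]) (rule F(4))
  then obtain L where L: "distinct L" "set L = W"
    and consec: "\<forall>(u, w)\<in>F. \<exists>xs ys. L = xs @ u # w # ys"
    by (elim exE conjE)
  have lenL: "2 \<le> length L" using W(2) L distinct_card by metis
  then have Lne: "L \<noteq> []" by auto
  \<comment> \<open>The cyclic successor; the appended \<open>hd L\<close> serves the last
    vertex.\<close>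
  define nxt where "nxt u = (THE w. \<exists>i < length L. u = L ! i \<and> w = (L @ [hd L]) ! Suc i)" for u
  have nxt: "nxt (L ! i) = (L @ [hd L]) ! Suc i" if "i < length L" for i
    unfolding nxt_def using that L(1) by (intro the_equality) (auto simp: nth_eq_iff_index_eq)
  have nxt_F: "nxt u = w" if "(u, w) \<in> F" for u w
  proof -
    obtain xs ys where "L = xs @ u # w # ys" using consec \<open>(u, w) \<in> F\<close> by fast
    then show ?thesis using nxt[of "length xs"] by (simp add: nth_append)
  qed
  have pos: "\<exists>i < length L. u = L ! i" if "u \<in> W" for u
    using that L(2) by (auto simp: in_set_conv_nth)
  have nxt_W: "nxt u \<in> W" if u: "u \<in> W" for u
  proof -
    obtain i where i: "i < length L" "u = L ! i" using pos[OF u] by blast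
    show ?thesis using nxt[OF i(1)] i Lne L(2)
      by (cases "Suc i = length L") (auto simp: nth_append)
  qed
  have nxt_ne: "nxt u \<noteq> u" if u: "u \<in> W" for u
  proof -
    obtain i where i: "i < length L" "u = L ! i" using pos[OF u] by blast
    show ?thesis
    proof (cases "Suc i = length L")
      case True
      then show ?thesis using nxt[OF i(1)] i Lne L(1) lenL
        by (auto simp: nth_append hd_conv_nth nth_eq_iff_index_eq)
    next
      case False
      then show ?thesis using nxt[OF i(1)] i L(1)
        by (auto simp: nth_append nth_eq_iff_index_eq)
    qed
  qed
  \<comment> \<open>An \<open>F\<close>-predecessor of \<open>nxt u\<close> stands directly before
    it in \<open>L\<close>, hence would be \<open>u\<close>, which has no
    \<open>F\<close>-successor. If \<open>u\<close> is last, \<open>nxt u\<close> is first and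
    nothing stands before it.\<close>
  have bad_nxt: "nxt u \<notin> Range F" if u: "u \<in> W - Domain F" for u
  proof
    assume "nxt u \<in> Range F"
    then obtain v where v: "(v, nxt u) \<in> F" by auto
    then obtain xs ys where xy: "L = xs @ v # nxt u # ys" using consec by fast
    obtain i where i: "i < length L" "u = L ! i" using pos u by blast
    have p: "L ! Suc (length xs) = nxt u" "L ! length xs = v" "Suc (length xs) < length L"
      using xy by (auto simp: nth_append)
    show False
    proof (cases "Suc i = length L")
      case True
      then have "L ! Suc (length xs) = L ! 0"
        using nxt[OF i(1)] i p Lne by (auto simp: nth_append hd_conv_nth)
      then show False using L(1) p(3) Lne by (simp add: nth_eq_iff_index_eq)
    next
      case False
      then have "L ! Suc (length xs) = L ! Suc i" "Suc i < length L"
        using nxt[OF i(1)] i p by (auto simp: nth_append)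
      then have "length xs = i" using L(1) p(3) by (simp add: nth_eq_iff_index_eq)
      then show False using i p v u by auto
    qed
  qed
  define T where "T = W - Domain F"
  have finT: "finite T" using finW by (simp add: T_def)
  have "\<exists>l. inj_on l T \<and> (\<forall>x\<in>T. l x \<in> {s \<in> S. (x, s) \<in> A \<and> (nxt x, s) \<in> A})"
  proof (rule distinct_representatives[OF finT])
    fix x assume x: "x \<in> T"
    have "card T \<le> card {s \<in> S. (x, s) \<in> A \<and> (nxt x, s) \<in> A}"
      unfolding T_def
    proof (rule link)
      show "x \<in> W - Domain F" using x by (simp add: T_def)
      show "nxt x \<in> W - Range F" using x nxt_W bad_nxt by (simp add: T_def)
      show "x \<noteq> nxt x" using x nxt_ne[of x] by (auto simp: T_def)
    qed
    then show "finite {s \<in> S. (x, s) \<in> A \<and> (nxt x, s) \<in> A} \<and>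
       card T \<le> card {s \<in> S. (x, s) \<in> A \<and> (nxt x, s) \<in> A}" using finS by simp
  qed
  then obtain l where l: "inj_on l T"
    "\<And>x. x \<in> T \<Longrightarrow> l x \<in> S" "\<And>x. x \<in> T \<Longrightarrow> (x, l x) \<in> A"  "\<And>x. x \<in> T \<Longrightarrow> (nxt x, l x) \<in> A"
    by auto
  define S' where "S' = S - l ` T"
  have "\<exists>g. inj_on g S' \<and> (\<forall>s\<in>S'. g s \<in> {e \<in> F. (s, fst e) \<in> B \<and> (s, snd e) \<in> B})"
  proof (rule distinct_representatives)
    fix s assume "s \<in> S'"
    moreover have "card S' \<le> card S" using finS by (simp add: S'_def card_mono)
    ultimately show "finite {e \<in> F. (s, fst e) \<in> B \<and> (s, snd e) \<in> B} \<and>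
        card S' \<le> card {e \<in> F. (s, fst e) \<in> B \<and> (s, snd e) \<in> B}"
      using absorb[of s] finF by (auto simp: S'_def)
  qed (use finS in \<open>auto simp: S'_def\<close>)
  then obtain m where m: "inj_on m S'" "\<And>s. s \<in> S' \<Longrightarrow> m s \<in> F"
    "\<And>s. s \<in> S' \<Longrightarrow> (s, fst (m s)) \<in> B" "\<And>s. s \<in> S' \<Longrightarrow> (s, snd (m s)) \<in> B"
    by auto
  have fst_inj: "s = s'" if "s \<in> S'" "s' \<in> S'" "fst (m s) = fst (m s')" for s s'
  proof -
    have "m s = m s'"
      using m(2)[OF that(1)] m(2)[OF that(2)] that(3) F(2)
      by (metis prod.collapse single_valuedD)
    then show ?thesis using m(1) that by (auto simp: inj_on_def)
  qed
  \<comment> \<open>At most one vertex follows \<open>u\<close>: distinct chosen edges have distinct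
    tails, and a tail is never in \<open>T\<close>.\<close>
  define g where "g u = (if u \<in> T then [l u] else if \<exists>s\<in>S'. fst (m s) = u
      then [THE s. s \<in> S' \<and> fst (m s) = u] else [])" for u
  have g_T: "g u = [l u]" if "u \<in> T" for u using that by (simp add: g_def)
  have fst_notT: "fst (m s) \<notin> T" if "s \<in> S'" for s
    using m(2)[OF that] by (auto simp: T_def Domain_fst)
  have g_S': "g (fst (m s)) = [s]" if s: "s \<in> S'" for s
  proof -
    have "(THE s'. s' \<in> S' \<and> fst (m s') = fst (m s)) = s"
      using s fst_inj by (intro the_equality) auto
    then show ?thesis using fst_notT[OF s] s by (auto simp: g_def)
  qed
  have g_cases: "(u \<in> T \<and> g u = [l u]) \<or> (\<exists>s\<in>S'. u = fst (m s) \<and> g u = [s]) \<or> (u \<notin> T \<and> g u = [])"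
    for u
  proof (cases "u \<notin> T \<and> (\<exists>s\<in>S'. fst (m s) = u)")
    case True
    then show ?thesis using g_S' by blast
  next
    case False
    then show ?thesis by (auto simp: g_def)
  qed
  have g_S: "set (g u) \<subseteq> S" for u
    using g_cases[of u] l(2) by (auto simp: S'_def)
  have g_disj: "u = u'" if "s \<in> set (g u)" "s \<in> set (g u')" for s u u'
  proof -
    have *: "(v \<in> T \<and> s = l v) \<or> (s \<in> S' \<and> v = fst (m s))" if "s \<in> set (g v)" for v
      using g_cases[of v] that by auto
    show ?thesis using *[OF that(1)] *[OF that(2)] inj_onD[OF l(1)] by (auto simp: S'_def)
  qed
  define vs where "vs = concat (map (\<lambda>u. u # g u) L)"
  have hd_vs: "hd vs = hd L" using Lne by (cases L) (auto simp: vs_def)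
  have "S \<subseteq> (\<Union>u\<in>W. set (g u))"
  proof
    fix s assume s: "s \<in> S"
    show "s \<in> (\<Union>u\<in>W. set (g u))"
    proof (cases "s \<in> S'")
      case True
      have "fst (m s) \<in> W" using m(2)[OF True] F(1) by (metis SigmaE2 in_mono prod.collapse)
      then show ?thesis using g_S'[OF True] by force
    next
      case False
      then obtain x where "x \<in> T" "s = l x" using s by (auto simp: S'_def)
      then show ?thesis using g_T[of x] by (auto simp: T_def intro!: bexI[of _ x])
    qed
  qed
  then have set_vs: "set vs = V"
    using g_S W(1) S L(2) unfolding vs_def by fastforce
  have dist_vs: "distinct vs"
    unfolding vs_def
  proof (rule distinct_concat)
    show "distinct (map (\<lambda>u. u # g u) L)" using L(1) by (simp add: distinct_map inj_on_def)
  next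
    fix ys assume "ys \<in> set (map (\<lambda>u. u # g u) L)"
    then obtain u where u: "u \<in> W" "ys = u # g u" using L(2) by auto
    then show "distinct ys" using g_cases[of u] g_S[of u] W(1) by auto
  next
    fix ys zs
    assume "ys \<in> set (map (\<lambda>u. u # g u) L)" "zs \<in> set (map (\<lambda>u. u # g u) L)" "ys \<noteq> zs"
    then obtain u u' where u: "u \<in> W" "ys = u # g u" "u' \<in> W" "zs = u' # g u'" "u \<noteq> u'"
      using L(2) by auto
    then show "set ys \<inter> set zs = {}"
      using g_S[of u] g_S[of u'] g_disj[of _ u u'] W(1) by auto
  qed
  define Q where "Q e \<longleftrightarrow> (\<exists>u w. (u, w) \<in> F \<and> e = {u, w}) \<or>
     (\<exists>x s. x \<in> (W - Domain F) \<union> (W - Range F) \<and> s \<in> S \<and> (x, s) \<in> A \<and> e = {x, s}) \<or>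
     (\<exists>s u. s \<in> S \<and> u \<in> W \<and> (s, u) \<in> B \<and> e = {s, u})" for e
  have chunk: "successively (\<lambda>a b. Q {a, b}) (u # g u @ [nxt u])" if u: "u \<in> W" for u
  proof -
    consider "u \<in> T" "g u = [l u]" | s where "s \<in> S'" "u = fst (m s)" "g u = [s]" | "u \<notin> T" "g u = []"
      using g_cases[of u] by blast
    then show ?thesis
    proof cases
      case 1
      have "Q {u, l u}" unfolding Q_def using 1(1) l(2,3)[OF 1(1)] T_def by blast
      moreover have "Q {nxt u, l u}"
        unfolding Q_def using 1(1) l(2,4)[OF 1(1)] T_def bad_nxt nxt_W[OF u] by blast
      ultimately show ?thesis using 1(2) by (simp add: insert_commute)
    next
      case 2
      have mF: "(u, snd (m s)) \<in> F" using 2 m(2)[of s] by simp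
      then have eq: "nxt u = snd (m s)" using nxt_F by blast
      have "Q {s, u}" "Q {s, snd (m s)}"
        unfolding Q_def using 2 m(3,4)[of s] mF F(1) S'_def by blast+
      then show ?thesis using 2(3) eq by (simp add: insert_commute)
    next
      case 3
      then obtain w where "(u, w) \<in> F" using u by (auto simp: T_def)
      moreover then have "nxt u = w" using nxt_F by blast
      ultimately show ?thesis using 3(2) by (auto simp: Q_def)
    qed
  qed
  have "successively (\<lambda>u w. successively (\<lambda>a b. Q {a, b}) (u # g u @ [w])) (L @ [hd L])"
  proof (subst successively_conv_nth, intro allI impI)
    fix i assume "Suc i < length (L @ [hd L])"
    then have i: "i < length L" by simp
    then have "L ! i \<in> W" using L(2) by auto
    from chunk[OF this] nxt[OF i] i
    show "successively (\<lambda>a b. Q {a, b})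
        ((L @ [hd L]) ! i # g ((L @ [hd L]) ! i) @ [(L @ [hd L]) ! Suc i])"
      by (simp add: nth_append)
  qed
  from successively_concat_chunks[OF Lne this]
  have "successively (\<lambda>a b. Q {a, b}) (vs @ [hd vs])" unfolding vs_def[symmetric] hd_vs .
  then have "\<forall>e\<in>cycle_edges vs. Q e" using cycle_edges_successively by blast
  then show ?thesis using dist_vs set_vs unfolding Q_def by blast
qed

section \<open>Packing many Hamilton cycles\<close>

definition undirected :: "('a \<times> 'a) set \<Rightarrow> 'a set set" where
  "undirected R = {{u, w} | u w. (u, w) \<in> R}"

lemma undirected_Un: "undirected (R \<union> S) = undirected R \<union> undirected S"
  unfolding undirected_def by blast

section \<open>Loads on the reservoirs and the sequential construction\<close>

lemma card_cycle_neighbours: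
  assumes "distinct vs"
  shows "finite {w. {v, w} \<in> cycle_edges vs}" "card {w. {v, w} \<in> cycle_edges vs} \<le> 2"
proof -
  define k where "k = length vs"
  obtain i where i: "\<And>j. j < k \<Longrightarrow> vs ! j = v \<Longrightarrow> j = i"
    using assms unfolding k_def by (metis nth_eq_iff_index_eq)
  have sub: "{w. {v, w} \<in> cycle_edges vs} \<subseteq> {vs ! (Suc i mod k), vs ! ((i + (k - 1)) mod k)}"
  proof
    fix w assume "w \<in> {w. {v, w} \<in> cycle_edges vs}"
    then obtain j where j: "j < k" "{v, w} = {vs ! j, vs ! (Suc j mod k)}"
      by (auto simp: cycle_edges_def k_def)
    from j(2) consider "v = vs ! j" "w = vs ! (Suc j mod k)" | "v = vs ! (Suc j mod k)" "w = vs ! j"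
      by (auto simp: doubleton_eq_iff)
    then show "w \<in> {vs ! (Suc i mod k), vs ! ((i + (k - 1)) mod k)}"
    proof cases
      case 1
      then show ?thesis using i[OF j(1)] by simp
    next
      case 2
      then have "Suc j mod k = i" using i[of "Suc j mod k"] j(1) by simp
      then have "(i + (k - 1)) mod k = (Suc j + (k - 1)) mod k" by (metis mod_add_left_eq)
      also have "\<dots> = j" using j(1) by simp
      finally show ?thesis using 2 by simp
    qed
  qed
  show "finite {w. {v, w} \<in> cycle_edges vs}" using finite_subset[OF sub] by simp
  show "card {w. {v, w} \<in> cycle_edges vs} \<le> 2"
    using card_mono[OF _ sub] card_insert_le_m1[of 2 "{vs ! ((i + (k - 1)) mod k)}"]
    by (simp add: card_insert_if split: if_splits)
qed

text \<open>In a pair of \<open>U\<close> the first vertex needed the edge, the second one was offered it. Offers are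
  made only by vertices of small load, so few vertices ever get blocked.\<close>

lemma card_blocked:
  fixes \<eta> :: real
  assumes V: "finite V" "card V = n" and U: "U \<subseteq> V \<times> V"
    and \<eta>: "0 < \<eta>" "\<eta> \<le> 1" "2 \<le> sqrt \<eta> * n"
    and outdeg: "\<And>y. y \<in> V \<Longrightarrow> card {z. (y, z) \<in> U} \<le> 2 * \<eta> * n"
    and indeg: "\<And>z. z \<in> V \<Longrightarrow> card {y. (y, z) \<in> U} \<le> sqrt \<eta> * n + 2"
    and y: "y \<in> V"
  shows "card {z \<in> V. (y, z) \<in> U \<or> (z, y) \<in> U \<or> card {y. (y, z) \<in> U} \<ge> sqrt \<eta> * n} \<le> 7 * sqrt \<eta> * n"
proof -
  define over where "over = {z \<in> V. card {y. (y, z) \<in> U} \<ge> sqrt \<eta> * n}"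
  have pos: "sqrt \<eta> * n > 0" using \<eta> by linarith
  have finU: "finite U" using U V(1) finite_subset by blast
  have U1: "U = Sigma V (\<lambda>y. {z. (y, z) \<in> U})" using U by auto
  have fin1: "finite {z. (y, z) \<in> U}" for y
    by (rule finite_subset[OF _ V(1)]) (use U in auto)
  have fin2: "finite {y. (y, z) \<in> U}" for z
    by (rule finite_subset[OF _ V(1)]) (use U in auto)
  have "real (card U) = (\<Sum>y\<in>V. real (card {z. (y, z) \<in> U}))"
    by (subst U1) (simp add: card_SigmaI V(1) fin1)
  also have "\<dots> \<le> (\<Sum>y\<in>V. 2 * \<eta> * n)" by (intro sum_mono outdeg)
  finally have cU: "real (card U) \<le> 2 * \<eta> * n * n" using V by (simp add: mult_ac)
  \<comment> \<open>Double counting: each overloaded vertex absorbs at least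
    \<open>sqrt \<eta> * n\<close> of at most \<open>2 * \<eta> * n * n\<close> pairs. The threshold
    \<open>sqrt \<eta> * n\<close> makes the load and the number of overloaded vertices of the same
    order.\<close>
  have "(sqrt \<eta> * n) * card over \<le> (\<Sum>z\<in>over. real (card {y. (y, z) \<in> U}))"
    using sum_mono[of over "\<lambda>_. sqrt \<eta> * n" "\<lambda>z. real (card {y. (y, z) \<in> U})"]
    by (simp add: over_def mult.commute)
  also have "\<dots> = real (card (Sigma over (\<lambda>z. {y. (y, z) \<in> U})))"
    using V(1) fin2 by (subst card_SigmaI) (auto simp: over_def)
  also have "card (Sigma over (\<lambda>z. {y. (y, z) \<in> U})) = card ((\<lambda>(z, y). (y, z)) ` Sigma over (\<lambda>z. {y. (y, z) \<in> U}))"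
    by (subst card_image) (auto simp: inj_on_def)
  also have "\<dots> \<le> card U" by (intro card_mono finU) auto
  finally have "(sqrt \<eta> * n) * card over \<le> 2 * \<eta> * n * n" using cU by linarith
  also have "\<dots> = (sqrt \<eta> * n) * (2 * sqrt \<eta> * n)" using \<eta>(1) by (simp add: mult_ac)
  finally have over: "card over \<le> 2 * sqrt \<eta> * n" using pos by (simp only: mult_le_cancel_left_pos)
  have "\<eta> = sqrt \<eta> * sqrt \<eta>" using \<eta> by simp
  also have "\<dots> \<le> sqrt \<eta> * 1" using \<eta> by (intro mult_left_mono) auto
  finally have "\<eta> * n \<le> sqrt \<eta> * n" by (intro mult_right_mono) auto
  moreover have "card {z \<in> V. (y, z) \<in> U \<or> (z, y) \<in> U \<or> card {y. (y, z) \<in> U} \<ge> sqrt \<eta> * n}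
      \<le> card (({z. (y, z) \<in> U} \<union> {z. (z, y) \<in> U}) \<union> over)"
    using V(1) by (intro card_mono) (auto simp: fin1 fin2 over_def)
  moreover have "\<dots> \<le> card ({z. (y, z) \<in> U} \<union> {z. (z, y) \<in> U}) + card over" by (rule card_Un_le)
  moreover have "card ({z. (y, z) \<in> U} \<union> {z. (z, y) \<in> U}) \<le> card {z. (y, z) \<in> U} + card {z. (z, y) \<in> U}"
    by (rule card_Un_le)
  \<comment> \<open>Used edges of either direction and overloaded vertices contribute at most
    \<open>2 * sqrt \<eta> * n\<close> each; \<open>2 \<le> sqrt \<eta> * n\<close> takes care of
    the additive 2.\<close>
  ultimately show ?thesis using outdeg[OF y] indeg[OF y] over \<eta>(3) by linarith
qed

text \<open>A cycle has at most two edges at a vertex. The outdegree of y grows only if y is needy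
  at index \<open>i\<close>, that is, lies in \<open>A i\<close>; the indegree of z grows only from
  below the threshold \<open>l\<close>, so it never passes \<open>l + 2\<close>.\<close>

lemma load_update:
  fixes l :: real
  assumes "distinct vs" "finite J" "i \<notin> J" and V: "finite V" "U \<subseteq> V \<times> V"
    and outdeg: "\<And>y. y \<in> V \<Longrightarrow> card {z. (y, z) \<in> U} \<le> 2 * card {j \<in> J. y \<in> A j}"
    and indeg: "\<And>z. z \<in> V \<Longrightarrow> card {y. (y, z) \<in> U} \<le> l + 2"
    and N: "N \<subseteq> V \<times> V"
      "\<And>y z. (y, z) \<in> N \<Longrightarrow> y \<in> A i \<and> {y, z} \<in> cycle_edges vs \<and> card {y. (y, z) \<in> U} < l"
  shows "\<And>y. y \<in> V \<Longrightarrow> card {z. (y, z) \<in> U \<union> N} \<le> 2 * card {j \<in> insert i J. y \<in> A j}"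
    "\<And>z. z \<in> V \<Longrightarrow> card {y. (y, z) \<in> U \<union> N} \<le> l + 2"
proof -
  fix y assume y: "y \<in> V"
  have un: "{z. (y, z) \<in> U \<union> N} = {z. (y, z) \<in> U} \<union> {z. (y, z) \<in> N}" by auto
  have le: "card {z. (y, z) \<in> U \<union> N} \<le> card {z. (y, z) \<in> U} + card {z. (y, z) \<in> N}"
    unfolding un by (rule card_Un_le)
  show "card {z. (y, z) \<in> U \<union> N} \<le> 2 * card {j \<in> insert i J. y \<in> A j}"
  proof (cases "y \<in> A i")
    case True
    have "card {z. (y, z) \<in> N} \<le> card {w. {y, w} \<in> cycle_edges vs}"
      using card_cycle_neighbours(1)[OF assms(1)] N(2) by (intro card_mono) auto
    also have "\<dots> \<le> 2" by (rule card_cycle_neighbours(2)[OF assms(1)])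
    finally have "card {z. (y, z) \<in> N} \<le> 2" .
    moreover have "{j \<in> insert i J. y \<in> A j} = insert i {j \<in> J. y \<in> A j}" using True by auto
    ultimately show ?thesis using le outdeg[OF y] assms(2,3) by simp
  next
    case False
    then have "{z. (y, z) \<in> N} = {}" "{j \<in> insert i J. y \<in> A j} = {j \<in> J. y \<in> A j}"
      using N(2) by auto
    then show ?thesis using le outdeg[OF y] by simp
  qed
next
  fix z assume z: "z \<in> V"
  have un: "{y. (y, z) \<in> U \<union> N} = {y. (y, z) \<in> U} \<union> {y. (y, z) \<in> N}" by auto
  have le: "card {y. (y, z) \<in> U \<union> N} \<le> card {y. (y, z) \<in> U} + card {y. (y, z) \<in> N}"
    unfolding un by (rule card_Un_le)
  show "card {y. (y, z) \<in> U \<union> N} \<le> l + 2"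
  proof (cases "{y. (y, z) \<in> N} = {}")
    case True
    then show ?thesis using le indeg[OF z] by simp
  next
    case False
    then have "card {y. (y, z) \<in> U} < l" using N(2) by blast
    moreover have "{y. (y, z) \<in> N} \<subseteq> {w. {z, w} \<in> cycle_edges vs}"
      using N(2) by (auto simp: insert_commute)
    then have "card {y. (y, z) \<in> N} \<le> card {w. {z, w} \<in> cycle_edges vs}"
      using card_cycle_neighbours(1)[OF assms(1)] by (rule card_mono[rotated])
    moreover have "\<dots> \<le> 2" by (rule card_cycle_neighbours(2)[OF assms(1)])
    ultimately show ?thesis using le by linarith
  qed
qed

text \<open>A vertex asks for reservoir edges only at the few indices where it is an end of the
  forest or belongs to \<open>S i\<close>. This keeps the blocked sets below
  \<open>7 * sqrt \<eta> * n\<close> and \<open>7 * sqrt \<gamma> * n\<close> throughout. A link or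
  an insertion uses two reservoir edges, hence the factor 14 in the margins over the demands
  \<open>T\<close> and \<open>\<sigma>\<close>.\<close>

lemma greedy_packing:
  fixes \<eta> \<gamma> T c1 c2 \<sigma> :: real and h :: "'i \<Rightarrow> 'a \<Rightarrow> nat"
  assumes V: "finite V" "card V = n" "3 \<le> n" and I: "finite I"
    and S: "\<And>i. i \<in> I \<Longrightarrow> S i \<subseteq> V" "\<And>i. i \<in> I \<Longrightarrow> 2 \<le> card (V - S i)"
      "\<And>i. i \<in> I \<Longrightarrow> card (S i) \<le> \<sigma> * n"
    and F: "\<And>i. i \<in> I \<Longrightarrow> F i \<subseteq> (V - S i) \<times> (V - S i)" "\<And>i. i \<in> I \<Longrightarrow> single_valued (F i)"
      "\<And>i. i \<in> I \<Longrightarrow> single_valued ((F i)\<inverse>)"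
      "\<And>i u w. i \<in> I \<Longrightarrow> (u, w) \<in> F i \<Longrightarrow> h i u < h i w"
      "\<And>i. i \<in> I \<Longrightarrow> card ((V - S i) - Domain (F i)) \<le> T * n"
    and disj: "\<And>i j. i \<in> I \<Longrightarrow> j \<in> I \<Longrightarrow> i \<noteq> j \<Longrightarrow> undirected (F i) \<inter> undirected (F j) = {}"
      "\<And>i. i \<in> I \<Longrightarrow> undirected (F i) \<inter> (R1 \<union> R2) = {}" "R1 \<inter> R2 = {}"
    and ends: "\<And>v. v \<in> V \<Longrightarrow>
        card {i \<in> I. v \<in> (V - S i - Domain (F i)) \<union> (V - S i - Range (F i))} \<le> \<eta> * n"
      "\<And>v. v \<in> V \<Longrightarrow> card {i \<in> I. v \<in> S i} \<le> \<gamma> * n"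
    and \<eta>: "0 < \<eta>" "\<eta> \<le> 1" "2 \<le> sqrt \<eta> * n" and \<gamma>: "0 < \<gamma>" "\<gamma> \<le> 1" "2 \<le> sqrt \<gamma> * n"
    and link: "\<And>i x z. i \<in> I \<Longrightarrow> x \<in> V - S i \<Longrightarrow> z \<in> V - S i \<Longrightarrow> x \<noteq> z \<Longrightarrow>
        c1 * n \<le> card {s \<in> S i. {x, s} \<in> R1 \<and> {z, s} \<in> R1}"
    and absorb: "\<And>i s. i \<in> I \<Longrightarrow> s \<in> S i \<Longrightarrow>
        c2 * n \<le> card {e \<in> F i. {s, fst e} \<in> R2 \<and> {s, snd e} \<in> R2}"
    and c: "T + 14 * sqrt \<eta> \<le> c1" "\<sigma> + 14 * sqrt \<gamma> \<le> c2"
  shows "\<exists>H. (\<forall>i\<in>I. hamilton_cycle V (\<Union>(undirected ` F ` I) \<union> R1 \<union> R2) (H i)) \<and>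
     (\<forall>i\<in>I. \<forall>j\<in>I. i \<noteq> j \<longrightarrow> H i \<inter> H j = {})"
proof -
  define Ends where "Ends i = (V - S i - Domain (F i)) \<union> (V - S i - Range (F i))" for i
  define E where "E = \<Union>(undirected ` F ` I) \<union> R1 \<union> R2"
  \<comment> \<open>\<open>U1\<close> and \<open>U2\<close> contain the reservoir edges used so far.
    Outdegrees are compared with the number of processed indices at which the vertex was needy,
    indegrees with the threshold at which offers stop.\<close>
  define inv where "inv J H U1 U2 \<longleftrightarrow> (\<forall>i\<in>J. hamilton_cycle V E (H i) \<and>
       H i \<subseteq> undirected (F i) \<union> undirected U1 \<union> undirected U2) \<and>
     (\<forall>i\<in>J. \<forall>j\<in>J. i \<noteq> j \<longrightarrow> H i \<inter> H j = {}) \<and>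
     U1 \<subseteq> V \<times> V \<and> U2 \<subseteq> V \<times> V \<and> undirected U1 \<subseteq> R1 \<and> undirected U2 \<subseteq> R2 \<and>
     (\<forall>y\<in>V. card {z. (y, z) \<in> U1} \<le> 2 * card {i \<in> J. y \<in> Ends i}) \<and>
     (\<forall>y\<in>V. card {z. (y, z) \<in> U2} \<le> 2 * card {i \<in> J. y \<in> S i}) \<and>
     (\<forall>z\<in>V. card {y. (y, z) \<in> U1} \<le> sqrt \<eta> * n + 2) \<and>
     (\<forall>z\<in>V. card {y. (y, z) \<in> U2} \<le> sqrt \<gamma> * n + 2)"
    for J and H :: "'i \<Rightarrow> 'a set set" and U1 U2
  have "\<exists>H U1 U2. inv J H U1 U2" if "J \<subseteq> I" for J
    using finite_subset[OF that I] that
  proof (induction J rule: finite_induct)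
    case empty
    show ?case
      by (intro exI[of _ "\<lambda>_. {}"] exI[of _ "{}"])
        (use \<eta> \<gamma> in \<open>auto simp: inv_def undirected_def\<close>)
  next
    case (insert i J)
    then obtain H U1 U2 where inv: "inv J H U1 U2" by auto
    have i: "i \<in> I" and JI: "J \<subseteq> I" and iJ: "i \<notin> J" and finJ: "finite J" using insert by auto
    have H: "hamilton_cycle V E (H j)" "H j \<subseteq> undirected (F j) \<union> undirected U1 \<union> undirected U2"
      if "j \<in> J" for j using inv that by (simp_all add: inv_def)
    have Hd: "H j \<inter> H k = {}" if "j \<in> J" "k \<in> J" "j \<noteq> k" for j k
      using inv that by (simp add: inv_def)
    have U: "U1 \<subseteq> V \<times> V" "U2 \<subseteq> V \<times> V" and UR: "undirected U1 \<subseteq> R1" "undirected U2 \<subseteq> R2"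
      using inv by (simp_all add: inv_def)
    have out1: "card {z. (y, z) \<in> U1} \<le> 2 * card {i \<in> J. y \<in> Ends i}"
      and out2: "card {z. (y, z) \<in> U2} \<le> 2 * card {i \<in> J. y \<in> S i}"
      and in1: "card {z. (z, y) \<in> U1} \<le> sqrt \<eta> * n + 2"
      and in2: "card {z. (z, y) \<in> U2} \<le> sqrt \<gamma> * n + 2" if "y \<in> V" for y
      using inv that by (simp_all add: inv_def)
    have out1': "card {z. (y, z) \<in> U1} \<le> 2 * \<eta> * n" if y: "y \<in> V" for y
    proof -
      have "card {i \<in> J. y \<in> Ends i} \<le> card {i \<in> I. y \<in> Ends i}"
        using I JI by (intro card_mono) auto
      then show ?thesis using out1[OF y] ends(1)[OF y] unfolding Ends_def by linarith
    qed
    have out2': "card {z. (y, z) \<in> U2} \<le> 2 * \<gamma> * n" if y: "y \<in> V" for y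
    proof -
      have "card {i \<in> J. y \<in> S i} \<le> card {i \<in> I. y \<in> S i}"
        using I JI by (intro card_mono) auto
      then show ?thesis using out2[OF y] ends(2)[OF y] by linarith
    qed
    \<comment> \<open>Two reasons to withhold z from y: their edge is used already, in either
      direction, or the load of z is full. The first gives disjointness from the earlier cycles, the
      second preserves the invariant.\<close>
    define X1 where "X1 y = {z \<in> V. (y, z) \<in> U1 \<or> (z, y) \<in> U1 \<or> card {y. (y, z) \<in> U1} \<ge> sqrt \<eta> * n}" for y
    define X2 where "X2 y = {z \<in> V. (y, z) \<in> U2 \<or> (z, y) \<in> U2 \<or> card {y. (y, z) \<in> U2} \<ge> sqrt \<gamma> * n}" for y
    have X1: "card (X1 y) \<le> 7 * sqrt \<eta> * n" if "y \<in> V" for y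
      unfolding X1_def by (rule card_blocked[OF V(1,2) U(1) \<eta> out1' in1 that])
    have X2: "card (X2 y) \<le> 7 * sqrt \<gamma> * n" if "y \<in> V" for y
      unfolding X2_def by (rule card_blocked[OF V(1,2) U(2) \<gamma> out2' in2 that])
    define A where "A = {(y, z). z \<in> V \<and> {y, z} \<in> R1 \<and> z \<notin> X1 y}"
    define B where "B = {(y, z). z \<in> V \<and> {y, z} \<in> R2 \<and> z \<notin> X2 y}"
    let ?W = "V - S i"
    have finF: "finite (F i)" using F(1)[OF i] V(1) finite_subset by (metis finite_Diff finite_SigmaI)
    have finS: "finite (S i)" using S(1)[OF i] V(1) finite_subset by blast
    have finX: "finite (X1 y)" "finite (X2 y)" for y using V(1) by (auto simp: X1_def X2_def)
    have "\<exists>vs. distinct vs \<and> set vs = V \<and> (\<forall>e\<in>cycle_edges vs.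
     (\<exists>u w. (u, w) \<in> F i \<and> e = {u, w}) \<or>
     (\<exists>x s. x \<in> (?W - Domain (F i)) \<union> (?W - Range (F i)) \<and> s \<in> S i \<and> (x, s) \<in> A \<and> e = {x, s}) \<or>
     (\<exists>s u. s \<in> S i \<and> u \<in> ?W \<and> (s, u) \<in> B \<and> e = {s, u}))"
    proof (rule hamilton_cycle_from_forest[where h = "h i"])
      fix x z assume x: "x \<in> ?W - Domain (F i)" and z: "z \<in> ?W - Range (F i)" and xz: "x \<noteq> z"
      let ?C = "{s \<in> S i. {x, s} \<in> R1 \<and> {z, s} \<in> R1}"
      let ?C' = "{s \<in> S i. (x, s) \<in> A \<and> (z, s) \<in> A}"
      have "?C \<subseteq> ?C' \<union> X1 x \<union> X1 z" using S(1)[OF i] by (auto simp: A_def)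
      then have "card ?C \<le> card (?C' \<union> X1 x \<union> X1 z)"
        using finS finX by (intro card_mono) auto
      also have "\<dots> \<le> card ?C' + card (X1 x) + card (X1 z)"
        by (meson add_right_mono card_Un_le order_trans)
      finally have *: "card ?C \<le> card ?C' + card (X1 x) + card (X1 z)" .
      have "c1 * n \<le> card ?C" using link[OF i, of x z] x z xz by blast
      moreover have "card (X1 x) \<le> 7 * sqrt \<eta> * n" "card (X1 z) \<le> 7 * sqrt \<eta> * n"
        using X1 x z by auto
      ultimately have "c1 * n \<le> card ?C' + (7 * sqrt \<eta> * n + 7 * sqrt \<eta> * n)"
        using * by linarith
      moreover have "(T + 14 * sqrt \<eta>) * n \<le> c1 * n" using c(1) by (intro mult_right_mono) auto
      ultimately have "real (card (?W - Domain (F i))) \<le> card ?C'"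
        using F(5)[OF i] by (simp add: algebra_simps)
      then show "card (?W - Domain (F i)) \<le> card ?C'" by simp
    next
      fix s assume s: "s \<in> S i"
      then have sV: "s \<in> V" using S(1)[OF i] by auto
      let ?C = "{e \<in> F i. {s, fst e} \<in> R2 \<and> {s, snd e} \<in> R2}"
      let ?C' = "{e \<in> F i. (s, fst e) \<in> B \<and> (s, snd e) \<in> B}"
      have "?C \<subseteq> ?C' \<union> {e \<in> F i. fst e \<in> X2 s} \<union> {e \<in> F i. snd e \<in> X2 s}"
        using F(1)[OF i] by (fastforce simp: B_def)
      then have "card ?C \<le> card (?C' \<union> {e \<in> F i. fst e \<in> X2 s} \<union> {e \<in> F i. snd e \<in> X2 s})"
        using finF by (intro card_mono) auto
      also have "\<dots> \<le> card ?C' + card {e \<in> F i. fst e \<in> X2 s} + card {e \<in> F i. snd e \<in> X2 s}"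
        by (meson add_right_mono card_Un_le order_trans)
      finally have *: "card ?C \<le> card ?C' + card {e \<in> F i. fst e \<in> X2 s} + card {e \<in> F i. snd e \<in> X2 s}" .
      have "card {e \<in> F i. fst e \<in> X2 s} \<le> card (X2 s)"
        using F(2)[OF i] by (intro card_inj_on_le[of fst] finX) (auto simp: inj_on_def single_valued_def)
      moreover have "card {e \<in> F i. snd e \<in> X2 s} \<le> card (X2 s)"
        using F(3)[OF i] by (intro card_inj_on_le[of snd] finX) (auto simp: inj_on_def single_valued_def)
      ultimately have "c2 * n \<le> card ?C' + (7 * sqrt \<gamma> * n + 7 * sqrt \<gamma> * n)"
        using * absorb[OF i s] X2[OF sV] by linarith
      moreover have "(\<sigma> + 14 * sqrt \<gamma>) * n \<le> c2 * n" using c(2) by (intro mult_right_mono) auto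
      ultimately have "real (card (S i)) \<le> card ?C'"
        using S(3)[OF i] by (simp add: algebra_simps)
      then show "card (S i) \<le> card ?C'" by simp
    qed (use V S[OF i] F[OF i] in auto)
    then obtain vs where vs: "distinct vs" "set vs = V" and
      edges: "\<And>e. e \<in> cycle_edges vs \<Longrightarrow> (\<exists>u w. (u, w) \<in> F i \<and> e = {u, w}) \<or>
     (\<exists>x s. x \<in> Ends i \<and> s \<in> S i \<and> (x, s) \<in> A \<and> e = {x, s}) \<or>
     (\<exists>s u. s \<in> S i \<and> u \<in> ?W \<and> (s, u) \<in> B \<and> e = {s, u})"
      unfolding Ends_def by (elim exE conjE) fast
    define N1 where "N1 = {(x, s). x \<in> Ends i \<and> s \<in> S i \<and> (x, s) \<in> A \<and> {x, s} \<in> cycle_edges vs}"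
    define N2 where "N2 = {(s, u). s \<in> S i \<and> u \<in> ?W \<and> (s, u) \<in> B \<and> {s, u} \<in> cycle_edges vs}"
    have edges': "cycle_edges vs \<subseteq> undirected (F i) \<union> undirected N1 \<union> undirected N2"
    proof
      fix e assume e: "e \<in> cycle_edges vs"
      from edges[OF e] show "e \<in> undirected (F i) \<union> undirected N1 \<union> undirected N2"
      proof (elim disjE exE conjE)
        fix u w assume "(u, w) \<in> F i" "e = {u, w}"
        then show ?thesis unfolding undirected_def by blast
      next
        fix x s assume *: "x \<in> Ends i" "s \<in> S i" "(x, s) \<in> A" "e = {x, s}"
        then have "(x, s) \<in> N1" using e by (simp add: N1_def)
        then show ?thesis using *(4) unfolding undirected_def by blast
      next
        fix s u assume *: "s \<in> S i" "u \<in> ?W" "(s, u) \<in> B" "e = {s, u}"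
        then have "(s, u) \<in> N2" using e by (simp add: N2_def)
        then show ?thesis using *(4) unfolding undirected_def by blast
      qed
    qed
    have N1R: "undirected N1 \<subseteq> R1" and N2R: "undirected N2 \<subseteq> R2"
      by (auto simp: undirected_def N1_def N2_def A_def B_def)
    have N1U: "undirected N1 \<inter> undirected U1 = {}" and N2U: "undirected N2 \<inter> undirected U2 = {}"
      by (auto simp: undirected_def N1_def N2_def A_def B_def X1_def X2_def doubleton_eq_iff)
    have NV: "N1 \<subseteq> V \<times> V" "N2 \<subseteq> V \<times> V"
      using S(1)[OF i] by (auto simp: N1_def N2_def Ends_def)
    have N1: "y \<in> Ends i \<and> {y, z} \<in> cycle_edges vs \<and> card {y. (y, z) \<in> U1} < sqrt \<eta> * n"
      if "(y, z) \<in> N1" for y z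
      using that by (auto simp: N1_def A_def X1_def)
    have N2: "y \<in> S i \<and> {y, z} \<in> cycle_edges vs \<and> card {y. (y, z) \<in> U2} < sqrt \<gamma> * n"
      if "(y, z) \<in> N2" for y z
      using that by (auto simp: N2_def B_def X2_def)
    have hc: "hamilton_cycle V E (cycle_edges vs)"
      unfolding hamilton_cycle_def
    proof (intro exI[of _ vs] conjI)
      show "3 \<le> length vs" using vs V distinct_card by metis
      show "cycle_edges vs \<subseteq> E" using edges' N1R N2R i unfolding E_def by blast
    qed (use vs in auto)
    \<comment> \<open>The new cycle meets an earlier one neither in forest edges nor across
      different kinds of edges, by the disjointness of the forests and reservoirs; within one
      reservoir it avoids all used edges.\<close>
    have dj: "cycle_edges vs \<inter> H j = {}" if j: "j \<in> J" for j
    proof -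
      have jI: "j \<in> I" "i \<noteq> j" using j JI iJ by auto
      show ?thesis
        using edges' H(2)[OF j] N1R N2R N1U N2U UR disj(1)[OF i jI] disj(2)[OF i] disj(2)[OF jI(1)] disj(3)
        by blast
    qed
    have "inv (insert i J) (H(i := cycle_edges vs)) (U1 \<union> N1) (U2 \<union> N2)"
      unfolding inv_def
    proof (intro conjI ballI impI)
      fix j assume j: "j \<in> insert i J"
      show "hamilton_cycle V E ((H(i := cycle_edges vs)) j)"
        using j hc H(1) by auto
      show "(H(i := cycle_edges vs)) j \<subseteq> undirected (F j) \<union> undirected (U1 \<union> N1) \<union> undirected (U2 \<union> N2)"
      proof (cases "j = i")
        case True
        then show ?thesis using edges' by (auto simp: undirected_def)
      next
        case False
        then show ?thesis using H(2)[of j] j by (auto simp: undirected_def)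
      qed
      fix k assume k: "k \<in> insert i J" "j \<noteq> k"
      show "(H(i := cycle_edges vs)) j \<inter> (H(i := cycle_edges vs)) k = {}"
        using j k dj[of j] dj[of k] Hd[of j k] by (cases "j = i"; cases "k = i") auto
    next
      show "undirected (U1 \<union> N1) \<subseteq> R1" "undirected (U2 \<union> N2) \<subseteq> R2"
        using UR N1R N2R by (auto simp: undirected_Un)
    next
      fix y assume y: "y \<in> V"
      show "card {z. (y, z) \<in> U1 \<union> N1} \<le> 2 * card {j \<in> insert i J. y \<in> Ends j}"
        by (rule load_update(1)[OF vs(1) finJ iJ V(1) U(1) out1 in1 NV(1) N1 y])
      show "card {z. (y, z) \<in> U2 \<union> N2} \<le> 2 * card {j \<in> insert i J. y \<in> S j}"
        by (rule load_update(1)[OF vs(1) finJ iJ V(1) U(2) out2 in2 NV(2) N2 y])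
      show "card {z. (z, y) \<in> U1 \<union> N1} \<le> sqrt \<eta> * n + 2"
        by (rule load_update(2)[OF vs(1) finJ iJ V(1) U(1) out1 in1 NV(1) N1 y])
      show "card {z. (z, y) \<in> U2 \<union> N2} \<le> sqrt \<gamma> * n + 2"
        by (rule load_update(2)[OF vs(1) finJ iJ V(1) U(2) out2 in2 NV(2) N2 y])
    qed (use U NV in auto)
    then show ?case by blast
  qed
  then obtain H U1 U2 where inv: "inv I H U1 U2" by blast
  show ?thesis
  proof (intro exI[of _ H] conjI ballI impI)
    show "hamilton_cycle V (\<Union>(undirected ` F ` I) \<union> R1 \<union> R2) (H i)" if "i \<in> I" for i
      using inv that unfolding inv_def E_def by simp
    show "H i \<inter> H j = {}" if "i \<in> I" "j \<in> I" "i \<noteq> j" for i j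
      using inv that unfolding inv_def by simp
  qed
qed

section \<open>Reservoirs drawn from the colour classes\<close>

lemma undirected_mono: "R \<subseteq> S \<Longrightarrow> undirected R \<subseteq> undirected S"
  unfolding undirected_def by blast

lemma hamilton_cycle_mono: "hamilton_cycle V E C \<Longrightarrow> E \<subseteq> E' \<Longrightarrow> hamilton_cycle V E' C"
  by (auto simp: hamilton_cycle_def)

lemma undirected_iff: "{u, w} \<in> undirected R \<longleftrightarrow> (u, w) \<in> R \<or> (w, u) \<in> R"
  by (auto simp: undirected_def doubleton_eq_iff)

lemma card_undirected_neighbours:
  assumes "single_valued R" "single_valued (R\<inverse>)"
  shows "finite {w. {v, w} \<in> undirected R}" "card {w. {v, w} \<in> undirected R} \<le> 2"
proof -
  define a where "a = (THE w. (v, w) \<in> R)"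
  define b where "b = (THE w. (w, v) \<in> R)"
  have a: "w = a" if "(v, w) \<in> R" for w
    unfolding a_def using that assms(1) by (intro the_equality[symmetric]) (auto simp: single_valued_def)
  have b: "w = b" if "(w, v) \<in> R" for w
    unfolding b_def using that assms(2) by (intro the_equality[symmetric]) (auto simp: single_valued_def)
  have sub: "{w. {v, w} \<in> undirected R} \<subseteq> {a, b}"
    using a b by (auto simp: undirected_iff)
  show "finite {w. {v, w} \<in> undirected R}" using finite_subset[OF sub] by simp
  have "card {w. {v, w} \<in> undirected R} \<le> card {a, b}" using sub by (intro card_mono) auto
  also have "\<dots> \<le> 2" by (simp add: card_insert_if)
  finally show "card {w. {v, w} \<in> undirected R} \<le> 2" .
qed

lemma card_preimage_le:
  assumes "finite J" "finite L" "\<And>c. card {l \<in> L. p l = c} \<le> 2"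
  shows "card {l \<in> L. p l \<in> J} \<le> 2 * card J"
proof -
  have "{l \<in> L. p l \<in> J} = (\<Union>c\<in>J. {l \<in> L. p l = c})" by auto
  also have "card \<dots> \<le> (\<Sum>c\<in>J. card {l \<in> L. p l = c})" by (rule card_UN_le[OF assms(1)])
  also have "\<dots> \<le> (\<Sum>c\<in>J. 2)" by (intro sum_mono assms(3))
  finally show ?thesis by simp
qed

text \<open>Both reservoirs are unions of whole colour classes \<open>N i\<close>, so they are
  disjoint from the remaining forests automatically. The price is the loss of their indices, at most
  \<open>8 * \<rho> * n\<close> cycles.\<close>

lemma packing_from_classes:
  fixes \<eta> \<gamma> \<sigma> T b1 b2 \<rho> :: real and h :: "'i \<Rightarrow> 'a \<Rightarrow> nat"
  assumes V: "finite V" "card V = n" "3 \<le> n"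
    and C: "finite C" "card C \<le> n" and Good: "I \<subseteq> C"
    and N: "\<And>i. i \<in> C \<Longrightarrow> single_valued (N i)" "\<And>i. i \<in> C \<Longrightarrow> single_valued ((N i)\<inverse>)"
      "\<And>i j. i \<in> C \<Longrightarrow> j \<in> C \<Longrightarrow> i \<noteq> j \<Longrightarrow> undirected (N i) \<inter> undirected (N j) = {}"
    and X: "X = \<Union>(undirected ` N ` C)"
    and S: "\<And>i. i \<in> I \<Longrightarrow> S i \<subseteq> V" "\<And>i. i \<in> I \<Longrightarrow> 2 \<le> card (V - S i)"
      "\<And>i. i \<in> I \<Longrightarrow> card (S i) \<le> \<sigma> * n"
    and F: "\<And>i. i \<in> I \<Longrightarrow> F i \<subseteq> (V - S i) \<times> (V - S i)" "\<And>i. i \<in> I \<Longrightarrow> F i \<subseteq> N i"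
      "\<And>i u w. i \<in> I \<Longrightarrow> (u, w) \<in> F i \<Longrightarrow> h i u < h i w"
      "\<And>i. i \<in> I \<Longrightarrow> card ((V - S i) - Domain (F i)) \<le> T * n"
    and ends: "\<And>v. v \<in> V \<Longrightarrow>
        card {i \<in> I. v \<in> (V - S i - Domain (F i)) \<union> (V - S i - Range (F i))} \<le> \<eta> * n"
      "\<And>v. v \<in> V \<Longrightarrow> card {i \<in> I. v \<in> S i} \<le> \<gamma> * n"
    and \<eta>: "0 < \<eta>" "\<eta> \<le> 1" "2 \<le> sqrt \<eta> * n" and \<gamma>: "0 < \<gamma>" "\<gamma> \<le> 1" "2 \<le> sqrt \<gamma> * n"
    and link: "\<And>i x z. i \<in> I \<Longrightarrow> x \<in> V - S i \<Longrightarrow> z \<in> V - S i \<Longrightarrow> x \<noteq> z \<Longrightarrow>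
        b1 * n \<le> card {s \<in> S i. {x, s} \<in> X \<and> {z, s} \<in> X}"
    and absorb: "\<And>i s. i \<in> I \<Longrightarrow> s \<in> S i \<Longrightarrow>
        b2 * n \<le> card {e \<in> F i. {s, fst e} \<in> X \<and> {s, snd e} \<in> X}"
    and b: "0 < b1" "b1 \<le> 1" "0 < b2" "b2 \<le> 1" and \<rho>: "0 < \<rho>" "32 * \<rho> \<le> b2"
    and c: "T + 14 * sqrt \<eta> \<le> \<rho>\<^sup>2 * b1 / 4" "\<sigma> + 14 * sqrt \<gamma> \<le> \<rho>\<^sup>2 * b2 / 8"
    and small: "2 * real n ^ 3 * (2 * exp (- (\<rho> ^ 4 * b1\<^sup>2 / 32) * real n)) < 1"
      "2 * real n ^ 3 * (2 * exp (- (\<rho> ^ 4 * (b2 / 2)\<^sup>2 / 32) * real n)) < 1"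
  shows "\<exists>H. edge_disjoint_hamilton_cycles V X H \<and> real (card I) - 8 * \<rho> * n \<le> card H"
proof -
  have finI: "finite I" using Good C finite_subset by blast
  have \<rho>1: "\<rho> \<le> 1" using \<rho> b by linarith
  have n1: "1 \<le> n" using V by simp
  define col where "col e = (THE i. i \<in> C \<and> e \<in> undirected (N i))" for e
  have col: "col e \<in> C \<and> e \<in> undirected (N (col e))" if "e \<in> X" for e
  proof -
    obtain i where i: "i \<in> C" "e \<in> undirected (N i)" using \<open>e \<in> X\<close> X by auto
    then have "col e = i" unfolding col_def using N(3) by (intro the_equality) auto
    then show ?thesis using i by simp
  qed
  \<comment> \<open>A colour class has at most one edge into and one out of a vertex; this is the
    multiplicity two on which \<open>thin_colour_pairs\<close> relies.\<close>
  have nbrs: "card {w \<in> A. {v, w} \<in> X \<and> col {v, w} = c} \<le> 2" for v c A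
  proof (cases "c \<in> C")
    case True
    have "card {w \<in> A. {v, w} \<in> X \<and> col {v, w} = c} \<le> card {w. {v, w} \<in> undirected (N c)}"
      using col by (intro card_mono card_undirected_neighbours(1)[OF N(1,2)[OF True]]) auto
    also have "\<dots> \<le> 2" by (rule card_undirected_neighbours(2)[OF N(1,2)[OF True]])
    finally show ?thesis .
  next
    case False
    then have e: "{w \<in> A. {v, w} \<in> X \<and> col {v, w} = c} = {}" using col by auto
    show ?thesis unfolding e by simp
  qed
  have finS: "finite (S i)" if "i \<in> I" for i using S(1)[OF that] V(1) finite_subset by blast
  have finF: "finite (F i)" if "i \<in> I" for i
    using F(1)[OF that] V(1) finite_subset by (metis finite_Diff finite_SigmaI)
  have svF: "single_valued (F i)" "single_valued ((F i)\<inverse>)" if "i \<in> I" for i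
  proof -
    have i: "i \<in> C" using that Good by blast
    show "single_valued (F i)" by (rule single_valued_subset[OF F(2)[OF that] N(1)[OF i]])
    have "(F i)\<inverse> \<subseteq> (N i)\<inverse>" using F(2)[OF that] by auto
    then show "single_valued ((F i)\<inverse>)" by (rule single_valued_subset[OF _ N(2)[OF i]])
  qed
  \<comment> \<open>One event for every forest and every pair of vertices outside
    \<open>S i\<close>: these cover all links that any course of the construction might
    request.\<close>
  define K1 where "K1 = {(i, x, z). i \<in> I \<and> x \<in> V - S i \<and> z \<in> V - S i \<and> x \<noteq> z}"
  define L1 where "L1 = (\<lambda>(i, x, z). {s \<in> S i. {x, s} \<in> X \<and> {z, s} \<in> X})"
  have K1_sub: "K1 \<subseteq> C \<times> V \<times> V" using Good by (auto simp: K1_def)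
  have K1: "finite K1" "card K1 \<le> n ^ 3"
  proof -
    show "finite K1" using K1_sub C(1) V(1) by (meson finite_SigmaI finite_subset)
    have "card K1 \<le> card (C \<times> V \<times> V)" using K1_sub C(1) V(1) by (intro card_mono) auto
    also have "\<dots> \<le> n * (n * n)" using C(2) V(2) by (simp add: card_cartesian_product)
    finally show "card K1 \<le> n ^ 3" by (simp add: power3_eq_cube)
  qed
  have "\<exists>J\<subseteq>C. card J \<le> 4 * \<rho> * n \<and> (\<forall>\<kappa>\<in>K1. \<rho>\<^sup>2 * b1 / 4 * n \<le>
     card {s \<in> L1 \<kappa>. col {fst (snd \<kappa>), s} \<in> J \<and> col {snd (snd \<kappa>), s} \<in> J})"
  proof (rule thin_colour_pairs[OF \<rho>(1) \<rho>1 b(1,2) n1 C K1 _ _ _ _ _ _ small(1)])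
    fix \<kappa> assume "\<kappa> \<in> K1"
    then obtain i x z where \<kappa>: "\<kappa> = (i, x, z)" "i \<in> I" "x \<in> V - S i" "z \<in> V - S i" "x \<noteq> z"
      by (auto simp: K1_def)
    show "finite (L1 \<kappa>)" using finS[OF \<kappa>(2)] by (simp add: \<kappa>(1) L1_def)
    show "(\<lambda>s. col {fst (snd \<kappa>), s}) ` L1 \<kappa> \<subseteq> C" "(\<lambda>s. col {snd (snd \<kappa>), s}) ` L1 \<kappa> \<subseteq> C"
      using col by (auto simp: \<kappa>(1) L1_def)
    show "b1 * n \<le> card (L1 \<kappa>)" using link[OF \<kappa>(2-5)] by (simp add: \<kappa>(1) L1_def)
    fix c
    have "card {s \<in> L1 \<kappa>. col {x, s} = c} \<le> card {s \<in> S i. {x, s} \<in> X \<and> col {x, s} = c}"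
      using finS[OF \<kappa>(2)] by (intro card_mono) (auto simp: \<kappa>(1) L1_def)
    then show "card {s \<in> L1 \<kappa>. col {fst (snd \<kappa>), s} = c} \<le> 2"
      using nbrs[of "S i" x c] by (simp add: \<kappa>(1))
    have "card {s \<in> L1 \<kappa>. col {z, s} = c} \<le> card {s \<in> S i. {z, s} \<in> X \<and> col {z, s} = c}"
      using finS[OF \<kappa>(2)] by (intro card_mono) (auto simp: \<kappa>(1) L1_def)
    then show "card {s \<in> L1 \<kappa>. col {snd (snd \<kappa>), s} = c} \<le> 2"
      using nbrs[of "S i" z c] by (simp add: \<kappa>(1))
  qed
  then obtain J1 where J1: "J1 \<subseteq> C" "card J1 \<le> 4 * \<rho> * n"
    and J1_pairs: "\<forall>\<kappa>\<in>K1. \<rho>\<^sup>2 * b1 / 4 * n \<le>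
     card {s \<in> L1 \<kappa>. col {fst (snd \<kappa>), s} \<in> J1 \<and> col {snd (snd \<kappa>), s} \<in> J1}"
    by (elim exE conjE)
  have finJ1: "finite J1" using J1(1) C(1) finite_subset by blast
  define K2 where "K2 = Sigma I S"
  define L0 where "L0 = (\<lambda>(i, s). {e \<in> F i. {s, fst e} \<in> X \<and> {s, snd e} \<in> X})"
  \<comment> \<open>\<open>J2\<close> has to avoid \<open>J1\<close>, so candidates with a colour in
    \<open>J1\<close> are discarded in advance. They are at most \<open>4 * card J1\<close>, hence
    \<open>16 * \<rho> * n\<close>, and \<open>32 * \<rho> \<le> b2\<close> leaves half of the
    supply.\<close>
  define L2 where "L2 \<kappa> = {e \<in> L0 \<kappa>. col {snd \<kappa>, fst e} \<notin> J1 \<and> col {snd \<kappa>, snd e} \<notin> J1}" for \<kappa>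
  have K2: "finite K2" "card K2 \<le> n ^ 3"
  proof -
    show "finite K2" using finI finS by (simp add: K2_def)
    have "K2 \<subseteq> C \<times> V" using Good S(1) by (auto simp: K2_def)
    then have "card K2 \<le> card (C \<times> V)" using C(1) V(1) by (intro card_mono) auto
    also have "\<dots> \<le> n * n" using C(2) V(2) by (simp add: card_cartesian_product)
    also have "\<dots> \<le> n ^ 3" using n1 by (simp add: power3_eq_cube)
    finally show "card K2 \<le> n ^ 3" .
  qed
  have finL0: "finite (L0 (i, s))" if "i \<in> I" for i s using finF[OF that] by (simp add: L0_def)
  have fib1: "card {e \<in> L0 (i, s). col {s, fst e} = c} \<le> 2" if "i \<in> I" for i s c
  proof -
    have "card {e \<in> L0 (i, s). col {s, fst e} = c} \<le> card {w \<in> V. {s, w} \<in> X \<and> col {s, w} = c}"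
    proof (rule card_inj_on_le[of fst])
      show "inj_on fst {e \<in> L0 (i, s). col {s, fst e} = c}"
        using svF(1)[OF that] by (auto simp: L0_def inj_on_def single_valued_def)
    qed (use F(1)[OF that] V(1) in \<open>auto simp: L0_def\<close>)
    then show ?thesis using nbrs[of V s c] by linarith
  qed
  have fib2: "card {e \<in> L0 (i, s). col {s, snd e} = c} \<le> 2" if "i \<in> I" for i s c
  proof -
    have "card {e \<in> L0 (i, s). col {s, snd e} = c} \<le> card {w \<in> V. {s, w} \<in> X \<and> col {s, w} = c}"
    proof (rule card_inj_on_le[of snd])
      show "inj_on snd {e \<in> L0 (i, s). col {s, snd e} = c}"
        using svF(2)[OF that] by (auto simp: L0_def inj_on_def single_valued_def)
    qed (use F(1)[OF that] V(1) in \<open>auto simp: L0_def\<close>)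
    then show ?thesis using nbrs[of V s c] by linarith
  qed
  have "\<exists>J\<subseteq>C - J1. card J \<le> 4 * \<rho> * n \<and> (\<forall>\<kappa>\<in>K2. \<rho>\<^sup>2 * (b2 / 2) / 4 * n \<le>
     card {e \<in> L2 \<kappa>. col {snd \<kappa>, fst e} \<in> J \<and> col {snd \<kappa>, snd e} \<in> J})"
  proof (rule thin_colour_pairs[OF \<rho>(1) \<rho>1 _ _ n1 _ _ K2 _ _ _ _ _ _ small(2)])
    show "card (C - J1) \<le> n" using C(2) card_mono[OF C(1), of "C - J1"] by auto
    fix \<kappa> assume "\<kappa> \<in> K2"
    then obtain i s where \<kappa>: "\<kappa> = (i, s)" "i \<in> I" "s \<in> S i"
      by (auto simp: K2_def)
    show fin2: "finite (L2 \<kappa>)" using finL0[OF \<kappa>(2)] by (simp add: \<kappa>(1) L2_def)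
    show "(\<lambda>e. col {snd \<kappa>, fst e}) ` L2 \<kappa> \<subseteq> C - J1" "(\<lambda>e. col {snd \<kappa>, snd e}) ` L2 \<kappa> \<subseteq> C - J1"
      using col by (auto simp: \<kappa>(1) L2_def L0_def)
    have "L0 \<kappa> \<subseteq> L2 \<kappa> \<union> {e \<in> L0 \<kappa>. col {s, fst e} \<in> J1} \<union> {e \<in> L0 \<kappa>. col {s, snd e} \<in> J1}"
      by (auto simp: \<kappa>(1) L2_def)
    then have "card (L0 \<kappa>) \<le> card (L2 \<kappa> \<union> {e \<in> L0 \<kappa>. col {s, fst e} \<in> J1} \<union> {e \<in> L0 \<kappa>. col {s, snd e} \<in> J1})"
      using fin2 finL0[OF \<kappa>(2)] by (intro card_mono) (auto simp: \<kappa>(1))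
    also have "\<dots> \<le> card (L2 \<kappa>) + card {e \<in> L0 \<kappa>. col {s, fst e} \<in> J1} + card {e \<in> L0 \<kappa>. col {s, snd e} \<in> J1}"
      by (meson add_right_mono card_Un_le order_trans)
    finally have "card (L0 \<kappa>) \<le> card (L2 \<kappa>) + 2 * card J1 + 2 * card J1"
      using card_preimage_le[OF finJ1 finL0[OF \<kappa>(2), of s] fib1[OF \<kappa>(2)]]
        card_preimage_le[OF finJ1 finL0[OF \<kappa>(2), of s] fib2[OF \<kappa>(2)]]
      unfolding \<kappa>(1) by linarith
    moreover have "b2 * n \<le> card (L0 \<kappa>)" using absorb[OF \<kappa>(2,3)] by (simp add: \<kappa>(1) L0_def)
    moreover have "16 * \<rho> * n \<le> b2 / 2 * n" using \<rho>(2) by (intro mult_right_mono) auto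
    ultimately show "b2 / 2 * n \<le> card (L2 \<kappa>)" using J1(2) by linarith
    fix c
    have "card {e \<in> L2 \<kappa>. col {s, fst e} = c} \<le> card {e \<in> L0 \<kappa>. col {s, fst e} = c}"
      using finL0[OF \<kappa>(2)] by (intro card_mono) (auto simp: \<kappa>(1) L2_def)
    then show "card {e \<in> L2 \<kappa>. col {snd \<kappa>, fst e} = c} \<le> 2"
      using fib1[OF \<kappa>(2), of s c] by (simp add: \<kappa>(1))
    have "card {e \<in> L2 \<kappa>. col {s, snd e} = c} \<le> card {e \<in> L0 \<kappa>. col {s, snd e} = c}"
      using finL0[OF \<kappa>(2)] by (intro card_mono) (auto simp: \<kappa>(1) L2_def)
    then show "card {e \<in> L2 \<kappa>. col {snd \<kappa>, snd e} = c} \<le> 2"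
      using fib2[OF \<kappa>(2), of s c] by (simp add: \<kappa>(1))
  qed (use b C in auto)
  then obtain J2 where J2: "J2 \<subseteq> C - J1" "card J2 \<le> 4 * \<rho> * n"
    and J2_pairs: "\<forall>\<kappa>\<in>K2. \<rho>\<^sup>2 * (b2 / 2) / 4 * n \<le>
     card {e \<in> L2 \<kappa>. col {snd \<kappa>, fst e} \<in> J2 \<and> col {snd \<kappa>, snd e} \<in> J2}"
    by (elim exE conjE)
  define R1 where "R1 = \<Union>(undirected ` N ` J1)"
  define R2 where "R2 = \<Union>(undirected ` N ` J2)"
  define I' where "I' = I - J1 - J2"
  have I': "I' \<subseteq> I" by (auto simp: I'_def)
  have undF: "undirected (F i) \<subseteq> undirected (N i)" if "i \<in> I" for i
    by (rule undirected_mono[OF F(2)[OF that]])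
  have dis: "undirected (N i) \<inter> \<Union>(undirected ` N ` J) = {}" if "i \<in> C" "J \<subseteq> C" "i \<notin> J" for i J
    using that N(3)[OF that(1)] by (auto 4 3)
  have R12: "R1 \<inter> R2 = {}"
    unfolding R1_def using dis[of _ J2] J1(1) J2(1) unfolding R2_def by (auto 4 3)
  have inR1: "e \<in> R1" if "e \<in> X" "col e \<in> J1" for e
    using col[OF that(1)] that(2) by (auto simp: R1_def)
  have inR2: "e \<in> R2" if "e \<in> X" "col e \<in> J2" for e
    using col[OF that(1)] that(2) by (auto simp: R2_def)
  have "\<exists>H. (\<forall>i\<in>I'. hamilton_cycle V (\<Union>(undirected ` F ` I') \<union> R1 \<union> R2) (H i)) \<and>
     (\<forall>i\<in>I'. \<forall>j\<in>I'. i \<noteq> j \<longrightarrow> H i \<inter> H j = {})"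
  proof (rule greedy_packing[OF V _ _ _ _ _ _ _ _ _ _ _ R12 _ _ \<eta> \<gamma>, where h = h and S = S
        and T = T and \<sigma> = \<sigma> and ?c1.0 = "\<rho>\<^sup>2 * b1 / 4" and ?c2.0 = "\<rho>\<^sup>2 * b2 / 8"])
    show "finite I'" using finI I' finite_subset by blast
    fix i assume i': "i \<in> I'"
    then have i: "i \<in> I" "i \<in> C" "i \<notin> J1" "i \<notin> J2" using Good by (auto simp: I'_def)
    show "S i \<subseteq> V" "2 \<le> card (V - S i)" "card (S i) \<le> \<sigma> * n" by (rule S[OF i(1)])+
    show "F i \<subseteq> (V - S i) \<times> (V - S i)" "card ((V - S i) - Domain (F i)) \<le> T * n"
      by (rule F[OF i(1)])+
    show "single_valued (F i)" "single_valued ((F i)\<inverse>)" by (rule svF[OF i(1)])+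
    show "h i u < h i w" if "(u, w) \<in> F i" for u w by (rule F(3)[OF i(1) that])
    show "undirected (F i) \<inter> undirected (F j) = {}" if "j \<in> I'" "i \<noteq> j" for j
      using N(3)[OF i(2), of j] undF[OF i(1)] undF[of j] that I' Good by blast
    show "undirected (F i) \<inter> (R1 \<union> R2) = {}"
      using dis[OF i(2) J1(1) i(3)] dis[OF i(2) _ i(4)] J2(1) undF[OF i(1)]
      unfolding R1_def R2_def by blast
    show "\<rho>\<^sup>2 * b1 / 4 * n \<le> card {s \<in> S i. {x, s} \<in> R1 \<and> {z, s} \<in> R1}"
      if "x \<in> V - S i" "z \<in> V - S i" "x \<noteq> z" for x z
    proof -
      have "(i, x, z) \<in> K1" using that i by (simp add: K1_def)
      from bspec[OF J1_pairs this]
      have "\<rho>\<^sup>2 * b1 / 4 * n \<le> card {s \<in> L1 (i, x, z). col {x, s} \<in> J1 \<and> col {z, s} \<in> J1}" by simp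
      also have "\<dots> \<le> card {s \<in> S i. {x, s} \<in> R1 \<and> {z, s} \<in> R1}"
        unfolding of_nat_le_iff using finS[OF i(1)] inR1 by (intro card_mono) (auto simp: L1_def)
      finally show ?thesis .
    qed
    show "\<rho>\<^sup>2 * b2 / 8 * n \<le> card {e \<in> F i. {s, fst e} \<in> R2 \<and> {s, snd e} \<in> R2}"
      if "s \<in> S i" for s
    proof -
      have "(i, s) \<in> K2" using that i by (simp add: K2_def)
      from bspec[OF J2_pairs this]
      have "\<rho>\<^sup>2 * b2 / 8 * n \<le> card {e \<in> L2 (i, s). col {s, fst e} \<in> J2 \<and> col {s, snd e} \<in> J2}" by simp
      also have "\<dots> \<le> card {e \<in> F i. {s, fst e} \<in> R2 \<and> {s, snd e} \<in> R2}"
        unfolding of_nat_le_iff using finF[OF i(1)] inR2 by (intro card_mono) (auto simp: L2_def L0_def)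
      finally show ?thesis .
    qed
  next
    fix v assume v: "v \<in> V"
    have "card {i \<in> I'. v \<in> (V - S i - Domain (F i)) \<union> (V - S i - Range (F i))}
       \<le> card {i \<in> I. v \<in> (V - S i - Domain (F i)) \<union> (V - S i - Range (F i))}"
      using finI I' by (intro card_mono) auto
    then show "card {i \<in> I'. v \<in> (V - S i - Domain (F i)) \<union> (V - S i - Range (F i))} \<le> \<eta> * n"
      using ends(1)[OF v] by linarith
    have "card {i \<in> I'. v \<in> S i} \<le> card {i \<in> I. v \<in> S i}"
      using finI I' by (intro card_mono) auto
    then show "card {i \<in> I'. v \<in> S i} \<le> \<gamma> * n" using ends(2)[OF v] by linarith
  qed (use c in auto)
  then obtain H where H0: "\<forall>i\<in>I'. hamilton_cycle V (\<Union>(undirected ` F ` I') \<union> R1 \<union> R2) (H i)"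
    "\<forall>i\<in>I'. \<forall>j\<in>I'. i \<noteq> j \<longrightarrow> H i \<inter> H j = {}" by (elim exE conjE)
  have H: "hamilton_cycle V (\<Union>(undirected ` F ` I') \<union> R1 \<union> R2) (H i)" if "i \<in> I'" for i
    by (rule bspec[OF H0(1) that])
  have H2: "H i \<inter> H j = {}" if "i \<in> I'" "j \<in> I'" "i \<noteq> j" for i j
    using H0(2) that by simp
  have sub: "\<Union>(undirected ` F ` I') \<union> R1 \<union> R2 \<subseteq> X"
    using undF Good J1(1) J2(1) unfolding X R1_def R2_def I'_def by blast
  have hc: "hamilton_cycle V X (H i)" if "i \<in> I'" for i
    by (rule hamilton_cycle_mono[OF H[OF that] sub])
  \<comment> \<open>Disjoint cycles are distinct only because they are nonempty; this is what makes
    the number of cycles equal to the number of indices.\<close>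
  have ne: "H i \<noteq> {}" if i: "i \<in> I'" for i
  proof -
    obtain vs where "3 \<le> length vs" "H i = cycle_edges vs"
      using hc[OF i] by (auto simp: hamilton_cycle_def)
    then have "{vs ! 0, vs ! (Suc 0 mod length vs)} \<in> H i"
      by (auto simp: cycle_edges_def intro!: exI[of _ 0])
    then show ?thesis by blast
  qed
  have "inj_on H I'"
  proof (rule inj_onI, rule ccontr)
    fix i j assume "i \<in> I'" "j \<in> I'" "H i = H j" "i \<noteq> j"
    then show False using H2[of i j] ne[of i] by auto
  qed
  then have card: "card (H ` I') = card I'" by (rule card_image)
  have "card I \<le> card (I' \<union> (J1 \<union> J2))"
    using finI finJ1 J2(1) C(1) finite_subset[of J2 C] by (intro card_mono) (auto simp: I'_def)
  also have "\<dots> \<le> card I' + (card J1 + card J2)"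
    by (meson add_left_mono card_Un_le order_trans)
  finally have "real (card I) - 8 * \<rho> * n \<le> card (H ` I')" using J1(2) J2(2) card by linarith
  moreover have "edge_disjoint_hamilton_cycles V X (H ` I')"
    unfolding edge_disjoint_hamilton_cycles_def disjoint_def using hc H2 by auto
  ultimately show ?thesis by blast
qed

section \<open>Decomposition into linear forests\<close>

lemma mult_mod_prime_inj:
  fixes p :: nat
  assumes "prime p" "m \<in> {1..<p}"
  shows "inj_on (\<lambda>a. a * m mod p) {1..<p}"
proof (rule inj_onI)
  fix a b assume a: "a \<in> {1..<p}" and b: "b \<in> {1..<p}" and eq: "a * m mod p = b * m mod p"
  have "\<not> p dvd m" using assms(2) by (auto dest: dvd_imp_le)
  then have "coprime m p" using prime_imp_coprime[OF assms(1)] by (simp add: coprime_commute)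
  moreover have "[a * m = b * m] (mod p)" using eq by (simp add: cong_def)
  ultimately have "[a = b] (mod p)" using cong_mult_rcancel_nat by blast
  then show "a = b" using a b by (simp add: cong_def)
qed

lemma mult_mod_prime_image:
  fixes p :: nat
  assumes "prime p" "m \<in> {1..<p}"
  shows "(\<lambda>a. a * m mod p) ` {1..<p} = {1..<p}"
proof (rule endo_inj_surj)
  show "(\<lambda>a. a * m mod p) ` {1..<p} \<subseteq> {1..<p}"
  proof
    fix y assume "y \<in> (\<lambda>a. a * m mod p) ` {1..<p}"
    then obtain a where a: "a \<in> {1..<p}" "y = a * m mod p" by blast
    have "\<not> p dvd a * m" using assms a(1) prime_dvd_mult_iff[OF assms(1), of a m]
      by (auto dest: dvd_imp_le)
    then have "0 < y" unfolding a(2) by (simp add: dvd_eq_mod_eq_0)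
    moreover have "y < p" using assms(1) a(2) prime_gt_0_nat by simp
    ultimately show "y \<in> {1..<p}" by simp
  qed
qed (use mult_mod_prime_inj[OF assms] in auto)

text \<open>The next two lemmas say that the Hamilton paths which run through \<open>{1..<p}\<close> in the order of
  increasing \<open>a * m mod p\<close>, for \<open>1 \<le> m \<le> (p - 1) div 2\<close>, decompose the complete graph on \<open>{1..<p}\<close>.\<close>

lemma consecutive_multiple_exists:
  fixes p a b :: nat
  assumes p: "prime p" "odd p" and ab: "a \<in> {1..<p}" "b \<in> {1..<p}" "a \<noteq> b"
  shows "\<exists>m\<in>{1..(p - 1) div 2}. a * m mod p = b * m mod p + 1 \<or> b * m mod p = a * m mod p + 1"
proof -
  \<comment> \<open>The congruence is an equality of residues because \<open>x * m\<close> is not 0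
    modulo \<open>p\<close>: the step from p - 1 to 0, which would close the path, does not
    occur.\<close>
  have step: "x * m mod p = y * m mod p + 1"
    if "x \<in> {1..<p}" "m \<in> {1..<p}" "[x * m = y * m + 1] (mod p)" for x y m :: nat
  proof -
    have x: "x * m mod p \<in> {1..<p}" using mult_mod_prime_image[OF p(1) that(2)] that(1) by blast
    have "x * m mod p = (y * m mod p + 1) mod p"
      using that(3) by (simp add: cong_def mod_simps)
    moreover have "y * m mod p < p" using p(1) prime_gt_0_nat by simp
    ultimately show ?thesis using x
      by (cases "y * m mod p + 1 = p") auto
  qed
  \<comment> \<open>For the inverse \<open>m\<close> of \<open>d\<close> modulo \<open>p\<close>,
    multiplication by \<open>m\<close> puts a directly after b.\<close>
  define d where "d = int a - int b"
  have "\<not> int p dvd d"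
    using ab zdvd_imp_le[of "int p" "\<bar>d\<bar>"] by (auto simp: d_def)
  then have "coprime d (int p)"
    using prime_imp_coprime[of "int p" d] p(1) by (simp add: coprime_commute)
  then obtain x where x: "[d * x = 1] (mod int p)" using cong_solve_coprime_int by blast
  define m where "m = nat (x mod int p)"
  have p0: "p > 0" using p prime_gt_0_nat by blast
  have m: "int m = x mod int p" "m < p" using p0 by (auto simp: m_def nat_less_iff)
  have dm: "[d * int m = 1] (mod int p)" using x m(1) by (simp add: cong_def mod_simps)
  have "m \<noteq> 0"
  proof
    assume "m = 0"
    then have "int p dvd 1" using dm by (simp add: cong_def mod_eq_0_iff_dvd cong_iff_dvd_diff)
    then show False using p(1) prime_gt_1_nat by force
  qed
  then have m1: "m \<in> {1..<p}" using m by simp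
  show ?thesis
  proof (cases "m \<le> (p - 1) div 2")
    case True
    have "[int (a * m) = int (b * m + 1)] (mod int p)"
      using dm by (simp add: d_def cong_iff_dvd_diff algebra_simps)
    then have "[a * m = b * m + 1] (mod p)" by (simp only: cong_int_iff)
    then have "a * m mod p = b * m mod p + 1" by (rule step[OF ab(1) m1])
    then show ?thesis using True m1 by (intro bexI[of _ m]) auto
  next
    case False
    \<comment> \<open>Replacing \<open>m\<close> by \<open>p - m\<close> reverses the path, so a and
      b exchange their roles; one of the two multipliers is at most (p - 1)/2.\<close>
    define m' where "m' = p - m"
    have m': "m' \<in> {1..<p}" "m' \<le> (p - 1) div 2"
      using m1 False p(2) unfolding m'_def by (auto elim!: oddE)
    have "int m' = int p - int m" using m1 by (simp add: m'_def)
    then have "int (b * m') - int (a * m' + 1) = (d * int m - 1) - int p * d"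
      by (simp only: d_def of_nat_mult of_nat_add of_nat_1) (simp add: algebra_simps)
    also have "int p dvd \<dots>" using dm by (simp add: cong_iff_dvd_diff)
    finally have "[int (b * m') = int (a * m' + 1)] (mod int p)"
      by (simp only: cong_iff_dvd_diff)
    then have "[b * m' = a * m' + 1] (mod p)" by (simp only: cong_int_iff)
    then have "b * m' mod p = a * m' mod p + 1" by (rule step[OF ab(2) m'(1)])
    then show ?thesis using m' by (intro bexI[of _ m']) auto
  qed
qed

lemma consecutive_multiple_unique:
  fixes p a b :: nat
  assumes p: "prime p" and ab: "a \<in> {1..<p}" "b \<in> {1..<p}"
    and m: "m \<in> {1..(p - 1) div 2}" "m' \<in> {1..(p - 1) div 2}"
    and eq: "a * m mod p = b * m mod p + 1 \<or> b * m mod p = a * m mod p + 1"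
      "a * m' mod p = b * m' mod p + 1 \<or> b * m' mod p = a * m' mod p + 1"
  shows "m = m'"
proof -
  define d where "d = int a - int b"
  have *: "\<exists>s\<in>{1, -1}. int p dvd d * int x - s"
    if "a * x mod p = b * x mod p + 1 \<or> b * x mod p = a * x mod p + 1" for x
  proof -
    have e: "d * int x - s = int p * (int (a * x div p) - int (b * x div p)) + (int (a * x mod p) - int (b * x mod p) - s)" for s
    proof -
      have "int (a * x) = int p * int (a * x div p) + int (a * x mod p)"
        "int (b * x) = int p * int (b * x div p) + int (b * x mod p)"
        by (metis mult_div_mod_eq of_nat_add of_nat_mult)+
      then show ?thesis by (simp add: d_def algebra_simps)
    qed
    from that show ?thesis
    proof
      assume "a * x mod p = b * x mod p + 1"
      then have "d * int x - 1 = int p * (int (a * x div p) - int (b * x div p))" unfolding e by simp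
      then show ?thesis by auto
    next
      assume "b * x mod p = a * x mod p + 1"
      then have "d * int x - (-1) = int p * (int (a * x div p) - int (b * x div p))" unfolding e by simp
      then show ?thesis by (metis dvd_triv_left insert_iff)
    qed
  qed
  obtain s where s: "s = 1 \<or> s = -1" "int p dvd d * int m - s" using *[OF eq(1)] by blast
  obtain s' where s': "s' = 1 \<or> s' = -1" "int p dvd d * int m' - s'" using *[OF eq(2)] by blast
  \<comment> \<open>Both multipliers are inverses of \<open>d\<close> up to sign. Eliminating the
    signs leaves a multiple of \<open>p\<close> of absolute value at most m + m' < p, that is
    0.\<close>
  have "int p dvd s' * (d * int m - s) - s * (d * int m' - s')"
    by (rule dvd_diff[OF dvd_mult[OF s(2)] dvd_mult[OF s'(2)]])
  also have "s' * (d * int m - s) - s * (d * int m' - s') = d * (s' * int m - s * int m')"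
    by (simp add: algebra_simps)
  finally have "int p dvd d * (s' * int m - s * int m')" .
  moreover have "a \<noteq> b" using eq(1) by auto
  then have "\<not> int p dvd d"
    using ab zdvd_imp_le[of "int p" "\<bar>d\<bar>"] by (auto simp: d_def)
  ultimately have dv: "int p dvd s' * int m - s * int m'"
    using p by (simp add: prime_dvd_mult_iff)
  have mm: "int m + int m' < int p" "1 \<le> m" "1 \<le> m'"
    using m prime_gt_1_nat[OF p] by auto
  then have "\<bar>s' * int m - s * int m'\<bar> < int p" using s(1) s'(1) by auto
  then have "s' * int m - s * int m' = 0"
    using dv zdvd_imp_le[of "int p" "\<bar>s' * int m - s * int m'\<bar>"] by auto
  then show ?thesis using s(1) s'(1) mm by auto
qed

section \<open>Colour classes along the paths\<close>

text \<open>The relation \<open>R m\<close> joins each layer of the m-th path to the next. Read as a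
  bipartite graph between two copies of \<open>V\<close>, it is coloured in a single application of
  Koenig's theorem. A colour class climbs one layer per edge, with in- and outdegrees at most one,
  so it is a linear forest. Out-edges of a vertex have different colours; their number is therefore
  that of its neighbours in the next part, and likewise for in-edges. The last two conclusions thus
  count the colours missing at a vertex.\<close>

lemma class_decomposition:
  assumes G: "simple_graph V E" and p: "prime p" "odd p"
    and f: "\<And>v. v \<in> V \<Longrightarrow> f v \<in> {1..<p}"
    and D: "\<And>u a. u \<in> V \<Longrightarrow> a \<in> {1..<p} \<Longrightarrow> card {w \<in> nbr E u. f w = a} \<le> D"
  obtains N :: "nat \<times> nat \<Rightarrow> ('a \<times> 'a) set" where
    "\<And>m c u w. (u, w) \<in> N (m, c) \<Longrightarrow> {u, w} \<in> E \<and> f w * m mod p = f u * m mod p + 1"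
    "\<And>i. i \<in> {1..(p - 1) div 2} \<times> {..<D} \<Longrightarrow> single_valued (N i)"
    "\<And>i. i \<in> {1..(p - 1) div 2} \<times> {..<D} \<Longrightarrow> single_valued ((N i)\<inverse>)"
    "\<And>i j. i \<in> {1..(p - 1) div 2} \<times> {..<D} \<Longrightarrow> j \<in> {1..(p - 1) div 2} \<times> {..<D} \<Longrightarrow> i \<noteq> j \<Longrightarrow>
      undirected (N i) \<inter> undirected (N j) = {}"
    "\<And>u w. {u, w} \<in> E \<Longrightarrow> f u \<noteq> f w \<Longrightarrow> \<exists>i\<in>{1..(p - 1) div 2} \<times> {..<D}. {u, w} \<in> undirected (N i)"
    "\<And>m u. m \<in> {1..(p - 1) div 2} \<Longrightarrow> u \<in> V \<Longrightarrow> f u * m mod p < p - 1 \<Longrightarrow>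
      \<exists>a\<in>{1..<p}. card {c \<in> {..<D}. u \<in> Domain (N (m, c))} = card {w \<in> nbr E u. f w = a}"
    "\<And>m u. m \<in> {1..(p - 1) div 2} \<Longrightarrow> u \<in> V \<Longrightarrow> 1 < f u * m mod p \<Longrightarrow>
      \<exists>a\<in>{1..<p}. card {c \<in> {..<D}. u \<in> Range (N (m, c))} = card {w \<in> nbr E u. f w = a}"
proof -
  define M where "M = {1..(p - 1) div 2}"
  have M: "m \<in> {1..<p}" if "m \<in> M" for m
    using that prime_gt_1_nat[OF p(1)] by (auto simp: M_def)
  define R where "R m = {(u, w). {u, w} \<in> E \<and> f w * m mod p = f u * m mod p + 1}" for m
  have RV: "R m \<subseteq> V \<times> V" for m using simple_graph_edgeD[OF G] by (auto simp: R_def)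
  have finV: "finite V" using G by (simp add: simple_graph_def)
  have finR: "finite (R m)" for m using finite_subset[OF RV] finV by simp
  have part: "\<exists>a\<in>{1..<p}. \<forall>w\<in>V. f w * m mod p = y \<longleftrightarrow> f w = a" if my: "m \<in> M" "y \<in> {1..<p}" for m y
  proof -
    obtain a where a: "a \<in> {1..<p}" "y = a * m mod p"
      using mult_mod_prime_image[OF p(1) M[OF my(1)]] my(2) by (metis (no_types, lifting) imageE)
    have "f w * m mod p = y \<longleftrightarrow> f w = a" if "w \<in> V" for w
      using inj_onD[OF mult_mod_prime_inj[OF p(1) M[OF my(1)]], of "f w" a] f[OF that] a
      by auto
    then show ?thesis using a(1) by (intro bexI[of _ a]) auto
  qed
  have range: "f u * m mod p \<in> {1..<p}" if "m \<in> M" "u \<in> V" for m u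
    using imageI[OF f[OF that(2)], of "\<lambda>a. a * m mod p"]
    unfolding mult_mod_prime_image[OF p(1) M[OF that(1)]] .
  have out: "\<exists>a\<in>{1..<p}. {w. (u, w) \<in> R m} = {w \<in> nbr E u. f w = a}"
    if m: "m \<in> M" and u: "u \<in> V" and lt: "f u * m mod p < p - 1" for m u
  proof -
    have "f u * m mod p + 1 \<in> {1..<p}" using lt by auto
    from part[OF m this] obtain a where a: "a \<in> {1..<p}"
      "\<forall>w\<in>V. f w * m mod p = f u * m mod p + 1 \<longleftrightarrow> f w = a" by (elim bexE)
    have "{w. (u, w) \<in> R m} = {w \<in> nbr E u. f w = a}"
      using a(2) simple_graph_edgeD(2)[OF G, of u] unfolding R_def nbr_def by auto
    then show ?thesis using a(1) by blast
  qed
  have inn: "\<exists>a\<in>{1..<p}. {w. (w, u) \<in> R m} = {w \<in> nbr E u. f w = a}"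
    if m: "m \<in> M" and u: "u \<in> V" and gt: "1 < f u * m mod p" for m u
  proof -
    have "f u * m mod p - 1 \<in> {1..<p}" using gt range[OF m u] by auto
    from part[OF m this] obtain a where a: "a \<in> {1..<p}"
      "\<forall>w\<in>V. f w * m mod p = f u * m mod p - 1 \<longleftrightarrow> f w = a" by (elim bexE)
    have "{w. (w, u) \<in> R m} = {w \<in> nbr E u. f w = a}"
    proof (intro set_eqI)
      fix w
      have "f u * m mod p = f w * m mod p + 1 \<longleftrightarrow> f w * m mod p = f u * m mod p - 1"
        using gt by auto
      then show "w \<in> {w. (w, u) \<in> R m} \<longleftrightarrow> w \<in> {w \<in> nbr E u. f w = a}"
        using a(2) simple_graph_edgeD(1)[OF G, of w u] unfolding R_def
        by (auto simp: mem_nbr insert_commute)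
    qed
    then show ?thesis using a(1) by blast
  qed
  have outD: "card {w. (u, w) \<in> R m} \<le> D" if m: "m \<in> M" for m u
  proof (cases "u \<in> V \<and> f u * m mod p < p - 1")
    case True
    then show ?thesis using out[OF m, of u] D[of u] by auto
  next
    case False
    have "(u, w) \<notin> R m" for w
    proof
      assume w: "(u, w) \<in> R m"
      then have "u \<in> V" "w \<in> V" using RV by auto
      then show False using False range[OF m \<open>w \<in> V\<close>] w by (auto simp: R_def)
    qed
    then show ?thesis by simp
  qed
  have inD: "card {w. (w, u) \<in> R m} \<le> D" if m: "m \<in> M" for m u
  proof (cases "u \<in> V \<and> 1 < f u * m mod p")
    case True
    then show ?thesis using inn[OF m, of u] D[of u] by auto
  next
    case False
    have "(w, u) \<notin> R m" for w
    proof
      assume w: "(w, u) \<in> R m"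
      then have "u \<in> V" "w \<in> V" using RV by auto
      then show False using False range[OF m \<open>w \<in> V\<close>] w by (auto simp: R_def)
    qed
    then show ?thesis by simp
  qed
  define ok where "ok m c \<longleftrightarrow> (\<forall>e\<in>R m. c e < D) \<and>
    (\<forall>x y y'. (x, y) \<in> R m \<longrightarrow> (x, y') \<in> R m \<longrightarrow> c (x, y) = c (x, y') \<longrightarrow> y = y') \<and>
    (\<forall>x x' y. (x, y) \<in> R m \<longrightarrow> (x', y) \<in> R m \<longrightarrow> c (x, y) = c (x', y) \<longrightarrow> x = x')" for m c
  have "\<forall>m\<in>M. \<exists>c. ok m c"
  proof
    fix m assume m: "m \<in> M"
    show "\<exists>c. ok m c"
      unfolding ok_def by (rule bipartite_edge_coloring[OF finR outD[OF m] inD[OF m]])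
  qed
  from bchoice[OF this] obtain col where col: "\<forall>m\<in>M. ok m (col m)" by (elim exE)
  define N where "N = (\<lambda>(m, c). {e \<in> R m. col m e = c})"
  have colD: "col m e < D" if "m \<in> M" "e \<in> R m" for m e
    using bspec[OF col that(1)] that(2) by (simp add: ok_def)
  have col1: "y = y'" if "m \<in> M" "(x, y) \<in> R m" "(x, y') \<in> R m" "col m (x, y) = col m (x, y')" for m x y y'
    using bspec[OF col that(1)] that(2-4) unfolding ok_def by blast
  have col2: "x = x'" if "m \<in> M" "(x, y) \<in> R m" "(x', y) \<in> R m" "col m (x, y) = col m (x', y)" for m x x' y
    using bspec[OF col that(1)] that(2-4) unfolding ok_def by blast
  \<comment> \<open>An edge determines \<open>m\<close> by the uniqueness lemma, and its direction
    because the layer increases along it.\<close>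
  have uniq: "m = m' \<and> u = u' \<and> w = w'"
    if "m \<in> M" "m' \<in> M" "(u, w) \<in> R m" "(u', w') \<in> R m'" "{u, w} = {u', w'}" for m m' u w u' w'
  proof -
    have uw: "u \<in> V" "w \<in> V" using that RV by auto
    have "m = m'"
      by (rule consecutive_multiple_unique[OF p(1) f[OF uw(1)] f[OF uw(2)]])
        (use that in \<open>auto simp: M_def R_def doubleton_eq_iff\<close>)
    then show ?thesis using that by (auto simp: R_def doubleton_eq_iff)
  qed
  show thesis
  proof (rule that[of N, folded M_def])
    show "{u, w} \<in> E \<and> f w * m mod p = f u * m mod p + 1" if "(u, w) \<in> N (m, c)" for m c u w
      using that by (auto simp: N_def R_def)
    show "single_valued (N i)" if "i \<in> M \<times> {..<D}" for i
      using that col1 by (auto simp: N_def single_valued_def)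
    show "single_valued ((N i)\<inverse>)" if "i \<in> M \<times> {..<D}" for i
      using that col2 by (auto simp: N_def single_valued_def)
    show "undirected (N i) \<inter> undirected (N j) = {}"
      if ij: "i \<in> M \<times> {..<D}" "j \<in> M \<times> {..<D}" "i \<noteq> j" for i j
    proof (rule ccontr)
      assume "undirected (N i) \<inter> undirected (N j) \<noteq> {}"
      then obtain u w u' w' where e: "(u, w) \<in> N i" "(u', w') \<in> N j" "{u, w} = {u', w'}"
        by (auto simp: undirected_def)
      then have "fst i = fst j \<and> u = u' \<and> w = w'"
        using ij(1,2) uniq[of "fst i" "fst j" u w u' w'] by (auto simp: N_def split: prod.splits)
      then show False using e ij(3) by (auto simp: N_def split: prod.splits)
    qed
    show "\<exists>i\<in>M \<times> {..<D}. {u, w} \<in> undirected (N i)" if uw: "{u, w} \<in> E" "f u \<noteq> f w" for u w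
    proof -
      have "\<exists>m\<in>M. f u * m mod p = f w * m mod p + 1 \<or> f w * m mod p = f u * m mod p + 1"
        unfolding M_def
        by (rule consecutive_multiple_exists[OF p f f uw(2)]) (use simple_graph_edgeD[OF G uw(1)] in auto)
      then obtain m where m0: "m \<in> M" "f u * m mod p = f w * m mod p + 1 \<or> f w * m mod p = f u * m mod p + 1"
        by blast
      have "(w, u) \<in> R m \<or> (u, w) \<in> R m"
        using m0(2) uw(1) unfolding R_def by (auto simp: insert_commute)
      then obtain x y where m: "m \<in> M" "(x, y) \<in> R m" "{u, w} = {x, y}"
        using m0(1) by (metis insert_commute)
      then have "(x, y) \<in> N (m, col m (x, y))" by (simp add: N_def)
      then have "{u, w} \<in> undirected (N (m, col m (x, y)))" using m(3) by (auto simp: undirected_def)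
      then show ?thesis using m colD[OF m(1,2)] by blast
    qed
    show "\<exists>a\<in>{1..<p}. card {c \<in> {..<D}. u \<in> Domain (N (m, c))} = card {w \<in> nbr E u. f w = a}"
      if m: "m \<in> M" and "u \<in> V" "f u * m mod p < p - 1" for m u
    proof -
      have "{c \<in> {..<D}. u \<in> Domain (N (m, c))} = (\<lambda>w. col m (u, w)) ` {w. (u, w) \<in> R m}"
        using colD[OF m] by (auto simp: N_def)
      also have "card \<dots> = card {w. (u, w) \<in> R m}"
        using col1[OF m] by (intro card_image) (auto simp: inj_on_def)
      finally show ?thesis using out[OF that] by auto
    qed
    show "\<exists>a\<in>{1..<p}. card {c \<in> {..<D}. u \<in> Range (N (m, c))} = card {w \<in> nbr E u. f w = a}"
      if m: "m \<in> M" and "u \<in> V" "1 < f u * m mod p" for m u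
    proof -
      have "{c \<in> {..<D}. u \<in> Range (N (m, c))} = (\<lambda>w. col m (w, u)) ` {w. (w, u) \<in> R m}"
        using colD[OF m] by (auto simp: N_def)
      also have "card \<dots> = card {w. (w, u) \<in> R m}"
        using col2[OF m] by (intro card_image) (auto simp: inj_on_def)
      finally show ?thesis using inn[OF that] by auto
    qed
  qed
qed

section \<open>Almost regular graphs\<close>

lemma mult_mod_prime_layer:
  fixes p :: nat
  assumes "prime p" "m \<in> {1..<p}" "t \<in> {1..<p}"
  shows "\<exists>a\<in>{1..<p}. \<forall>b\<in>{1..<p}. b * m mod p = t \<longleftrightarrow> b = a"
proof -
  obtain a where a: "a \<in> {1..<p}" "t = a * m mod p"
    using mult_mod_prime_image[OF assms(1,2)] assms(3) by (metis (no_types, lifting) imageE)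
  then show ?thesis
    using inj_onD[OF mult_mod_prime_inj[OF assms(1,2)], of _ a] by (intro bexI[of _ a]) auto
qed

lemma card_vimage_sum:
  assumes "finite B" "finite T"
  shows "card {s \<in> B. g s \<in> T} = (\<Sum>t\<in>T. card {s \<in> B. g s = t})"
proof -
  have "{s \<in> B. g s \<in> T} = (\<Union>t\<in>T. {s \<in> B. g s = t})" by auto
  also have "card \<dots> = (\<Sum>t\<in>T. card {s \<in> B. g s = t})"
    using assms by (intro card_UN_disjoint) auto
  finally show ?thesis .
qed

lemma edge_disjoint_hamilton_cycles_mono:
  "edge_disjoint_hamilton_cycles V E H \<Longrightarrow> E \<subseteq> E' \<Longrightarrow> edge_disjoint_hamilton_cycles V E' H"
  unfolding edge_disjoint_hamilton_cycles_def using hamilton_cycle_mono by blast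

text \<open>All forests come from one random partition. Its errors are tiny even when summed over
  all parts, since \<open>100 * (real k)\<^sup>2 * \<epsilon> \<le> \<alpha>\<close> makes
  \<open>k\<close> deviations small against one part; thus the ends of the forests come mainly from
  the boundary layers and cost only a constant number of part sizes.\<close>

lemma near_regular_packing:
  fixes \<alpha> \<epsilon> \<rho> r :: real and p k s0 n :: nat and V :: "'a set"
  assumes G: "simple_graph V E" "card V = n" "4 \<le> n"
    and p: "prime p" "odd p" and k: "k = p - 1"
    and \<alpha>: "0 < \<alpha>" "\<alpha> \<le> 1" and \<epsilon>: "0 < \<epsilon>" "1 \<le> \<epsilon> * n" "100 * (real k)\<^sup>2 * \<epsilon> \<le> \<alpha>"
    and deg: "\<And>v. v \<in> V \<Longrightarrow> \<bar>real (card (nbr E v)) - r\<bar> < \<epsilon> * n"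
    and r: "(1/2 + \<alpha>/2) * n \<le> r" "r \<le> n"
    and s0: "1 \<le> s0" "s0 \<le> k" and \<rho>: "\<rho> = \<alpha> / 64"
    and c1: "3 / real k + 14 * sqrt (5 / real k) \<le> \<rho>\<^sup>2 * (real s0 * \<alpha> / (4 * real k)) / 4"
    and c2: "2 * real s0 / real k + 14 * sqrt (2 * real s0 / real k) \<le> \<rho>\<^sup>2 * (\<alpha> / 2) / 8"
    and c3: "2 * real s0 / real k + 3 / real k + 2 * \<epsilon> \<le> \<alpha> / 2" and k5: "5 \<le> k" and c4: "4 * s0 \<le> k"
    and small0: "real k * real n ^ 3 * (2 * exp (- (2 * \<epsilon>\<^sup>2) * real n)) < 1"
    and small1: "2 * real n ^ 3 * (2 * exp (- (\<rho> ^ 4 * (real s0 * \<alpha> / (4 * real k))\<^sup>2 / 32) * real n)) < 1"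
    and small2: "2 * real n ^ 3 * (2 * exp (- (\<rho> ^ 4 * (\<alpha> / 2 / 2)\<^sup>2 / 32) * real n)) < 1"
    and nbig: "2 \<le> sqrt (5 / real k) * n" "2 \<le> sqrt (2 * real s0 / real k) * n"
  shows "\<exists>H. edge_disjoint_hamilton_cycles V E H \<and> r / 2 - \<alpha> * n / 4 \<le> card H"
proof -
  have finV: "finite V" using G by (simp add: simple_graph_def)
  have kp: "{1..k} = {1..<p}" using k5 k by auto
  \<comment> \<open>Below, \<open>y\<close> is the mean size of a part, \<open>e\<close> the
    deviation allowed by the partition, and \<open>q\<close> the mean number of neighbours in a
    part.\<close>
  define x where "x = real n"
  define K where "K = real k"
  define y where "y = x / K"
  define e where "e = \<epsilon> * x"
  define q where "q = r / K"
  have K: "K \<ge> 5" using k5 by (simp add: K_def)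
  have x: "x \<ge> 4" using G by (simp add: x_def)
  have xy: "x = K * y" using K by (simp add: y_def)
  have y0: "y > 0" using x K by (simp add: y_def)
  have e1: "e \<ge> 1" using \<epsilon> by (simp add: e_def x_def)
  have Ke: "100 * (K * e) \<le> \<alpha> * y"
  proof -
    have "(100 * K\<^sup>2 * \<epsilon>) * x \<le> \<alpha> * x" using \<epsilon>(3) x by (intro mult_right_mono) (auto simp: K_def)
    then have "K * (100 * (K * e)) \<le> K * (\<alpha> * y)"
      by (simp add: e_def power2_eq_square mult_ac xy)
    then show ?thesis using K by simp
  qed
  have ay: "\<alpha> * y \<le> y" using \<alpha> y0 by simp
  have eK: "5 * e \<le> K * e" using K e1 by (intro mult_right_mono) auto
  have ey: "500 * e \<le> \<alpha> * y" using Ke eK by linarith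
  have divK: "a / K \<le> a" if "a \<ge> 0" for a :: real
    using divide_left_mono[of 1 K a] K that by simp
  have qy: "q \<le> y" using r(2) K by (simp add: q_def y_def x_def divide_right_mono)
  have q0: "q \<ge> 0"
  proof -
    have "r \<ge> 0" using r(1) \<alpha> by (smt (verit) mult_nonneg_nonneg of_nat_0_le_iff divide_nonneg_nonneg)
    then show ?thesis using K by (simp add: q_def)
  qed
  \<comment> \<open>\<open>V\<close> controls the part sizes, a pair of distinct vertices the supply
    for links, and the pair (u, u) the degrees of \<open>u\<close> into the parts.\<close>
  define \<A> where "\<A> = insert V ((\<lambda>(u, w). nbr E u \<inter> nbr E w) ` (V \<times> V))"
  have "card \<A> \<le> n * n + 1"
  proof -
    have "card ((\<lambda>(u, w). nbr E u \<inter> nbr E w) ` (V \<times> V)) \<le> card (V \<times> V)"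
      by (rule card_image_le) (use finV in auto)
    also have "\<dots> = n * n" using G(2) by (simp add: card_cartesian_product)
    finally show ?thesis using finV unfolding \<A>_def
      by (subst card_insert_if) auto
  qed
  also have "\<dots> \<le> n * n * n"
  proof -
    have "n * n * 4 \<le> n * n * n" using G(3) by (intro mult_left_mono) auto
    moreover have "1 \<le> n * n" using G(3) by auto
    ultimately show ?thesis by linarith
  qed
  finally have cardA: "card \<A> \<le> card V ^ 3" using G(2) by (simp add: power3_eq_cube)
  have "\<exists>f. (\<forall>v\<in>V. f v \<in> {1..k}) \<and>
       (\<forall>A\<in>\<A>. \<forall>a\<in>{1..k}. \<bar>real (card {u \<in> A. f u = a}) - card A / real k\<bar> < \<epsilon> * card V)"
  proof (rule random_partition[OF \<epsilon>(1) _ finV _ _ cardA])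
    show "\<A> \<subseteq> Pow V" using nbr_subset[OF G(1)] by (auto simp: \<A>_def)
  qed (use small0 G k5 in auto)
  then obtain f where f: "\<forall>v\<in>V. f v \<in> {1..k}"
    and fA: "\<forall>A\<in>\<A>. \<forall>a\<in>{1..k}. \<bar>real (card {u \<in> A. f u = a}) - card A / real k\<bar> < \<epsilon> * card V"
    by (elim exE conjE)
  have fp: "f v \<in> {1..<p}" if "v \<in> V" for v using f that kp by auto
  have part: "\<bar>real (card {u \<in> A. f u = a}) - card A / K\<bar> < e" if "A \<in> \<A>" "a \<in> {1..<p}" for A a
    using fA that G(2) unfolding kp K_def e_def x_def by blast
  have partV: "card {u \<in> V. f u = a} \<le> y + e" if "a \<in> {1..<p}" for a
    using part[OF _ that, of V] G(2) by (simp add: \<A>_def y_def x_def)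
  have codegA: "nbr E u \<inter> nbr E w \<in> \<A>" if "u \<in> V" "w \<in> V" for u w
    using that by (auto simp: \<A>_def)
  have degq: "\<bar>real (card (nbr E u)) / K - q\<bar> \<le> e" if "u \<in> V" for u
  proof -
    have "real (card (nbr E u)) / K - q = (real (card (nbr E u)) - r) / K"
      by (simp add: q_def diff_divide_distrib)
    then have "\<bar>real (card (nbr E u)) / K - q\<bar> = \<bar>real (card (nbr E u)) - r\<bar> / K"
      using K by (simp add: abs_divide)
    also have "\<dots> \<le> e / K" using deg[OF that] K by (intro divide_right_mono) (auto simp: e_def x_def)
    also have "\<dots> \<le> e" using divK e1 by simp
    finally show ?thesis .
  qed
  have partN: "\<bar>real (card {w \<in> nbr E u. f w = a}) - q\<bar> \<le> 2 * e" if "u \<in> V" "a \<in> {1..<p}" for u a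
    using part[OF codegA[OF that(1,1)] that(2)] degq[OF that(1)] by simp
  \<comment> \<open>Degrees into parts lie within \<open>2 * e\<close> of \<open>q\<close>, and
    rounding costs at most 1, which is at most \<open>e\<close>. So at most \<open>5 * e\<close>
    colours are missing at a vertex on either side.\<close>
  define D where "D = nat \<lceil>q + 2 * e\<rceil>"
  have D: "q + 2 * e \<le> real D" "real D \<le> q + 3 * e"
    using q0 e1 unfolding D_def by linarith+
  have D2: "real D \<le> 2 * y" using D(2) qy ey ay y0 e1 by linarith
  define M where "M = {1..(p - 1) div 2}"
  have Mp: "m \<in> {1..<p}" if "m \<in> M" for m using that prime_gt_1_nat[OF p(1)] by (auto simp: M_def)
  have cardM: "real (card M) = K / 2"
    using p(2) by (auto simp: M_def K_def k elim!: oddE)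
  have finM: "finite M" by (simp add: M_def)
  have Dle: "card {w \<in> nbr E u. f w = a} \<le> D" if "u \<in> V" "a \<in> {1..<p}" for u a
    using partN[OF that] D(1) by linarith
  obtain N :: "nat \<times> nat \<Rightarrow> ('a \<times> 'a) set" where
    N: "\<And>m c u w. (u, w) \<in> N (m, c) \<Longrightarrow> {u, w} \<in> E \<and> f w * m mod p = f u * m mod p + 1"
    and Nsv: "\<And>i. i \<in> M \<times> {..<D} \<Longrightarrow> single_valued (N i)"
      "\<And>i. i \<in> M \<times> {..<D} \<Longrightarrow> single_valued ((N i)\<inverse>)"
    and Ndisj: "\<And>i j. i \<in> M \<times> {..<D} \<Longrightarrow> j \<in> M \<times> {..<D} \<Longrightarrow> i \<noteq> j \<Longrightarrow>
      undirected (N i) \<inter> undirected (N j) = {}"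
    and Ncov: "\<And>u w. {u, w} \<in> E \<Longrightarrow> f u \<noteq> f w \<Longrightarrow> \<exists>i\<in>M \<times> {..<D}. {u, w} \<in> undirected (N i)"
    and Ndom: "\<And>m u. m \<in> M \<Longrightarrow> u \<in> V \<Longrightarrow> f u * m mod p < p - 1 \<Longrightarrow>
      \<exists>a\<in>{1..<p}. card {c \<in> {..<D}. u \<in> Domain (N (m, c))} = card {w \<in> nbr E u. f w = a}"
    and Nran: "\<And>m u. m \<in> M \<Longrightarrow> u \<in> V \<Longrightarrow> 1 < f u * m mod p \<Longrightarrow>
      \<exists>a\<in>{1..<p}. card {c \<in> {..<D}. u \<in> Range (N (m, c))} = card {w \<in> nbr E u. f w = a}"
    using class_decomposition[OF G(1) p fp Dle, folded M_def] by blast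
  define hg where "hg m v = f v * m mod p" for m v
  have hg: "hg m v \<in> {1..<p}" if "m \<in> M" "v \<in> V" for m v
    using imageI[OF fp[OF that(2)], of "\<lambda>a. a * m mod p"]
    unfolding mult_mod_prime_image[OF p(1) Mp[OF that(1)]] hg_def .
  define C where "C = M \<times> {..<D}"
  define S where "S i = {v \<in> V. hg (fst i) v \<le> s0}" for i :: "nat \<times> nat"
  \<comment> \<open>Restricting the tails is enough: \<open>hg\<close> grows by one along an edge,
    so heads are beyond layer \<open>s0\<close> as well.\<close>
  define F where "F i = {(u, w) \<in> N i. s0 < hg (fst i) u}" for i :: "nat \<times> nat"
  \<comment> \<open>No edge of \<open>N i\<close> leaves the last layer; its vertices are path ends
    in any case and are counted separately.\<close>
  define miss where "miss i = {v \<in> V. hg (fst i) v < p - 1 \<and> v \<notin> Domain (N i)}" for i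
  define I where "I = {i \<in> C. card (miss i) \<le> y}"
  define X where "X = \<Union>(undirected ` N ` C)"
  have XE: "X \<subseteq> E"
    using N by (auto simp: X_def undirected_def)
  have inX: "{u, w} \<in> X" if "{u, w} \<in> E" "f u \<noteq> f w" for u w
    using Ncov[OF that] by (auto simp: X_def C_def)
  have finC: "finite C" by (simp add: C_def finM)
  have IC: "I \<subseteq> C" by (auto simp: I_def)
  have finI: "finite I" using finite_subset[OF IC finC] .
  have IM: "fst i \<in> M" if "i \<in> I" for i using that by (auto simp: I_def C_def)
  have cardC: "real (card C) = K / 2 * real D"
    unfolding C_def by (simp add: card_cartesian_product cardM)
  have layer: "\<exists>a\<in>{1..<p}. \<forall>v\<in>V. hg m v = t \<longleftrightarrow> f v = a" if mt: "m \<in> M" "t \<in> {1..<p}" for m t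
  proof -
    obtain a where "a \<in> {1..<p}" "\<forall>b\<in>{1..<p}. b * m mod p = t \<longleftrightarrow> b = a"
      using mult_mod_prime_layer[OF p(1) Mp[OF mt(1)] mt(2)] by (elim bexE)
    then show ?thesis using fp unfolding hg_def by (intro bexI[of _ a]) auto
  qed
  have layer_le: "card {v \<in> V. hg m v = t} \<le> y + e" if mt: "m \<in> M" "t \<in> {1..<p}" for m t
  proof -
    obtain a where a: "a \<in> {1..<p}" "\<forall>v\<in>V. hg m v = t \<longleftrightarrow> f v = a"
      using layer[OF mt] by (elim bexE)
    have "{v \<in> V. hg m v = t} = {v \<in> V. f v = a}" using a(2) by auto
    then show ?thesis using partV[OF a(1)] by simp
  qed
  have s0p: "{1..s0} \<subseteq> {1..<p}" using s0 k k5 by auto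
  have cardS: "card (S i) \<le> s0 * (2 * y)" if i: "i \<in> I" for i
  proof -
    have "S i = {v \<in> V. hg (fst i) v \<in> {1..s0}}"
      using hg[OF IM[OF i]] by (auto simp: S_def)
    then have "real (card (S i)) = (\<Sum>t\<in>{1..s0}. real (card {v \<in> V. hg (fst i) v = t}))"
      using card_vimage_sum[OF finV, of "{1..s0}" "hg (fst i)"] by simp
    also have "\<dots> \<le> (\<Sum>t\<in>{1..s0}. 2 * y)"
    proof (rule sum_mono)
      fix t assume "t \<in> {1..s0}"
      then have "t \<in> {1..<p}" using s0p by blast
      from layer_le[OF IM[OF i] this]
      show "real (card {v \<in> V. hg (fst i) v = t}) \<le> 2 * y" using ey ay e1 by linarith
    qed
    finally show ?thesis by simp
  qed
  have s0y: "s0 * (2 * y) = 2 * real s0 / K * x" using K by (simp add: y_def)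
  \<comment> \<open>Different layers belong to different parts, so every edge of \<open>E\<close>
    between \<open>S i\<close> and the other vertices is coloured and present in \<open>X\<close>.
    Only edges inside a part get no colour.\<close>
  have fst_ne: "f u \<noteq> f s" if "i \<in> I" "u \<in> V - S i" "s \<in> S i" for i u s
    using that by (auto simp: S_def hg_def)
  have FW: "F i \<subseteq> (V - S i) \<times> (V - S i)" if i: "i \<in> I" for i
  proof (rule subrelI)
    fix u w assume uw: "(u, w) \<in> F i"
    obtain m c where mc: "i = (m, c)" by (cases i)
    have "{u, w} \<in> E" "hg m w = hg m u + 1" "s0 < hg m u"
      using uw N[of u w m c] by (auto simp: F_def mc hg_def)
    then show "(u, w) \<in> (V - S i) \<times> (V - S i)"
      using simple_graph_edgeD[OF G(1), of u w] by (auto simp: S_def mc)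
  qed
  have missF: "card ((V - S i) - Domain (F i)) \<le> 3 * y" if i: "i \<in> I" for i
  proof -
    have "(V - S i) - Domain (F i) \<subseteq> {v \<in> V. hg (fst i) v = p - 1} \<union> miss i"
    proof
      fix v assume v: "v \<in> (V - S i) - Domain (F i)"
      then have "s0 < hg (fst i) v" "v \<in> V" by (auto simp: S_def)
      moreover have "hg (fst i) v \<le> p - 1" using hg[OF IM[OF i] \<open>v \<in> V\<close>] by auto
      moreover have "v \<notin> Domain (N i)" using v \<open>s0 < hg (fst i) v\<close> by (auto simp: F_def)
      ultimately show "v \<in> {v \<in> V. hg (fst i) v = p - 1} \<union> miss i" by (auto simp: miss_def)
    qed
    then have "card ((V - S i) - Domain (F i)) \<le> card ({v \<in> V. hg (fst i) v = p - 1} \<union> miss i)"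
      using finV by (intro card_mono) (auto simp: miss_def)
    also have "\<dots> \<le> card {v \<in> V. hg (fst i) v = p - 1} + card (miss i)" by (rule card_Un_le)
    finally have "card ((V - S i) - Domain (F i)) \<le> card {v \<in> V. hg (fst i) v = p - 1} + card (miss i)" .
    moreover have "p - 1 \<in> {1..<p}" using k k5 by auto
    then have "card {v \<in> V. hg (fst i) v = p - 1} \<le> y + e" by (rule layer_le[OF IM[OF i]])
    moreover have "card (miss i) \<le> y" using i by (simp add: I_def)
    ultimately show ?thesis using ey ay e1 by linarith
  qed
  have outmiss: "card {c \<in> {..<D}. hg m v < p - 1 \<and> v \<notin> Domain (N (m, c))} \<le> 5 * e"
    if m: "m \<in> M" and v: "v \<in> V" for m v
  proof (cases "hg m v < p - 1")
    case True
    then obtain a where a: "a \<in> {1..<p}"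
      "card {c \<in> {..<D}. v \<in> Domain (N (m, c))} = card {w \<in> nbr E v. f w = a}"
      using Ndom[OF m v] by (auto simp: hg_def)
    have eq: "{c \<in> {..<D}. hg m v < p - 1 \<and> v \<notin> Domain (N (m, c))} = {..<D} - {c \<in> {..<D}. v \<in> Domain (N (m, c))}"
      using True by auto
    have "card {c \<in> {..<D}. hg m v < p - 1 \<and> v \<notin> Domain (N (m, c))} =
        D - card {c \<in> {..<D}. v \<in> Domain (N (m, c))}"
      unfolding eq by (subst card_Diff_subset) auto
    then show ?thesis using a(2) partN[OF v a(1)] D(2) Dle[OF v a(1)] by linarith
  next
    case False
    then show ?thesis using e1 by simp
  qed
  have inmiss: "card {c \<in> {..<D}. 1 < hg m v \<and> v \<notin> Range (N (m, c))} \<le> 5 * e"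
    if m: "m \<in> M" and v: "v \<in> V" for m v
  proof (cases "1 < hg m v")
    case True
    then obtain a where a: "a \<in> {1..<p}"
      "card {c \<in> {..<D}. v \<in> Range (N (m, c))} = card {w \<in> nbr E v. f w = a}"
      using Nran[OF m v] by (auto simp: hg_def)
    have eq: "{c \<in> {..<D}. 1 < hg m v \<and> v \<notin> Range (N (m, c))} = {..<D} - {c \<in> {..<D}. v \<in> Range (N (m, c))}"
      using True by auto
    have "card {c \<in> {..<D}. 1 < hg m v \<and> v \<notin> Range (N (m, c))} =
        D - card {c \<in> {..<D}. v \<in> Range (N (m, c))}"
      unfolding eq by (subst card_Diff_subset) auto
    then show ?thesis using a(2) partN[OF v a(1)] D(2) Dle[OF v a(1)] by linarith
  next
    case False
    then show ?thesis using e1 by simp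
  qed
  \<comment> \<open>For a fixed path, at most \<open>5 * e * n\<close> out-edges are missing over
    all colours together, so at most \<open>5 * e * n / y\<close>, which is
    \<open>5 * e * K\<close>, colours miss more than \<open>y\<close>.\<close>
  have bad: "card {c \<in> {..<D}. y < card (miss (m, c))} \<le> 5 * e * K" if m: "m \<in> M" for m
  proof -
    let ?B = "{c \<in> {..<D}. y < card (miss (m, c))}"
    have "y * card ?B = (\<Sum>c\<in>?B. y)" by simp
    also have "\<dots> \<le> (\<Sum>c\<in>?B. real (card (miss (m, c))))" by (intro sum_mono) auto
    also have "\<dots> \<le> (\<Sum>c<D. real (card (miss (m, c))))" by (intro sum_mono2) auto
    also have "\<dots> = (\<Sum>c<D. \<Sum>v\<in>V. of_bool (v \<in> miss (m, c)))"
    proof (intro sum.cong refl)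
      fix c
      have "(\<Sum>v\<in>V. of_bool (v \<in> miss (m, c))) = real (card (V \<inter> miss (m, c)))"
        using finV by (simp add: of_bool_def sum.If_cases)
      also have "V \<inter> miss (m, c) = miss (m, c)" by (auto simp: miss_def)
      finally show "real (card (miss (m, c))) = (\<Sum>v\<in>V. of_bool (v \<in> miss (m, c)))" by simp
    qed
    also have "\<dots> = (\<Sum>v\<in>V. \<Sum>c<D. of_bool (v \<in> miss (m, c)))" by (rule sum.swap)
    also have "\<dots> \<le> (\<Sum>v\<in>V. 5 * e)"
    proof (rule sum_mono)
      fix v assume v: "v \<in> V"
      have "(\<Sum>c<D. of_bool (v \<in> miss (m, c))) = real (card ({..<D} \<inter> {c. v \<in> miss (m, c)}))"
        by (simp add: of_bool_def sum.If_cases)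
      also have "{..<D} \<inter> {c. v \<in> miss (m, c)} = {c \<in> {..<D}. hg m v < p - 1 \<and> v \<notin> Domain (N (m, c))}"
        using v by (auto simp: miss_def)
      also have "real (card \<dots>) \<le> 5 * e" by (rule outmiss[OF m v])
      finally show "(\<Sum>c<D. of_bool (v \<in> miss (m, c))) \<le> 5 * e" .
    qed
    also have "\<dots> = y * (5 * e * K)" using G(2) xy by (simp add: x_def mult_ac)
    finally show ?thesis using y0 by simp
  qed
  \<comment> \<open>There are K/2 * D \<ge> r/2 colours in all; the discarded ones number at most
    K/2 * (5 * e * K), hence at most \<alpha> * x / 40.\<close>
  have cardI: "r / 2 - 3 * \<alpha> * x / 100 \<le> card I"
  proof -
    have sub: "C - I \<subseteq> Sigma M (\<lambda>m. {c \<in> {..<D}. y < card (miss (m, c))})"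
      by (auto simp: C_def I_def)
    have "card (C - I) \<le> card (Sigma M (\<lambda>m. {c \<in> {..<D}. y < card (miss (m, c))}))"
      using finM by (intro card_mono sub) auto
    also have "\<dots> = (\<Sum>m\<in>M. card {c \<in> {..<D}. y < card (miss (m, c))})"
      using finM by (simp add: card_SigmaI)
    finally have "real (card (C - I)) \<le> real (\<Sum>m\<in>M. card {c \<in> {..<D}. y < card (miss (m, c))})"
      by (simp only: of_nat_le_iff)
    also have "\<dots> \<le> (\<Sum>m\<in>M. 5 * e * K)" unfolding of_nat_sum by (intro sum_mono bad)
    also have "\<dots> = (K * 5 / 2) * (K * e)" using cardM by simp
    finally have 1: "real (card (C - I)) \<le> (K * 5 / 2) * (K * e)" .
    have "(K * 5 / 2) * (100 * (K * e)) \<le> (K * 5 / 2) * (\<alpha> * y)"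
      using Ke K by (intro mult_left_mono) auto
    also have "\<dots> = 5 / 2 * (\<alpha> * x)" by (simp add: xy)
    finally have *: "(K * 5 / 2) * (100 * (K * e)) \<le> 5 / 2 * (\<alpha> * x)" .
    have "(K * 5 / 2) * (K * e) \<le> 3 * \<alpha> * x / 100"
    proof -
      have "0 \<le> \<alpha> * x" using \<alpha> x by simp
      moreover have "(K * 5 / 2) * (100 * (K * e)) = 100 * ((K * 5 / 2) * (K * e))" by simp
      ultimately show ?thesis using * by linarith
    qed
    then have 2: "real (card (C - I)) \<le> 3 * \<alpha> * x / 100" using 1 by linarith
    have "K / 2 * q \<le> K / 2 * D" using D(1) e1 K by (intro mult_left_mono) auto
    then have "r / 2 \<le> card C" using K by (simp add: cardC q_def)
    moreover have "card C = card I + card (C - I)"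
      using card_Diff_subset[OF finI IC] card_mono[OF finC IC] by linarith
    ultimately show ?thesis using 2 by simp
  qed
  \<comment> \<open>For fixed \<open>f v\<close>, different \<open>m\<close> put \<open>v\<close>
    into different layers. This is what spreads ends and deleted vertices evenly over the
    forests.\<close>
  have one: "card {m \<in> M. hg m v \<in> T} \<le> card T" if v: "v \<in> V" and "finite T" for v T
  proof (rule card_inj_on_le[of "\<lambda>m. hg m v"])
    show "inj_on (\<lambda>m. hg m v) {m \<in> M. hg m v \<in> T}"
    proof (rule inj_onI)
      fix m m' assume m: "m \<in> {m \<in> M. hg m v \<in> T}" "m' \<in> {m \<in> M. hg m v \<in> T}" "hg m v = hg m' v"
      then have "m * f v mod p = m' * f v mod p" by (simp add: hg_def mult.commute)
      then show "m = m'" using inj_onD[OF mult_mod_prime_inj[OF p(1) fp[OF v]], of m m'] Mp m(1,2) by blast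
    qed
  qed (use that in auto)
  have D_times: "real (card A) * real D \<le> real b * (2 * y)" if "card A \<le> b" for A :: "nat set" and b
    using that D2 y0 by (intro mult_mono) auto
  \<comment> \<open>The last layer and layer s0 + 1 each contain \<open>v\<close> for at most one
    \<open>m\<close>, which concerns at most D \<le> 2 * y forests. Missing out-edges and in-edges
    add at most \<open>5 * e\<close> forests per path and direction. The total 4 * y + 5 * K * e is
    below 5 * y.\<close>
  have ends: "card {i \<in> I. v \<in> (V - S i - Domain (F i)) \<union> (V - S i - Range (F i))} \<le> 5 * y"
    if v: "v \<in> V" for v
  proof -
    define A1 where "A1 t = {m \<in> M. hg m v \<in> {t}} \<times> {..<D}" for t
    define A2 where "A2 = Sigma M (\<lambda>m. {c \<in> {..<D}. hg m v < p - 1 \<and> v \<notin> Domain (N (m, c))})"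
    define A3 where "A3 = Sigma M (\<lambda>m. {c \<in> {..<D}. 1 < hg m v \<and> v \<notin> Range (N (m, c))})"
    have "{i \<in> I. v \<in> (V - S i - Domain (F i)) \<union> (V - S i - Range (F i))} \<subseteq>
        (A1 (p - 1) \<union> A2) \<union> (A1 (s0 + 1) \<union> A3)"
    proof
      fix i assume i: "i \<in> {i \<in> I. v \<in> (V - S i - Domain (F i)) \<union> (V - S i - Range (F i))}"
      obtain m c where mc: "i = (m, c)" by (cases i)
      have m: "m \<in> M" "c < D" using i mc by (auto simp: I_def C_def)
      have h: "s0 < hg m v" "hg m v \<le> p - 1" using i hg[OF m(1) v] mc by (auto simp: S_def)
      from i have "v \<notin> Domain (F i) \<or> v \<notin> Range (F i)" by auto
      then show "i \<in> (A1 (p - 1) \<union> A2) \<union> (A1 (s0 + 1) \<union> A3)"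
      proof
        assume "v \<notin> Domain (F i)"
        then have "v \<notin> Domain (N i)" using h mc by (auto simp: F_def)
        then show ?thesis using h m mc by (auto simp: A1_def A2_def)
      next
        assume nr: "v \<notin> Range (F i)"
        show ?thesis
        proof (cases "hg m v = s0 + 1")
          case True
          then show ?thesis using m mc by (auto simp: A1_def)
        next
          case False
          have "v \<notin> Range (N i)"
          proof
            assume "v \<in> Range (N i)"
            then obtain u where u: "(u, v) \<in> N i" by auto
            then have "hg m v = hg m u + 1" using N[of u v m c] mc by (simp add: hg_def)
            then have "(u, v) \<in> F i" using u False h mc by (auto simp: F_def)
            then show False using nr by auto
          qed
          then show ?thesis using h False m mc by (auto simp: A3_def)
        qed
      qed
    qed
    moreover have fin: "finite (A1 t)" "finite A2" "finite A3" for t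
      using finM by (auto simp: A1_def A2_def A3_def)
    ultimately have "card {i \<in> I. v \<in> (V - S i - Domain (F i)) \<union> (V - S i - Range (F i))} \<le>
        card ((A1 (p - 1) \<union> A2) \<union> (A1 (s0 + 1) \<union> A3))"
      by (intro card_mono) auto
    also have "\<dots> \<le> card (A1 (p - 1)) + card A2 + (card (A1 (s0 + 1)) + card A3)"
      by (meson add_mono card_Un_le order_trans)
    finally have total: "card {i \<in> I. v \<in> (V - S i - Domain (F i)) \<union> (V - S i - Range (F i))} \<le>
       card (A1 (p - 1)) + card A2 + (card (A1 (s0 + 1)) + card A3)" .
    have cA1: "real (card (A1 t)) \<le> 2 * y" for t
      using D_times[OF one[OF v, of "{t}"]] by (simp add: A1_def card_cartesian_product)
    have cA2: "real (card A2) \<le> K / 2 * (5 * e)"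
    proof -
      have "real (card A2) = (\<Sum>m\<in>M. real (card {c \<in> {..<D}. hg m v < p - 1 \<and> v \<notin> Domain (N (m, c))}))"
        using finM by (simp add: A2_def card_SigmaI)
      also have "\<dots> \<le> (\<Sum>m\<in>M. 5 * e)" by (intro sum_mono outmiss[OF _ v])
      finally show ?thesis using cardM by simp
    qed
    have cA3: "real (card A3) \<le> K / 2 * (5 * e)"
    proof -
      have "real (card A3) = (\<Sum>m\<in>M. real (card {c \<in> {..<D}. 1 < hg m v \<and> v \<notin> Range (N (m, c))}))"
        using finM by (simp add: A3_def card_SigmaI)
      also have "\<dots> \<le> (\<Sum>m\<in>M. 5 * e)" by (intro sum_mono inmiss[OF _ v])
      finally show ?thesis using cardM by simp
    qed
    have "K / 2 * (5 * e) + K / 2 * (5 * e) = 5 * (K * e)" by simp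
    then show ?thesis using total cA1[of "p - 1"] cA1[of "s0 + 1"] cA2 cA3 Ke ay y0 by linarith
  qed
  have inS: "card {i \<in> I. v \<in> S i} \<le> s0 * (2 * y)" if v: "v \<in> V" for v
  proof -
    have "card {i \<in> I. v \<in> S i} \<le> card ({m \<in> M. hg m v \<in> {1..s0}} \<times> {..<D})"
    proof (rule card_mono)
      show "{i \<in> I. v \<in> S i} \<subseteq> {m \<in> M. hg m v \<in> {1..s0}} \<times> {..<D}"
        using hg[OF _ v] by (auto simp: I_def C_def S_def)
    qed (use finM in auto)
    then have "real (card {i \<in> I. v \<in> S i}) \<le> real (card {m \<in> M. hg m v \<in> {1..s0}} * D)"
      unfolding card_cartesian_product card_lessThan by (simp only: of_nat_le_iff)
    then show ?thesis using D_times[OF one[OF v, of "{1..s0}"]] by simp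
  qed
  \<comment> \<open>Two vertices have at least 2 * (r - e) - n common neighbours, which is at least
    \<open>\<alpha> * x - 2 * e\<close>. The partition has split this set evenly, so each of the
    \<open>s0\<close> layers receives at least \<open>\<alpha> * y / 4\<close> of them.\<close>
  have link: "real s0 * \<alpha> / (4 * K) * x \<le> card {s \<in> S i. {u, s} \<in> X \<and> {w, s} \<in> X}"
    if i: "i \<in> I" and u: "u \<in> V - S i" and w: "w \<in> V - S i" for i u w
  proof -
    let ?B = "nbr E u \<inter> nbr E w"
    have finB: "finite ?B" using finite_nbr[OF G(1)] by blast
    have BV: "?B \<subseteq> V" using nbr_subset[OF G(1)] by blast
    have "card (nbr E u) + card (nbr E w) = card (nbr E u \<union> nbr E w) + card ?B"
      by (rule card_Un_Int) (use finite_nbr[OF G(1)] in auto)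
    moreover have "card (nbr E u \<union> nbr E w) \<le> n"
      using nbr_subset[OF G(1)] finV G(2) by (metis Un_least card_mono)
    ultimately have "real (card ?B) \<ge> card (nbr E u) + card (nbr E w) - x" by (simp add: x_def)
    then have "real (card ?B) \<ge> \<alpha> * x - 2 * e"
      using deg[of u] deg[of w] u w r(1) by (simp add: e_def x_def algebra_simps)
    then have "(\<alpha> * x - 2 * e) / K \<le> card ?B / K" using K by (intro divide_right_mono) auto
    moreover have "(\<alpha> * x - 2 * e) / K = \<alpha> * y - 2 * e / K" by (simp add: y_def diff_divide_distrib)
    moreover have "2 * e / K \<le> 2 * e" using divK[of "2 * e"] e1 by simp
    ultimately have B: "\<alpha> * y - 2 * e \<le> card ?B / K" by linarith
    have "real s0 * \<alpha> / (4 * K) * x = (\<Sum>t\<in>{1..s0}. \<alpha> * y / 4)"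
      by (simp add: y_def)
    also have "\<dots> \<le> (\<Sum>t\<in>{1..s0}. real (card {s \<in> ?B. hg (fst i) s = t}))"
    proof (rule sum_mono)
      fix t assume "t \<in> {1..s0}"
      then have "t \<in> {1..<p}" using s0p by blast
      then obtain a where a: "a \<in> {1..<p}" "\<forall>v\<in>V. hg (fst i) v = t \<longleftrightarrow> f v = a"
        using layer[OF IM[OF i]] by meson
      have eq: "{s \<in> ?B. hg (fst i) s = t} = {s \<in> ?B. f s = a}" using a(2) BV by auto
      have "\<bar>real (card {s \<in> ?B. f s = a}) - card ?B / K\<bar> < e"
        using part[OF codegA a(1)] u w by auto
      then show "\<alpha> * y / 4 \<le> real (card {s \<in> ?B. hg (fst i) s = t})"
        unfolding eq using B ey e1 by linarith
    qed
    also have "\<dots> = real (card {s \<in> ?B. hg (fst i) s \<in> {1..s0}})"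
      using card_vimage_sum[OF finB, of "{1..s0}" "hg (fst i)"] by simp
    also have "\<dots> \<le> card {s \<in> S i. {u, s} \<in> X \<and> {w, s} \<in> X}"
    proof -
      have "{s \<in> ?B. hg (fst i) s \<in> {1..s0}} \<subseteq> {s \<in> S i. {u, s} \<in> X \<and> {w, s} \<in> X}"
      proof
        fix s assume s: "s \<in> {s \<in> ?B. hg (fst i) s \<in> {1..s0}}"
        then have "s \<in> S i" using BV by (auto simp: S_def)
        then show "s \<in> {s \<in> S i. {u, s} \<in> X \<and> {w, s} \<in> X}"
          using s inX[of u s] inX[of w s] fst_ne[OF i u] fst_ne[OF i w] by (auto simp: mem_nbr)
      qed
      then show ?thesis unfolding of_nat_le_iff using finV by (intro card_mono) (auto simp: S_def)
    qed
    finally show ?thesis .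
  qed
  have finF: "finite (F i)" if "i \<in> I" for i
    using FW[OF that] finV finite_subset by (metis finite_Diff finite_SigmaI)
  have svF: "inj_on fst (F i)" "inj_on snd (F i)" if "i \<in> I" for i
    using Nsv[of i] that IC by (auto simp: C_def F_def inj_on_def single_valued_def)
  \<comment> \<open>Dirac's count. All but (2 * s0 + 3) * y vertices are tails in
    \<open>F i\<close>. The edges whose tail is not adjacent to \<open>s\<close> are at most n minus
    the degree of \<open>s\<close>, and the same holds for heads. At least 2 * r - n edges remain,
    up to errors that \<open>c3\<close> bounds by half of \<open>\<alpha> * x\<close>.\<close>
  have absorb: "\<alpha> / 2 * x \<le> card {a \<in> F i. {s, fst a} \<in> X \<and> {s, snd a} \<in> X}"
    if i: "i \<in> I" and s: "s \<in> S i" for i s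
  proof -
    let ?A = "{a \<in> F i. {s, fst a} \<in> X \<and> {s, snd a} \<in> X}"
    have sV: "s \<in> V" using s by (simp add: S_def)
    have inXs: "{s, u} \<in> X" if "u \<in> V - S i" "u \<in> nbr E s" for u
      using inX[of s u] fst_ne[OF i that(1) s] that(2) by (auto simp: mem_nbr)
    have "F i \<subseteq> ?A \<union> {a \<in> F i. fst a \<in> V - nbr E s} \<union> {a \<in> F i. snd a \<in> V - nbr E s}"
      using FW[OF i] inXs by fastforce
    then have "card (F i) \<le> card (?A \<union> {a \<in> F i. fst a \<in> V - nbr E s} \<union> {a \<in> F i. snd a \<in> V - nbr E s})"
      using finF[OF i] by (intro card_mono) auto
    also have "\<dots> \<le> card ?A + card {a \<in> F i. fst a \<in> V - nbr E s} + card {a \<in> F i. snd a \<in> V - nbr E s}"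
      by (meson add_right_mono card_Un_le order_trans)
    finally have 1: "card (F i) \<le> card ?A + card {a \<in> F i. fst a \<in> V - nbr E s} + card {a \<in> F i. snd a \<in> V - nbr E s}" .
    have 2: "card {a \<in> F i. fst a \<in> V - nbr E s} \<le> card (V - nbr E s)"
      using svF(1)[OF i] finV by (intro card_inj_on_le[of fst]) (auto simp: inj_on_def)
    have 3: "card {a \<in> F i. snd a \<in> V - nbr E s} \<le> card (V - nbr E s)"
      using svF(2)[OF i] finV by (intro card_inj_on_le[of snd]) (auto simp: inj_on_def)
    have 4: "real (card (V - nbr E s)) = x - card (nbr E s)"
      using nbr_subset[OF G(1)] finV G(2) card_nbr_le[OF G(1), of s]
      by (subst card_Diff_subset) (auto simp: finite_nbr[OF G(1)] x_def of_nat_diff)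
    have 5: "card (V - S i) \<le> card (F i) + card ((V - S i) - Domain (F i))"
    proof -
      have "card (V - S i) \<le> card (Domain (F i) \<union> ((V - S i) - Domain (F i)))"
        using finV finF[OF i] by (intro card_mono) (auto simp: finite_Domain)
      also have "\<dots> \<le> card (Domain (F i)) + card ((V - S i) - Domain (F i))" by (rule card_Un_le)
      also have "card (Domain (F i)) \<le> card (F i)"
        unfolding Domain_fst by (rule card_image_le[OF finF[OF i]])
      finally show ?thesis by simp
    qed
    have 6: "real (card (V - S i)) = x - card (S i)"
    proof -
      have "S i \<subseteq> V" by (auto simp: S_def)
      then show ?thesis using finV G(2) card_mono[OF finV, of "S i"]
        by (subst card_Diff_subset) (auto simp: x_def of_nat_diff finite_subset)
    qed
    have 7: "s0 * (2 * y) + 3 * y + 2 * e \<le> \<alpha> / 2 * x"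
    proof -
      have "(2 * real s0 / K + 3 / K + 2 * \<epsilon>) * x \<le> \<alpha> / 2 * x"
        using c3 x by (intro mult_right_mono) (auto simp: K_def)
      then show ?thesis by (simp add: s0y y_def e_def algebra_simps)
    qed
    have 8: "\<alpha> * x + x \<le> 2 * r" using r(1) by (simp add: x_def algebra_simps)
    have "r - e \<le> card (nbr E s)" using deg[OF sV] by (simp add: e_def x_def)
    then show ?thesis using 1 2 3 4 5 6 7 8 missF[OF i] cardS[OF i] by linarith
  qed
  have s0k: "2 * real s0 / real k \<le> 1 / 2"
  proof -
    have "4 * real s0 \<le> real k" using c4 by linarith
    then show ?thesis using k5 by (simp add: divide_le_eq)
  qed
  have "\<exists>H. edge_disjoint_hamilton_cycles V X H \<and> real (card I) - 8 * \<rho> * n \<le> card H"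
  proof (rule packing_from_classes[where h = "\<lambda>i. hg (fst i)" and S = S and F = F and N = N and C = C
        and \<eta> = "5 / real k" and \<gamma> = "2 * real s0 / real k" and \<sigma> = "2 * real s0 / real k" and T = "3 / real k"
        and ?b1.0 = "real s0 * \<alpha> / (4 * real k)" and ?b2.0 = "\<alpha> / 2"])
    show "card C \<le> n"
    proof -
      have "K / 2 * real D \<le> K / 2 * (2 * y)" using D2 K by (intro mult_left_mono) auto
      then have "real (card C) \<le> real n" using cardC xy by (simp add: x_def)
      then show ?thesis by simp
    qed
    show "single_valued (N i)" "single_valued ((N i)\<inverse>)" if "i \<in> C" for i
      using Nsv that by (auto simp: C_def)
    show "undirected (N i) \<inter> undirected (N j) = {}" if "i \<in> C" "j \<in> C" "i \<noteq> j" for i j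
      using Ndisj that by (simp add: C_def)
    show "real (card (S i)) \<le> 2 * real s0 / real k * n" if "i \<in> I" for i
      using cardS[OF that] s0y by (simp add: K_def x_def)
    show "2 \<le> card (V - S i)" if "i \<in> I" for i
    proof -
      have "S i \<subseteq> V" by (auto simp: S_def)
      then have "real (card (V - S i)) = x - card (S i)" using finV G(2) card_mono[OF finV, of "S i"]
        by (subst card_Diff_subset) (auto simp: x_def of_nat_diff finite_subset)
      moreover have "real (card (S i)) \<le> x - 2"
      proof -
        have "real (card (S i)) \<le> 2 * real s0 / real k * x" using cardS[OF that] s0y by (simp add: K_def)
        also have "\<dots> \<le> 1 / 2 * x"
          using s0k x by (intro mult_right_mono) auto
        finally show ?thesis using x by simp
      qed
      ultimately show ?thesis by simp
    qed
    show "F i \<subseteq> N i" for i by (auto simp: F_def)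
    show "hg (fst i) u < hg (fst i) w" if "(u, w) \<in> F i" for i u w
      using that N[of u w "fst i" "snd i"] by (auto simp: F_def hg_def)
    show "real (card ((V - S i) - Domain (F i))) \<le> 3 / real k * n" if "i \<in> I" for i
      using missF[OF that] by (simp add: y_def K_def x_def)
    show "real (card {i \<in> I. v \<in> (V - S i - Domain (F i)) \<union> (V - S i - Range (F i))}) \<le> 5 / real k * n"
      if "v \<in> V" for v
      using ends[OF that] by (simp add: y_def K_def x_def)
    show "real (card {i \<in> I. v \<in> S i}) \<le> 2 * real s0 / real k * n" if "v \<in> V" for v
      using inS[OF that] s0y by (simp add: K_def x_def)
    show "real s0 * \<alpha> / (4 * real k) * n \<le> card {s \<in> S i. {u, s} \<in> X \<and> {w, s} \<in> X}"
      if "i \<in> I" "u \<in> V - S i" "w \<in> V - S i" "u \<noteq> w" for i u w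
      using link[OF that(1-3)] by (simp add: K_def x_def)
    show "\<alpha> / 2 * n \<le> card {a \<in> F i. {s, fst a} \<in> X \<and> {s, snd a} \<in> X}"
      if "i \<in> I" "s \<in> S i" for i s
      using absorb[OF that] by (simp add: x_def)
    show "real s0 * \<alpha> / (4 * real k) \<le> 1"
    proof -
      have "real s0 * \<alpha> \<le> real k * 1" using s0 \<alpha> by (intro mult_mono) auto
      then show ?thesis using k5 by (simp add: divide_le_eq)
    qed
    show "5 / real k \<le> 1" using k5 by simp
    show "2 * real s0 / real k \<le> 1" using s0k by simp
  qed (use finV G finC IC FW X_def \<alpha> \<rho> c1 c2 small1 small2 nbig k5 s0 in \<open>auto simp: S_def\<close>)
  then obtain H where H: "edge_disjoint_hamilton_cycles V X H" "real (card I) - 8 * \<rho> * n \<le> card H"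
    by blast
  have "0 \<le> \<alpha> * x" using \<alpha> x by simp
  then have "r / 2 - \<alpha> * n / 4 \<le> card H" using H(2) cardI by (simp add: \<rho> x_def)
  then show ?thesis using edge_disjoint_hamilton_cycles_mono[OF H(1) XE] by blast
qed

section \<open>The theorem\<close>

text \<open>The constants are chosen in the order \<theta>, \<kappa>, \<open>k\<close>,
  \<open>s0\<close>, \<epsilon>. Absorption forces the ratio of \<open>s0\<close> to
  \<open>k\<close> below a constant \<kappa>; linking then holds for large \<open>k\<close>, because
  its left side decays like 1 / sqrt k while its right side keeps the order of \<theta> *
  \<kappa>.\<close>

lemma packing_constants:
  fixes \<alpha> \<rho> :: real
  assumes \<alpha>: "0 < \<alpha>" "\<alpha> \<le> 1" and \<rho>: "\<rho> = \<alpha> / 64"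
  obtains p k s0 :: nat and \<epsilon> :: real where
    "prime p" "odd p" "k = p - 1" "0 < \<epsilon>" "100 * (real k)\<^sup>2 * \<epsilon> \<le> \<alpha>" "1 \<le> s0" "s0 \<le> k"
    "3 / real k + 14 * sqrt (5 / real k) \<le> \<rho>\<^sup>2 * (real s0 * \<alpha> / (4 * real k)) / 4"
    "2 * real s0 / real k + 14 * sqrt (2 * real s0 / real k) \<le> \<rho>\<^sup>2 * (\<alpha> / 2) / 8"
    "2 * real s0 / real k + 3 / real k + 2 * \<epsilon> \<le> \<alpha> / 2" "5 \<le> k" "4 * s0 \<le> k"
proof -
  \<comment> \<open>The right side of the absorption inequality; that of the linking inequality is
    \<open>\<theta> * s0 / k\<close>.\<close>
  define \<theta> where "\<theta> = \<rho>\<^sup>2 * \<alpha> / 16"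
  have \<theta>0: "\<theta> > 0" using \<alpha> \<rho> by (simp add: \<theta>_def)
  have "\<rho>\<^sup>2 \<le> 1" using \<alpha> \<rho> by (simp add: power_le_one)
  then have "\<rho>\<^sup>2 * \<alpha> \<le> 1 * \<alpha>" using \<alpha> by (intro mult_right_mono) auto
  then have \<theta>1: "\<theta> \<le> \<alpha> / 16" by (simp add: \<theta>_def)
  \<comment> \<open>With \<open>u\<close> = 2 * s0 / k \<le> 2 * \<kappa> both \<open>u\<close> and
    \<open>sqrt u\<close> are at most \<theta>/15, which makes u + 14 * sqrt u at most
    \<theta>.\<close>
  define \<kappa> where "\<kappa> = (\<theta> / 15)\<^sup>2 / 2"
  have \<kappa>0: "\<kappa> > 0" using \<theta>0 by (simp add: \<kappa>_def)
  have "(\<theta> / 15) * (\<theta> / 15) \<le> (\<theta> / 15) * 1"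
    using \<theta>0 \<theta>1 \<alpha> by (intro mult_left_mono) auto
  then have \<kappa>1: "2 * \<kappa> \<le> \<theta> / 15" by (simp add: \<kappa>_def power2_eq_square)
  have "\<forall>\<^sub>F k::nat in sequentially. 1 \<le> \<kappa> * real k \<and> 90 / (\<theta> * \<kappa>) \<le> sqrt (real k) \<and> 24 / \<alpha> \<le> real k \<and> 5 \<le> k"
  proof (intro eventually_conj)
    show "\<forall>\<^sub>F k::nat in sequentially. 1 \<le> \<kappa> * real k" using \<kappa>0 by real_asymp
    show "\<forall>\<^sub>F k::nat in sequentially. 90 / (\<theta> * \<kappa>) \<le> sqrt (real k)" by real_asymp
    show "\<forall>\<^sub>F k::nat in sequentially. 24 / \<alpha> \<le> real k" by real_asymp
  qed (rule eventually_ge_at_top)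
  \<comment> \<open>The bound on \<open>sqrt k\<close> gives 45 / sqrt k \<le> \<theta> * \<kappa> /
    2, where 45 = 3 + 14 * 3 uses sqrt 5 \<le> 3. The first condition keeps \<open>s0\<close>
    positive and at least half of \<kappa> * k, and the third gives 3 / k \<le> \<alpha>/8.\<close>
  then obtain k0 where k0: "\<And>k. k \<ge> k0 \<Longrightarrow> 1 \<le> \<kappa> * real k \<and> 90 / (\<theta> * \<kappa>) \<le> sqrt (real k) \<and> 24 / \<alpha> \<le> real k \<and> 5 \<le> k"
    by (auto simp: eventually_sequentially)
  obtain p where p: "prime p" "k0 + 2 < p" using bigger_prime by blast
  define k where "k = p - 1"
  have k: "1 \<le> \<kappa> * real k" "90 / (\<theta> * \<kappa>) \<le> sqrt (real k)" "24 / \<alpha> \<le> real k" "5 \<le> k"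
    using k0[of k] p(2) by (auto simp: k_def)
  have kpos: "real k \<ge> 5" using k(4) by simp
  define s0 where "s0 = nat \<lfloor>\<kappa> * real k\<rfloor>"
  have s0: "real s0 \<le> \<kappa> * k" "\<kappa> * k / 2 \<le> real s0" "1 \<le> s0"
  proof -
    have "1 \<le> \<lfloor>\<kappa> * real k\<rfloor>" using k(1) by linarith
    moreover from this have "real s0 = of_int \<lfloor>\<kappa> * real k\<rfloor>" by (simp add: s0_def)
    ultimately show "real s0 \<le> \<kappa> * k" "\<kappa> * k / 2 \<le> real s0" "1 \<le> s0" by linarith+
  qed
  define \<epsilon> where "\<epsilon> = \<alpha> / (100 * (real k)\<^sup>2)"
  define u where "u = 2 * real s0 / real k"
  have u: "0 \<le> u" "u \<le> (\<theta> / 15)\<^sup>2" "\<kappa> \<le> u"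
  proof -
    show "0 \<le> u" by (simp add: u_def)
    have "u \<le> 2 * (\<kappa> * k) / real k" unfolding u_def using s0(1) by (intro divide_right_mono) auto
    then show "u \<le> (\<theta> / 15)\<^sup>2" using kpos by (simp add: \<kappa>_def)
    show "\<kappa> \<le> u" using s0(2) kpos by (simp add: u_def field_simps)
  qed
  have u1: "u \<le> \<theta> / 15" using u(2) \<kappa>1 by (simp add: \<kappa>_def)
  show thesis
  proof (rule that[of p k \<epsilon> s0])
    show "odd p" using prime_odd_nat[OF p(1)] p(2) by simp
    show "0 < \<epsilon>" using \<alpha> kpos by (simp add: \<epsilon>_def)
    show "100 * (real k)\<^sup>2 * \<epsilon> \<le> \<alpha>" using kpos by (simp add: \<epsilon>_def)
    have "\<kappa> * k \<le> 1 / 4 * k" using \<kappa>1 \<theta>1 \<alpha> by (intro mult_right_mono) auto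
    then show s4: "4 * s0 \<le> k" using s0(1) by linarith
    then show "s0 \<le> k" by simp
    have sk: "1 / sqrt k \<le> \<theta> * \<kappa> / 90"
      using k(2) \<theta>0 \<kappa>0 kpos by (simp add: field_simps)
    have "sqrt k * 1 \<le> sqrt k * sqrt k" using kpos by (intro mult_left_mono) auto
    then have "sqrt k \<le> k" using kpos by simp
    then have "1 / real k \<le> 1 / sqrt k" using kpos by (intro divide_left_mono) auto
    moreover have "sqrt (5 / real k) \<le> 3 * (1 / sqrt k)"
    proof -
      have "sqrt 5 \<le> sqrt (3\<^sup>2)" by (intro real_sqrt_le_mono) simp
      then have "sqrt 5 \<le> 3" by simp
      then show ?thesis using kpos by (simp add: real_sqrt_divide divide_right_mono)
    qed
    ultimately have "3 / real k + 14 * sqrt (5 / real k) \<le> 45 * (1 / sqrt k)" by simp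
    also have "\<dots> \<le> \<theta> * \<kappa> / 2" using sk by simp
    also have "\<dots> \<le> \<theta> * u / 2" using u(3) \<theta>0 by simp
    also have "\<dots> = \<rho>\<^sup>2 * (real s0 * \<alpha> / (4 * real k)) / 4" by (simp add: \<theta>_def u_def)
    finally show "3 / real k + 14 * sqrt (5 / real k) \<le> \<rho>\<^sup>2 * (real s0 * \<alpha> / (4 * real k)) / 4" .
    have su: "sqrt u \<le> \<theta> / 15" using real_sqrt_le_mono[OF u(2)] \<theta>0 by simp
    have "u + 14 * sqrt u \<le> \<theta>" using su u1 by linarith
    then show "2 * real s0 / real k + 14 * sqrt (2 * real s0 / real k) \<le> \<rho>\<^sup>2 * (\<alpha> / 2) / 8"
      by (simp add: u_def \<theta>_def)
    have "3 / real k \<le> \<alpha> / 8" using k(3) \<alpha> kpos by (simp add: field_simps)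
    moreover have "\<epsilon> \<le> \<alpha> / 100"
    proof -
      have "1 \<le> (real k)\<^sup>2" using kpos by (simp add: one_le_power)
      then have "\<alpha> / (100 * (real k)\<^sup>2) \<le> \<alpha> / 100" using \<alpha> kpos by (intro divide_left_mono) auto
      then show ?thesis by (simp add: \<epsilon>_def)
    qed
    ultimately show "2 * real s0 / real k + 3 / real k + 2 * \<epsilon> \<le> \<alpha> / 2"
      using u1 \<theta>1 \<alpha> unfolding u_def by simp
  qed (use p k_def s0 k in auto)
qed

theorem theorem6:
  "\<exists>\<alpha>\<^sub>0::real. \<alpha>\<^sub>0 > 0 \<and>
    (\<forall>\<alpha>::real. 0 < \<alpha> \<and> \<alpha> \<le> \<alpha>\<^sub>0 \<longrightarrow>
      (\<exists>n\<^sub>0::nat. \<forall>(V::'a set) (E::'a set set) (n::nat).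
        simple_graph V E \<and> card V = n \<and> n \<ge> n\<^sub>0 \<and>
        real (min_degree V E) \<ge> (1/2 + \<alpha>) * real n \<and>
        real (max_degree V E) \<le> real (min_degree V E) + \<alpha>\<^sup>2 * real n / 5 \<longrightarrow>
        (\<exists>H. edge_disjoint_hamilton_cycles V E H \<and>
             real (card H) \<ge> (real (min_degree V E) - \<alpha> * real n) / 2)))"
proof (rule exI[of _ "1::real"], intro conjI allI impI)
  fix \<alpha> :: real
  assume "0 < \<alpha> \<and> \<alpha> \<le> 1"
  then have \<alpha>: "0 < \<alpha>" "\<alpha> \<le> 1" by auto
  define \<rho> where "\<rho> = \<alpha> / 64"
  obtain p k s0 :: nat and \<epsilon> where par: "prime p" "odd p" "k = p - 1" "0 < \<epsilon>" "100 * (real k)\<^sup>2 * \<epsilon> \<le> \<alpha>"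
    "1 \<le> s0" "s0 \<le> k"
    "3 / real k + 14 * sqrt (5 / real k) \<le> \<rho>\<^sup>2 * (real s0 * \<alpha> / (4 * real k)) / 4"
    "2 * real s0 / real k + 14 * sqrt (2 * real s0 / real k) \<le> \<rho>\<^sup>2 * (\<alpha> / 2) / 8"
    "2 * real s0 / real k + 3 / real k + 2 * \<epsilon> \<le> \<alpha> / 2" "5 \<le> k" "4 * s0 \<le> k"
    by (rule packing_constants[OF \<alpha> \<rho>_def])
  \<comment> \<open>Everything here depends on \<alpha> alone, so one threshold serves all graphs.
    The factor 1 and the exponent 1 in the condition for the rounding step give it the form of
    \<open>eventually_union_bound_small\<close>.\<close>
  define P where "P n \<longleftrightarrow> real k * real n ^ 3 * (2 * exp (- (2 * \<epsilon>\<^sup>2) * real n)) < 1 \<and>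
    2 * real n ^ 3 * (2 * exp (- (\<rho> ^ 4 * (real s0 * \<alpha> / (4 * real k))\<^sup>2 / 32) * real n)) < 1 \<and>
    2 * real n ^ 3 * (2 * exp (- (\<rho> ^ 4 * (\<alpha> / 2 / 2)\<^sup>2 / 32) * real n)) < 1 \<and>
    1 * real n ^ 1 * (2 * exp (- (2 * \<epsilon>\<^sup>2) * real n)) < 1 \<and>
    1 \<le> \<epsilon> * n \<and> 2 \<le> sqrt (5 / real k) * n \<and> 2 \<le> sqrt (2 * real s0 / real k) * n \<and> 4 \<le> n" for n :: nat
  have big: "\<forall>\<^sub>F n::nat in sequentially. c \<le> a * real n" if "a > 0" for a c :: real
    using that by real_asymp
  have "\<forall>\<^sub>F n in sequentially. P n"
    unfolding P_def
    by (intro eventually_conj eventually_union_bound_small big eventually_ge_at_top)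
      (use par \<alpha> in \<open>auto simp: \<rho>_def\<close>)
  then obtain n0 where n0: "\<And>n. n \<ge> n0 \<Longrightarrow> P n" by (auto simp: eventually_sequentially)
  show "\<exists>n\<^sub>0::nat. \<forall>(V::'a set) (E::'a set set) (n::nat).
        simple_graph V E \<and> card V = n \<and> n \<ge> n\<^sub>0 \<and>
        real (min_degree V E) \<ge> (1/2 + \<alpha>) * real n \<and>
        real (max_degree V E) \<le> real (min_degree V E) + \<alpha>\<^sup>2 * real n / 5 \<longrightarrow>
        (\<exists>H. edge_disjoint_hamilton_cycles V E H \<and>
             real (card H) \<ge> (real (min_degree V E) - \<alpha> * real n) / 2)"
  proof (intro exI[of _ n0] allI impI)
    fix V :: "'a set" and E :: "'a set set" and n :: nat
    define d where "d = real (min_degree V E)"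
    assume "simple_graph V E \<and> card V = n \<and> n \<ge> n0 \<and>
        real (min_degree V E) \<ge> (1/2 + \<alpha>) * real n \<and>
        real (max_degree V E) \<le> real (min_degree V E) + \<alpha>\<^sup>2 * real n / 5"
    then have G: "simple_graph V E" "card V = n" and "n \<ge> n0"
      and d: "(1/2 + \<alpha>) * n \<le> d" and \<Delta>: "real (max_degree V E) \<le> d + \<alpha>\<^sup>2 * n / 5"
      by (auto simp: d_def)
    then have P: "P n" using n0 by simp
    then have n: "4 \<le> n" by (simp add: P_def)
    have finV: "finite V" using G by (simp add: simple_graph_def)
    have ne: "V \<noteq> {}" using G n by auto
    have lo: "d \<le> card (nbr E v)" and hi: "card (nbr E v) \<le> d + \<alpha>\<^sup>2 * n / 5" if "v \<in> V" for v
    proof -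
      have "min_degree V E \<le> Defs.degree E v" "Defs.degree E v \<le> max_degree V E"
        using that finV by (auto simp: min_degree_def max_degree_def)
      then show "d \<le> card (nbr E v)" "card (nbr E v) \<le> d + \<alpha>\<^sup>2 * n / 5"
        using \<Delta> degree_eq_card_nbr[OF G(1), of v] by (auto simp: d_def)
    qed
    have dn: "d \<le> n"
    proof -
      obtain v where "v \<in> V" using ne by blast
      then show ?thesis using lo[of v] card_nbr_le[OF G(1), of v] G(2) by linarith
    qed
    define r where "r = (1 - \<alpha> / 5) * d"
    have npos: "n > 0" using n by simp
    obtain W where W: "\<And>e. e \<in> E \<Longrightarrow> 0 \<le> W e \<and> W e \<le> (1::real)"
      "\<And>u. u \<in> V \<Longrightarrow> (\<Sum>e | e \<in> E \<and> u \<in> e. W e) = r"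
      using fractional_regular[OF G npos \<alpha> lo hi d] unfolding r_def by blast
    have sm: "real (card V) * (2 * exp (- (2 * \<epsilon>\<^sup>2) * real (card V))) < 1"
      using P G(2) by (simp add: P_def)
    have V1: "1 \<le> card V" using n G(2) by simp
    obtain E' where E': "E' \<subseteq> E" "\<forall>v\<in>V. \<bar>real (card (nbr E' v)) - r\<bar> < \<epsilon> * card V"
      using random_subgraph[OF par(4) G(1) V1 W sm] by blast
    have G': "simple_graph V E'" by (rule simple_graph_subset[OF G(1) E'(1)])
    have \<alpha>\<alpha>: "\<alpha> * \<alpha> \<le> \<alpha> * 1" using \<alpha> by (intro mult_left_mono) auto
    \<comment> \<open>The factor 1 - \<alpha>/5 takes at most \<alpha>/10 + \<alpha>/5 from 1/2 +
      \<alpha>, so the degrees keep a linear margin over n/2.\<close>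
    have "(1/2 + \<alpha>/2) * n \<le> ((1 - \<alpha> / 5) * (1/2 + \<alpha>)) * n"
      using \<alpha> \<alpha>\<alpha> by (intro mult_right_mono) (auto simp: algebra_simps)
    also have "\<dots> = (1 - \<alpha> / 5) * ((1/2 + \<alpha>) * n)" by simp
    also have "\<dots> \<le> r" unfolding r_def using d \<alpha> by (intro mult_left_mono) auto
    finally have r1: "(1/2 + \<alpha>/2) * n \<le> r" .
    have d0: "0 \<le> d" by (simp add: d_def)
    have r2: "r \<le> n"
    proof -
      have "r \<le> 1 * d" unfolding r_def using \<alpha> d0 by (intro mult_right_mono) auto
      then show ?thesis using dn by simp
    qed
    have "\<exists>H. edge_disjoint_hamilton_cycles V E' H \<and> r / 2 - \<alpha> * n / 4 \<le> card H"
    proof (rule near_regular_packing[OF G' G(2) n par(1-3) \<alpha> par(4) _ par(5) _ r1 r2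
          par(6,7) \<rho>_def par(8-12)])
      show "\<bar>real (card (nbr E' v)) - r\<bar> < \<epsilon> * n" if "v \<in> V" for v
        using E'(2) that G(2) by simp
    qed (use P in \<open>simp_all add: P_def\<close>)
    then obtain H where H: "edge_disjoint_hamilton_cycles V E' H" "r / 2 - \<alpha> * n / 4 \<le> card H" by blast
    have "\<alpha> * d \<le> \<alpha> * n" using \<alpha> dn by (intro mult_left_mono) auto
    moreover have "r = d - \<alpha> * d / 5" by (simp add: r_def algebra_simps)
    moreover have "0 \<le> \<alpha> * n" using \<alpha> by simp
    \<comment> \<open>The losses \<alpha> * d / 10 and \<alpha> * n / 4 add up to at most 7/20 of
      \<alpha> * n, which is less than the permitted half.\<close>
    moreover have "(d - a) / 2 \<le> c"
      if "b \<le> a" "r = d - b / 5" "0 \<le> a" "r / 2 - a / 4 \<le> c" for a b c :: real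
      using that by (simp add: field_simps)
    ultimately have "(d - \<alpha> * n) / 2 \<le> card H" using H(2) by blast
    then show "\<exists>H. edge_disjoint_hamilton_cycles V E H \<and>
             real (card H) \<ge> (real (min_degree V E) - \<alpha> * real n) / 2"
      using edge_disjoint_hamilton_cycles_mono[OF H(1) E'(1)] by (auto simp: d_def)
  qed
qed simp

end
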